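(* Define $b:\mathbb{Z}^+\to\mathbb{Z}^+$ by $b(1)=2$, $b(2)=6$, $b(3)=12$, $b(4)=24$, $b(5)=40$, $b(6)=72$, and $b(n)=2^n$ for all $n\geq 7$. Then for every positive integer $n$, $\operatorname{rdim}(n)\geq b(n)$.
   Context: Let $k$ be a field with separable closure $k_s$. An (algebraic) torus over $k$ is an algebraic group over $k$ that becomes isomorphic over $k_s$ to a finite product of copies of the multiplicative group. The representation dimension $\operatorname{rdim}(T)$ of a torus $T$ over $k$ is the minimal positive integer $r$ such that there exists a faithful embedding $T\hookrightarrow \operatorname{GL}_r$ (over $k$). For a positive integer $n$, $\operatorname{rdim}(n):=\max\{\operatorname{rdim}(T) \mid T \text{ a torus},\ \dim(T)=n\}$, where the maximum is taken over all $n$-dimensional tori over all fields (this maximum exists). *)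

theory Defs
  imports "HOL-Algebra.Algebra" "HOL-Algebra.Product_Groups" "HOL-Algebra.Generated_Rings"
    "HOL-Algebra.Algebraic_Closure" "HOL-Library.Extended_Nat"
begin

text \<open>
  Affine group schemes over a field \<open>k\<close> are represented by their functor of points: a
  \<open>k\<close>-algebra \<open>A\<close> (the coordinate ring) together with a functorial group structure on the sets
  \<open>Hom\<^sub>k(A, R)\<close>, for \<open>R\<close> a commutative \<open>k\<close>-algebra.  One type \<open>'a\<close> plays the role of the universe:
  all fields and algebras have their carriers in it.  If \<open>'a\<close> is infinite, it is closed (up to
  isomorphism) under tensor products of algebras, finitely generated algebras and separable
  closures, so that Yoneda's lemma is available inside the universe.
\<close>

type_synonym 'a alg = "('a, 'a) module"
type_synonym 'a gfunctor = "'a alg \<Rightarrow> ('a \<Rightarrow> 'a) monoid"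


section \<open>Separable closure\<close>

text \<open>In HOL-Algebra a polynomial is the list of its coefficients, leading coefficient first.\<close>

definition poly_deriv :: "('a, 'm) ring_scheme \<Rightarrow> 'a list \<Rightarrow> 'a list" where
  "poly_deriv R p =
     ring.normalize R (map (\<lambda>i. add_pow R (length p - 1 - i) (p ! i)) [0..<length p - 1])"

definition separable_poly :: "('a, 'm) ring_scheme \<Rightarrow> 'a list \<Rightarrow> bool" where
  "separable_poly R p \<longleftrightarrow> p \<in> carrier (poly_ring R) \<and>
     (\<forall>d \<in> carrier (poly_ring R).
        d pdivides\<^bsub>R\<^esub> p \<and> d pdivides\<^bsub>R\<^esub> (poly_deriv R p) \<longrightarrow> d \<in> Units (poly_ring R))"

definition separable_closure :: "'a ring \<Rightarrow> 'a ring \<Rightarrow> ('a \<Rightarrow> 'a) \<Rightarrow> bool" where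
  "separable_closure k K \<iota> \<longleftrightarrow> field k \<and> field K \<and> \<iota> \<in> ring_hom k K \<and>
     (\<forall>x \<in> carrier K. \<exists>p. separable_poly k p \<and> ring.eval K (map \<iota> p) x = \<zero>\<^bsub>K\<^esub>) \<and>
     (\<forall>p. separable_poly K p \<longrightarrow> ring.splitted K p)"


section \<open>Algebras and algebraic groups\<close>

definition alg_hom :: "'a ring \<Rightarrow> 'a alg \<Rightarrow> 'a alg \<Rightarrow> ('a \<Rightarrow> 'a) set" where
  "alg_hom k A R =
     {f \<in> carrier A \<rightarrow>\<^sub>E carrier R. f \<in> ring_hom A R \<and>
        (\<forall>c \<in> carrier k. \<forall>a \<in> carrier A. f (c \<odot>\<^bsub>A\<^esub> a) = c \<odot>\<^bsub>R\<^esub> f a)}"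

definition generate_alg :: "'a ring \<Rightarrow> 'a alg \<Rightarrow> 'a set \<Rightarrow> 'a set" where
  "generate_alg k A H = generate_ring A ({c \<odot>\<^bsub>A\<^esub> \<one>\<^bsub>A\<^esub> | c. c \<in> carrier k} \<union> H)"

text \<open>Restriction of scalars along \<open>\<iota> : k \<rightarrow> K\<close>, turning a \<open>K\<close>-algebra into a \<open>k\<close>-algebra.\<close>

definition restrict_scalars :: "('a \<Rightarrow> 'a) \<Rightarrow> 'a alg \<Rightarrow> 'a alg" where
  "restrict_scalars \<iota> R = R\<lparr>smult := (\<lambda>c x. \<iota> c \<odot>\<^bsub>R\<^esub> x)\<rparr>"

definition affine_group_scheme :: "'a ring \<Rightarrow> 'a alg \<Rightarrow> 'a gfunctor \<Rightarrow> bool" where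
  "affine_group_scheme k A T \<longleftrightarrow> field k \<and> algebra k A \<and>
     (\<forall>R. algebra k R \<longrightarrow> group (T R) \<and> carrier (T R) = alg_hom k A R) \<and>
     (\<forall>R S f. algebra k R \<longrightarrow> algebra k S \<longrightarrow> f \<in> alg_hom k R S \<longrightarrow>
        (\<lambda>x. compose (carrier A) f x) \<in> hom (T R) (T S))"

definition affine_algebraic_group :: "'a ring \<Rightarrow> 'a alg \<Rightarrow> 'a gfunctor \<Rightarrow> bool" where
  "affine_algebraic_group k A T \<longleftrightarrow> affine_group_scheme k A T \<and>
     (\<exists>H. finite H \<and> H \<subseteq> carrier A \<and> generate_alg k A H = carrier A)"


section \<open>Tori\<close>

definition Gm_power :: "nat \<Rightarrow> 'a alg \<Rightarrow> (nat \<Rightarrow> 'a) monoid" where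
  "Gm_power n R = product_group {..<n} (\<lambda>_. units_of R)"

text \<open>
  The base change of \<open>T\<close> to \<open>K\<close> is the functor sending a \<open>K\<close>-algebra \<open>R\<close> to \<open>T R\<close> with \<open>R\<close> regarded
  as a \<open>k\<close>-algebra (it is represented by \<open>K \<otimes>\<^sub>k A\<close>).  The dimension of a torus is the number of
  copies of the multiplicative group.
\<close>

definition base_change_iso_Gm_power ::
    "'a ring \<Rightarrow> ('a \<Rightarrow> 'a) \<Rightarrow> 'a alg \<Rightarrow> 'a gfunctor \<Rightarrow> nat \<Rightarrow> bool" where
  "base_change_iso_Gm_power K \<iota> A T n \<longleftrightarrow>
     (\<exists>\<phi>. (\<forall>R. algebra K R \<longrightarrow> \<phi> R \<in> iso (T (restrict_scalars \<iota> R)) (Gm_power n R)) \<and>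
          (\<forall>R S f x. algebra K R \<longrightarrow> algebra K S \<longrightarrow> f \<in> alg_hom K R S \<longrightarrow>
             x \<in> carrier (T (restrict_scalars \<iota> R)) \<longrightarrow>
             \<phi> S (compose (carrier A) f x) = compose {..<n} f (\<phi> R x)))"

definition torus_of_dim :: "'a ring \<Rightarrow> 'a alg \<Rightarrow> 'a gfunctor \<Rightarrow> nat \<Rightarrow> bool" where
  "torus_of_dim k A T n \<longleftrightarrow> affine_algebraic_group k A T \<and>
     (\<exists>K \<iota>. separable_closure k K \<iota> \<and> base_change_iso_Gm_power K \<iota> A T n)"


section \<open>Representation dimension\<close>

definition mat_monoid :: "nat \<Rightarrow> 'a alg \<Rightarrow> (nat \<times> nat \<Rightarrow> 'a) monoid" where
  "mat_monoid r R =
     \<lparr>carrier = {..<r} \<times> {..<r} \<rightarrow>\<^sub>E carrier R,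
      monoid.mult = (\<lambda>M N. \<lambda>(i, j) \<in> {..<r} \<times> {..<r}.
        \<Oplus>\<^bsub>R\<^esub>l\<in>{..<r}. M (i, l) \<otimes>\<^bsub>R\<^esub> N (l, j)),
      one = (\<lambda>(i, j) \<in> {..<r} \<times> {..<r}. if i = j then \<one>\<^bsub>R\<^esub> else \<zero>\<^bsub>R\<^esub>)\<rparr>"

definition GL :: "nat \<Rightarrow> 'a alg \<Rightarrow> (nat \<times> nat \<Rightarrow> 'a) monoid" where
  "GL r R = units_of (mat_monoid r R)"

definition representation ::
    "'a ring \<Rightarrow> 'a alg \<Rightarrow> 'a gfunctor \<Rightarrow> nat \<Rightarrow> ('a alg \<Rightarrow> ('a \<Rightarrow> 'a) \<Rightarrow> (nat \<times> nat \<Rightarrow> 'a)) \<Rightarrow> bool" where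
  "representation k A T r \<rho> \<longleftrightarrow>
     (\<forall>R. algebra k R \<longrightarrow> \<rho> R \<in> hom (T R) (GL r R)) \<and>
     (\<forall>R S f x. algebra k R \<longrightarrow> algebra k S \<longrightarrow> f \<in> alg_hom k R S \<longrightarrow> x \<in> carrier (T R) \<longrightarrow>
        \<rho> S (compose (carrier A) f x) = compose ({..<r} \<times> {..<r}) f (\<rho> R x))"

text \<open>
  A representation is a closed immersion iff its comorphism \<open>k[GL\<^sub>r] \<rightarrow> A\<close> is surjective.  As
  \<open>k[GL\<^sub>r]\<close> is generated by the entries of the generic matrix and of its inverse, the image of the
  comorphism is generated by the entries of \<open>M\<close> and its inverse, where \<open>M\<close> in \<open>GL\<^sub>r(A)\<close> is the
  image of the universal point, i.e. the identity of \<open>A\<close>.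
\<close>

definition faithful_embedding ::
    "'a ring \<Rightarrow> 'a alg \<Rightarrow> 'a gfunctor \<Rightarrow> nat \<Rightarrow> ('a alg \<Rightarrow> ('a \<Rightarrow> 'a) \<Rightarrow> (nat \<times> nat \<Rightarrow> 'a)) \<Rightarrow> bool" where
  "faithful_embedding k A T r \<rho> \<longleftrightarrow> representation k A T r \<rho> \<and>
     (let M = \<rho> A (\<lambda>a \<in> carrier A. a) in
        generate_alg k A
          (M ` ({..<r} \<times> {..<r}) \<union> (inv\<^bsub>GL r A\<^esub> M) ` ({..<r} \<times> {..<r})) = carrier A)"

definition rdim :: "'a ring \<Rightarrow> 'a alg \<Rightarrow> 'a gfunctor \<Rightarrow> nat" where
  "rdim k A T = (LEAST r. r > 0 \<and> (\<exists>\<rho>. faithful_embedding k A T r \<rho>))"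

text \<open>
  The maximum of \<open>rdim\<close> over all \<open>n\<close>-dimensional tori over all fields in the universe \<open>'a\<close>, written
  as a supremum in \<open>enat\<close>, which is the maximum whenever the maximum exists.
\<close>

definition max_rdim :: "'a itself \<Rightarrow> nat \<Rightarrow> enat" where
  "max_rdim (_ :: 'a itself) n =
     Sup {enat (rdim k A T) | (k :: 'a ring) A T. torus_of_dim k A T n}"


definition b :: "nat \<Rightarrow> nat" where
  "b n = (if n = 1 then 2 else if n = 2 then 6 else if n = 3 then 12 else if n = 4 then 24
          else if n = 5 then 40 else if n = 6 then 72 else 2 ^ n)"

end

theory Submission
  imports Defs "HOL-Algebra.Algebraic_Closure_Type" "HOL-Library.Poly_Mapping"
    "HOL-Computational_Algebra.Fraction_Field" "HOL-Library.Function_Algebras" "HOL-Library.Countable_Set"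
begin

abbreviation mon :: "'v \<Rightarrow> 'l::zero \<Rightarrow> 'v \<Rightarrow>\<^sub>0 'l" where "mon \<equiv> Poly_Mapping.single"
abbreviation cf :: "('v \<Rightarrow>\<^sub>0 'l::zero) \<Rightarrow> 'v \<Rightarrow> 'l" where "cf \<equiv> Poly_Mapping.lookup"
abbreviation supp :: "('v \<Rightarrow>\<^sub>0 'l::zero) \<Rightarrow> 'v set" where "supp \<equiv> Poly_Mapping.keys"

lemma sum_mon: "(\<Sum>v\<in>supp p. mon v (cf p v)) = p"
proof (rule poly_mapping_eqI)
  fix w
  have "cf (\<Sum>v\<in>supp p. mon v (cf p v)) w = (\<Sum>v\<in>supp p. if v = w then cf p v else 0)"
    by (simp add: lookup_sum lookup_single when_def)
  also have "\<dots> = cf p w" by (simp add: in_keys_iff)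
  finally show "cf (\<Sum>v\<in>supp p. mon v (cf p v)) w = cf p w" .
qed

lemma cf_const_mult: "cf (mon 0 c * p) v = c * cf p v" for p :: "'v::monoid_add \<Rightarrow>\<^sub>0 'l::semiring_0"
  unfolding mult_map_scale_conv_mult[symmetric]
  by (transfer fixing: c) (simp add: when_def)

lemma mon_sum: "mon v (sum f I) = (\<Sum>i\<in>I. mon v (f i))" for f :: "_ \<Rightarrow> 'l::comm_monoid_add"
  by (induction I rule: infinite_finite_induct) (auto simp: single_add)

locale galois_action =
  fixes G :: "('v::ab_group_add \<Rightarrow> 'v) set"
    and act :: "('v \<Rightarrow> 'v) \<Rightarrow> 'l::field_char_0 \<Rightarrow> 'l"
  assumes finite_G: "finite G"
    and id_G: "id \<in> G"
    and comp_G: "\<And>g h. g \<in> G \<Longrightarrow> h \<in> G \<Longrightarrow> g \<circ> h \<in> G"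
    and inv_G: "\<And>g. g \<in> G \<Longrightarrow> inv_into UNIV g \<in> G"
    and bij_G: "\<And>g. g \<in> G \<Longrightarrow> bij g"
    and additive_G: "\<And>g u v. g \<in> G \<Longrightarrow> g (u + v) = g u + g v"
    and act_add: "\<And>g c d. g \<in> G \<Longrightarrow> act g (c + d) = act g c + act g d"
    and act_mult: "\<And>g c d. g \<in> G \<Longrightarrow> act g (c * d) = act g c * act g d"
    and act_1: "\<And>g. g \<in> G \<Longrightarrow> act g 1 = 1"
    and act_comp: "\<And>g h c. g \<in> G \<Longrightarrow> h \<in> G \<Longrightarrow> act (g \<circ> h) c = act g (act h c)"
    and act_id: "\<And>c. act id c = c"
begin

definition k0 :: "'l set" where "k0 = {c. \<forall>g\<in>G. act g c = c}"

definition Tr :: "'l \<Rightarrow> 'l" where "Tr c = (\<Sum>g\<in>G. act g c)"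

definition \<tau> :: "'l \<Rightarrow> 'v \<Rightarrow> 'v \<Rightarrow>\<^sub>0 'l" where
  "\<tau> c v = (\<Sum>g\<in>G. mon (g v) (act g c))"

lemma act_0: "g \<in> G \<Longrightarrow> act g 0 = 0"
  using act_add[of g 0 0] by simp

lemma act_uminus: "g \<in> G \<Longrightarrow> act g (- c) = - act g c"
  using act_add[of g c "- c"] act_0 by (simp add: eq_neg_iff_add_eq_0 add.commute)

lemma act_sum: "g \<in> G \<Longrightarrow> act g (sum f I) = (\<Sum>i\<in>I. act g (f i))"
  by (induction I rule: infinite_finite_induct) (auto simp: act_0 act_add)

lemma act_power: "g \<in> G \<Longrightarrow> act g (c ^ i) = act g c ^ i"
  by (induction i) (auto simp: act_1 act_mult)

lemma act_of_nat: "g \<in> G \<Longrightarrow> act g (of_nat i) = of_nat i"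
  by (induction i) (auto simp: act_0 act_1 act_add)

lemma inv_G_apply [simp]: "g \<in> G \<Longrightarrow> g (inv_into UNIV g v) = v" "g \<in> G \<Longrightarrow> inv_into UNIV g (g v) = v"
  using bij_G[of g] by (simp_all add: bij_is_surj surj_f_inv_f bij_is_inj)

lemma comp_inv_G: "g \<in> G \<Longrightarrow> g \<circ> inv_into UNIV g = id" "g \<in> G \<Longrightarrow> inv_into UNIV g \<circ> g = id"
  by (auto simp: fun_eq_iff)

lemma act_inv [simp]: "g \<in> G \<Longrightarrow> act g (act (inv_into UNIV g) c) = c"
    "g \<in> G \<Longrightarrow> act (inv_into UNIV g) (act g c) = c"
  by (simp_all add: act_comp[symmetric] inv_G comp_inv_G act_id)

lemma act_inverse:
  assumes g: "g \<in> G" shows "act g (inverse c) = inverse (act g c)"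
proof (cases "c = 0")
  case False
  then have "act g c * act g (inverse c) = 1"
    using g by (simp add: act_mult[symmetric] act_1)
  then show ?thesis by (metis inverse_unique)
qed (use g in \<open>simp add: act_0\<close>)

lemma act_eq_0_iff: "g \<in> G \<Longrightarrow> act g c = 0 \<longleftrightarrow> c = 0"
  by (metis act_0 act_inv(2) inv_G)

lemma G_zero: "g \<in> G \<Longrightarrow> g 0 = 0"
  using additive_G[of g 0 0] by simp

lemma G_uminus: "g \<in> G \<Longrightarrow> g (- v) = - g v"
  using additive_G[of g v "- v"] G_zero[of g] by (simp add: eq_neg_iff_add_eq_0 add.commute)

lemma inj_G: "g \<in> G \<Longrightarrow> g u = g v \<longleftrightarrow> u = v"
  by (metis inv_G_apply(2))

lemma G_zero_iff: "g \<in> G \<Longrightarrow> g v = 0 \<longleftrightarrow> v = 0"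
  using inj_G[of g v 0] by (simp add: G_zero)

lemma bij_left: "g \<in> G \<Longrightarrow> bij_betw ((\<circ>) g) G G"
  by (rule bij_betwI[where g = "(\<circ>) (inv_into UNIV g)"])
     (auto simp: comp_G inv_G comp_assoc[symmetric] comp_inv_G)

lemma bij_right: "g \<in> G \<Longrightarrow> bij_betw (\<lambda>h. h \<circ> g) G G"
  by (rule bij_betwI[where g = "\<lambda>h. h \<circ> inv_into UNIV g"])
     (auto simp: comp_G inv_G comp_assoc comp_inv_G)

lemma sum_G_left: "g \<in> G \<Longrightarrow> (\<Sum>h\<in>G. f (g \<circ> h)) = (\<Sum>h\<in>G. f h)"
  by (rule sum.reindex_bij_betw[OF bij_left])

lemma sum_G_right: "g \<in> G \<Longrightarrow> (\<Sum>h\<in>G. f (h \<circ> g)) = (\<Sum>h\<in>G. f h)"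
  using sum.reindex_bij_betw[OF bij_right, of g f] by simp

lemma card_G_pos: "card G > 0"
  using id_G finite_G by (auto simp: card_gt_0_iff)

lemma k0_closed [intro]:
  "0 \<in> k0" "1 \<in> k0" "c \<in> k0 \<Longrightarrow> d \<in> k0 \<Longrightarrow> c + d \<in> k0" "c \<in> k0 \<Longrightarrow> d \<in> k0 \<Longrightarrow> c * d \<in> k0"
  "c \<in> k0 \<Longrightarrow> - c \<in> k0" "c \<in> k0 \<Longrightarrow> inverse c \<in> k0"
  by (auto simp: k0_def act_0 act_1 act_add act_mult act_uminus act_inverse)

lemma k0_of_nat: "of_nat i \<in> k0"
  by (simp add: k0_def act_of_nat)

lemma k0_act: "c \<in> k0 \<Longrightarrow> g \<in> G \<Longrightarrow> act g c = c"
  by (simp add: k0_def)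

lemma Tr_k0: "Tr c \<in> k0"
proof -
  have "act g (Tr c) = Tr c" if g: "g \<in> G" for g
  proof -
    have "act g (Tr c) = (\<Sum>h\<in>G. act (g \<circ> h) c)"
      using g by (simp add: Tr_def act_sum act_comp)
    then show ?thesis using sum_G_left[OF g, of "\<lambda>h. act h c"] by (simp add: Tr_def)
  qed
  then show ?thesis by (simp add: k0_def)
qed

lemma Tr_add: "Tr (c + d) = Tr c + Tr d"
  by (simp add: Tr_def act_add sum.distrib)

lemma Tr_0: "Tr 0 = 0" by (simp add: Tr_def act_0)

lemma Tr_scale: "c \<in> k0 \<Longrightarrow> Tr (c * d) = c * Tr d"
  by (simp add: Tr_def act_mult k0_act sum_distrib_left)

lemma Tr_act: "g \<in> G \<Longrightarrow> Tr (act g c) = Tr c"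
  using sum_G_right[of g "\<lambda>h. act h c"] by (simp add: Tr_def act_comp)

lemma cf_\<tau>: "cf (\<tau> c v) w = (\<Sum>g\<in>G. if g v = w then act g c else 0)"
  by (simp add: \<tau>_def lookup_sum lookup_single when_def)

lemma \<tau>_add: "\<tau> (c + d) v = \<tau> c v + \<tau> d v"
  by (simp add: \<tau>_def act_add single_add sum.distrib)

lemma \<tau>_0: "\<tau> 0 v = 0"
  by (simp add: \<tau>_def act_0)

lemma \<tau>_scale: "c \<in> k0 \<Longrightarrow> \<tau> (c * d) v = mon 0 c * \<tau> d v"
  by (simp add: \<tau>_def act_mult k0_act sum_distrib_left mult_single)

lemma \<tau>_act: "g \<in> G \<Longrightarrow> \<tau> (act g c) (g v) = \<tau> c v"
  using sum_G_right[of g "\<lambda>h. mon (h v) (act h c)"] by (simp add: \<tau>_def act_comp)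

lemma \<tau>_zero: "\<tau> c 0 = mon 0 (Tr c)"
  by (simp add: \<tau>_def Tr_def G_zero mon_sum)

lemma \<tau>_mult: "\<tau> c u * \<tau> d v = (\<Sum>g\<in>G. \<tau> (c * act g d) (u + g v))"
proof -
  have "(\<Sum>g\<in>G. \<tau> (c * act g d) (u + g v))
      = (\<Sum>h\<in>G. \<Sum>g\<in>G. mon (h u + (h \<circ> g) v) (act h c * act (h \<circ> g) d))"
    unfolding \<tau>_def by (subst sum.swap) (simp add: act_mult act_comp additive_G)
  also have "\<dots> = (\<Sum>h\<in>G. \<Sum>g\<in>G. mon (h u + g v) (act h c * act g d))"
  proof (rule sum.cong[OF refl])
    fix h assume "h \<in> G"
    from sum_G_left[OF this, of "\<lambda>g. mon (h u + g v) (act h c * act g d)"]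
    show "(\<Sum>g\<in>G. mon (h u + (h \<circ> g) v) (act h c * act (h \<circ> g) d))
        = (\<Sum>g\<in>G. mon (h u + g v) (act h c * act g d))" .
  qed
  also have "\<dots> = \<tau> c u * \<tau> d v"
    by (simp add: \<tau>_def sum_product mult_single)
  finally show ?thesis by simp
qed

lemma supp_\<tau>: "supp (\<tau> c v) \<subseteq> (\<lambda>g. g v) ` G"
proof
  fix w assume "w \<in> supp (\<tau> c v)"
  then have "cf (\<tau> c v) w \<noteq> 0" by (simp add: in_keys_iff)
  moreover have "cf (\<tau> c v) w = 0" if "\<forall>g\<in>G. g v \<noteq> w"
    unfolding cf_\<tau> using that by (intro sum.neutral) auto
  ultimately show "w \<in> (\<lambda>g. g v) ` G" by auto
qed

lemma cf_\<tau>_act: "h \<in> G \<Longrightarrow> cf (\<tau> c v) (h w) = act h (cf (\<tau> c v) w)"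
proof -
  assume h: "h \<in> G"
  have "act h (cf (\<tau> c v) w) = (\<Sum>g\<in>G. if (h \<circ> g) v = h w then act (h \<circ> g) c else 0)"
    unfolding cf_\<tau> using h by (subst act_sum) (auto intro!: sum.cong simp: act_0 act_comp inj_G)
  also have "\<dots> = cf (\<tau> c v) (h w)"
    unfolding cf_\<tau> by (rule sum_G_left[OF h, of "\<lambda>g. if g v = h w then act g c else 0"])
  finally show ?thesis by simp
qed

definition inv0 :: "('v \<Rightarrow>\<^sub>0 'l) set" where
  "inv0 = {p. \<forall>g\<in>G. \<forall>v. cf p (g v) = act g (cf p v)}"

lemma \<tau>_inv0: "\<tau> c v \<in> inv0"
  by (simp add: inv0_def cf_\<tau>_act)

lemma inv0_sum_\<tau>:
  assumes p: "p \<in> inv0"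
  shows "mon 0 (of_nat (card G)) * p = (\<Sum>v\<in>supp p. \<tau> (cf p v) v)"
proof -
  have sg: "g ` supp p = supp p" if g: "g \<in> G" for g
  proof -
    have "g v \<in> supp p \<longleftrightarrow> v \<in> supp p" for v
      using p g by (simp add: inv0_def in_keys_iff act_eq_0_iff)
    note iff = this
    show ?thesis
    proof (intro equalityI subsetI)
      fix w assume "w \<in> supp p"
      then have "inv_into UNIV g w \<in> supp p" using iff[of "inv_into UNIV g w"] g by simp
      moreover have "w = g (inv_into UNIV g w)" using g by simp
      ultimately show "w \<in> g ` supp p" by (rule rev_image_eqI)
    next
      fix w assume "w \<in> g ` supp p"
      then obtain v where "w = g v" "v \<in> supp p" by auto
      then show "w \<in> supp p" using iff[of v] by simp
    qed
  qed
  have "(\<Sum>v\<in>supp p. \<tau> (cf p v) v) = (\<Sum>g\<in>G. \<Sum>v\<in>supp p. mon (g v) (cf p (g v)))"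
    unfolding \<tau>_def by (subst sum.swap) (use p in \<open>simp add: inv0_def\<close>)
  also have "\<dots> = (\<Sum>g\<in>G. p)"
  proof (rule sum.cong[OF refl])
    fix g assume g: "g \<in> G"
    have "(\<Sum>v\<in>supp p. mon (g v) (cf p (g v))) = (\<Sum>v\<in>g ` supp p. mon v (cf p v))"
      using g by (subst sum.reindex) (auto simp: inj_on_def inj_G)
    then show "(\<Sum>v\<in>supp p. mon (g v) (cf p (g v))) = p" using sg[OF g] sum_mon[of p] by simp
  qed
  also have "\<dots> = mon 0 (of_nat (card G)) * p" by simp
  finally show ?thesis by simp
qed

lemma inv0_eq_sum_\<tau>:
  assumes p: "p \<in> inv0"
  shows "p = (\<Sum>v\<in>supp p. \<tau> (inverse (of_nat (card G)) * cf p v) v)"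
proof -
  have k: "inverse (of_nat (card G)) \<in> k0" using k0_of_nat by blast
  have "p = mon 0 (inverse (of_nat (card G))) * (mon 0 (of_nat (card G)) * p)"
    using card_G_pos unfolding mult.assoc[symmetric] mult_single by simp
  also have "\<dots> = (\<Sum>v\<in>supp p. \<tau> (inverse (of_nat (card G)) * cf p v) v)"
    unfolding inv0_sum_\<tau>[OF p] by (simp add: sum_distrib_left \<tau>_scale[OF k])
  finally show ?thesis .
qed

lemma inv0_closed:
  "0 \<in> inv0" "1 \<in> inv0" "p \<in> inv0 \<Longrightarrow> q \<in> inv0 \<Longrightarrow> p + q \<in> inv0"
  "p \<in> inv0 \<Longrightarrow> - p \<in> inv0" "c \<in> k0 \<Longrightarrow> p \<in> inv0 \<Longrightarrow> mon 0 c * p \<in> inv0"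
proof -
  show "1 \<in> inv0"
    using G_zero_iff by (auto simp: inv0_def lookup_one when_def act_1 act_0)
qed (auto simp: inv0_def act_0 act_add lookup_add act_uminus cf_const_mult act_mult k0_act)

lemma inv0_sum: "(\<And>i. i \<in> I \<Longrightarrow> f i \<in> inv0) \<Longrightarrow> sum f I \<in> inv0"
  by (induction I rule: infinite_finite_induct) (auto simp: inv0_closed)

lemma inv0_mult:
  assumes p: "p \<in> inv0" and q: "q \<in> inv0"
  shows "p * q \<in> inv0"
proof -
  let ?t = "inverse (of_nat (card G))"
  have "p * q = (\<Sum>v\<in>supp p. \<tau> (?t * cf p v) v) * (\<Sum>v\<in>supp q. \<tau> (?t * cf q v) v)"
    by (rule arg_cong2[OF inv0_eq_sum_\<tau>[OF p] inv0_eq_sum_\<tau>[OF q]])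
  also have "\<dots> \<in> inv0"
    unfolding sum_product \<tau>_mult by (intro inv0_sum \<tau>_inv0)
  finally show ?thesis .
qed

lemma \<tau>_coeff_1: "cf (\<tau> 1 v) v \<noteq> 0"
proof -
  have "cf (\<tau> 1 v) v = (\<Sum>g\<in>{g\<in>G. g v = v}. 1)"
    unfolding cf_\<tau> by (subst sum.inter_filter[symmetric]) (auto simp: finite_G act_1 intro!: sum.cong)
  also have "\<dots> = of_nat (card {g\<in>G. g v = v})" by simp
  also have "\<dots> \<noteq> 0" using id_G finite_G by (auto simp: card_eq_0_iff)
  finally show ?thesis .
qed

end

locale galois_coords = galois_action G act
  for G :: "('v::ab_group_add \<Rightarrow> 'v) set" and act :: "('v \<Rightarrow> 'v) \<Rightarrow> 'l::field_char_0 \<Rightarrow> 'l" +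
  fixes \<alpha> \<beta> :: "nat \<Rightarrow> 'l" and m :: nat
  assumes coords: "\<And>g. g \<in> G \<Longrightarrow> (\<Sum>i<m. \<alpha> i * act g (\<beta> i)) = (if g = id then 1 else 0)"
    and dual: "\<And>i j. i < m \<Longrightarrow> j < m \<Longrightarrow> Tr (\<beta> i * \<alpha> j) = (if i = j then 1 else 0)"
begin

lemma coords_gen:
  assumes g: "g \<in> G" and h: "h \<in> G"
  shows "(\<Sum>i<m. act g (\<alpha> i) * act h (\<beta> i)) = (if g = h then 1 else 0)"
proof -
  let ?u = "inv_into UNIV g \<circ> h"
  have u: "?u \<in> G" using g h by (simp add: comp_G inv_G)
  have "(\<Sum>i<m. act g (\<alpha> i) * act h (\<beta> i)) = act g (\<Sum>i<m. \<alpha> i * act ?u (\<beta> i))"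
    using g h by (simp add: act_sum act_mult act_comp inv_G)
  also have "\<dots> = (if ?u = id then 1 else 0)" using u g by (simp add: coords act_1 act_0)
  also have "?u = id \<longleftrightarrow> g = h"
    using g h by (metis comp_assoc comp_inv_G comp_id id_comp)
  finally show ?thesis .
qed

text \<open>\<open>canonical I p q\<close> expresses that the sum of the tensors \<open>p\<^sub>i \<otimes> q\<^sub>i\<close> is the separability idempotent.\<close>

definition canonical :: "nat set \<Rightarrow> (nat \<Rightarrow> 'l) \<Rightarrow> (nat \<Rightarrow> 'l) \<Rightarrow> bool" where
  "canonical I p q \<longleftrightarrow> finite I \<and> (\<forall>z. (\<Sum>i\<in>I. Tr (p i * z) * q i) = z)"

lemma canonical_act:
  assumes g: "g \<in> G"
  shows "canonical {..<m} (\<lambda>i. act g (\<beta> i)) (\<lambda>i. act g (\<alpha> i))"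
proof -
  have "(\<Sum>i<m. Tr (act g (\<beta> i) * z) * act g (\<alpha> i)) = z" for z
  proof -
    have "(\<Sum>i<m. Tr (act g (\<beta> i) * z) * act g (\<alpha> i)) = (\<Sum>h\<in>G. act h z * (\<Sum>i<m. act g (\<alpha> i) * act (h \<circ> g) (\<beta> i)))"
      unfolding Tr_def sum_distrib_right
      by (subst sum.swap) (use g in \<open>auto simp: act_mult act_comp sum_distrib_left algebra_simps intro!: sum.cong\<close>)
    also have "\<dots> = (\<Sum>h\<in>G. if h = id then act h z else 0)"
    proof (rule sum.cong[OF refl])
      fix h assume h: "h \<in> G"
      have "g = h \<circ> g \<longleftrightarrow> h = id"
        using g by (metis comp_assoc comp_inv_G(1) comp_id id_comp)
      then show "act h z * (\<Sum>i<m. act g (\<alpha> i) * act (h \<circ> g) (\<beta> i)) = (if h = id then act h z else 0)"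
        using coords_gen[OF g comp_G[OF h g]] by auto
    qed
    also have "\<dots> = z" using finite_G id_G by (simp add: act_id)
    finally show ?thesis .
  qed
  then show ?thesis by (simp add: canonical_def)
qed

lemma canonical_\<beta>\<alpha>: "canonical {..<m} \<beta> \<alpha>"
  using canonical_act[OF id_G] by (simp add: act_id)

lemma canonical_\<alpha>\<beta>: "canonical {..<m} \<alpha> \<beta>"
proof -
  have "(\<Sum>i<m. Tr (\<alpha> i * z) * \<beta> i) = z" for z
  proof -
    have "(\<Sum>i<m. Tr (\<alpha> i * z) * \<beta> i) = (\<Sum>h\<in>G. act h z * (\<Sum>i<m. act h (\<alpha> i) * act id (\<beta> i)))"
      unfolding Tr_def sum_distrib_right
      by (subst sum.swap) (auto simp: act_mult act_id sum_distrib_left algebra_simps intro!: sum.cong)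
    also have "\<dots> = (\<Sum>h\<in>G. if h = id then act h z else 0)"
      using coords_gen[OF _ id_G] by (intro sum.cong refl) auto
    also have "\<dots> = z" using finite_G id_G by (simp add: act_id)
    finally show ?thesis .
  qed
  then show ?thesis by (simp add: canonical_def)
qed

lemma expand_\<beta>: "z = (\<Sum>l<m. Tr (z * \<alpha> l) * \<beta> l)"
  using canonical_\<alpha>\<beta> by (simp add: canonical_def mult.commute[of z])

lemma mon_eq_sum_\<tau>:
  "mon v c = (\<Sum>i<m. mon 0 (\<alpha> i) * \<tau> (\<beta> i * c) v)"
proof -
  have "(\<Sum>i<m. mon 0 (\<alpha> i) * \<tau> (\<beta> i * c) v)
     = (\<Sum>g\<in>G. mon (g v) ((\<Sum>i<m. \<alpha> i * act g (\<beta> i)) * act g c))"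
    unfolding \<tau>_def sum_distrib_left mult_single sum_distrib_right mon_sum
    by (subst sum.swap) (auto simp: act_mult algebra_simps intro!: sum.cong)
  also have "\<dots> = (\<Sum>g\<in>G. if g = id then mon (g v) (act g c) else 0)"
    by (intro sum.cong refl) (auto simp: coords)
  also have "\<dots> = mon v c" using finite_G id_G by (simp add: act_id)
  finally show ?thesis by simp
qed

end

lemma (in abelian_monoid) finsum_swap:
  assumes "finite A" "finite B" and f: "\<And>a b. a \<in> A \<Longrightarrow> b \<in> B \<Longrightarrow> f a b \<in> carrier G"
  shows "(\<Oplus>a\<in>A. \<Oplus>b\<in>B. f a b) = (\<Oplus>b\<in>B. \<Oplus>a\<in>A. f a b)"
  using assms(1) f
proof (induction A rule: finite_induct)
  case (insert a A)
  then have "(\<Oplus>a\<in>insert a A. \<Oplus>b\<in>B. f a b) = (\<Oplus>b\<in>B. f a b) \<oplus> (\<Oplus>b\<in>B. \<Oplus>a\<in>A. f a b)"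
    by (subst finsum_insert) auto
  also have "\<dots> = (\<Oplus>b\<in>B. f a b \<oplus> (\<Oplus>a\<in>A. f a b))"
    using insert by (subst finsum_addf) auto
  also have "\<dots> = (\<Oplus>b\<in>B. \<Oplus>a\<in>insert a A. f a b)"
    using insert by (intro finsum_cong') (auto simp: finsum_insert)
  finally show ?case .
qed simp

lemma (in abelian_monoid) finsum_superset:
  assumes "finite B" "A \<subseteq> B" "\<And>b. b \<in> B \<Longrightarrow> f b \<in> carrier G" "\<And>b. b \<in> B - A \<Longrightarrow> f b = \<zero>"
  shows "finsum G f A = finsum G f B"
  using assms by (intro add.finprod_mono_neutral_cong_left) auto

lemma (in abelian_monoid) finsum_bij:
  assumes "bij_betw h A B" "\<And>b. b \<in> B \<Longrightarrow> f b \<in> carrier G"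
  shows "(\<Oplus>a\<in>A. f (h a)) = finsum G f B"
  using finsum_reindex[of f h A] assms by (auto simp: bij_betw_def)

lemma (in cring) finsum_mult:
  assumes "finite A" "finite B" "\<And>a. a \<in> A \<Longrightarrow> f a \<in> carrier R" "\<And>b. b \<in> B \<Longrightarrow> g b \<in> carrier R"
  shows "(\<Oplus>a\<in>A. f a) \<otimes> (\<Oplus>b\<in>B. g b) = (\<Oplus>a\<in>A. \<Oplus>b\<in>B. f a \<otimes> g b)"
proof -
  have "(\<Oplus>a\<in>A. f a) \<otimes> (\<Oplus>b\<in>B. g b) = (\<Oplus>a\<in>A. f a \<otimes> (\<Oplus>b\<in>B. g b))"
    using assms by (intro finsum_ldistr) auto
  also have "\<dots> = (\<Oplus>a\<in>A. \<Oplus>b\<in>B. f a \<otimes> g b)"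
    using assms by (intro finsum_cong' finsum_rdistr) auto
  finally show ?thesis .
qed

definition transport :: "('t \<Rightarrow> 'a) \<Rightarrow> 't::comm_ring_1 set \<Rightarrow> ('a \<Rightarrow> 'a \<Rightarrow> 'a) \<Rightarrow> 'a alg" where
  "transport \<epsilon> C s = \<lparr>carrier = \<epsilon> ` C,
     monoid.mult = (\<lambda>x y. \<epsilon> (inv_into UNIV \<epsilon> x * inv_into UNIV \<epsilon> y)), one = \<epsilon> 1,
     ring.zero = \<epsilon> 0, add = (\<lambda>x y. \<epsilon> (inv_into UNIV \<epsilon> x + inv_into UNIV \<epsilon> y)), module.smult = s\<rparr>"

lemma cring_transport:
  fixes \<epsilon> :: "'t::comm_ring_1 \<Rightarrow> 'a"
  assumes inj: "inj \<epsilon>" and C: "0 \<in> C" "1 \<in> C" "\<And>x y. x \<in> C \<Longrightarrow> y \<in> C \<Longrightarrow> x + y \<in> C"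
    "\<And>x y. x \<in> C \<Longrightarrow> y \<in> C \<Longrightarrow> x * y \<in> C" "\<And>x. x \<in> C \<Longrightarrow> - x \<in> C"
  shows "cring (transport \<epsilon> C s)"
proof (rule cringI)
  show "abelian_group (transport \<epsilon> C s)"
  proof (rule abelian_groupI)
    fix x assume "x \<in> carrier (transport \<epsilon> C s)"
    then obtain c where "x = \<epsilon> c" "c \<in> C" by (auto simp: transport_def)
    then show "\<exists>y\<in>carrier (transport \<epsilon> C s). y \<oplus>\<^bsub>transport \<epsilon> C s\<^esub> x = \<zero>\<^bsub>transport \<epsilon> C s\<^esub>"
      using C(5) inj by (intro bexI[of _ "\<epsilon> (- c)"]) (auto simp: transport_def)
  qed (use assms in \<open>auto simp: transport_def add_ac\<close>)
  show "comm_monoid (transport \<epsilon> C s)"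
    by (rule comm_monoidI) (use assms in \<open>auto simp: transport_def mult_ac\<close>)
qed (use assms in \<open>auto simp: transport_def algebra_simps\<close>)

lemma transport_simps:
  assumes "inj \<epsilon>"
  shows "carrier (transport \<epsilon> C s) = \<epsilon> ` C"
    "\<epsilon> x \<otimes>\<^bsub>transport \<epsilon> C s\<^esub> \<epsilon> y = \<epsilon> (x * y)" "\<epsilon> x \<oplus>\<^bsub>transport \<epsilon> C s\<^esub> \<epsilon> y = \<epsilon> (x + y)"
    "\<one>\<^bsub>transport \<epsilon> C s\<^esub> = \<epsilon> 1" "\<zero>\<^bsub>transport \<epsilon> C s\<^esub> = \<epsilon> 0" "x' \<odot>\<^bsub>transport \<epsilon> C s\<^esub> y' = s x' y'"
  using assms by (simp_all add: transport_def)

locale torus_data = galois_coords G act \<alpha> \<beta> m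
  for G :: "('v::ab_group_add \<Rightarrow> 'v) set" and act :: "('v \<Rightarrow> 'v) \<Rightarrow> 'l::field_char_0 \<Rightarrow> 'l" and \<alpha> \<beta> m +
  fixes \<Lambda> :: "'v set" and e :: "nat \<Rightarrow> 'v" and n :: nat and crd :: "nat \<Rightarrow> 'v \<Rightarrow> int"
    and emb :: "'l \<Rightarrow> 'c::field_char_0" and encK :: "'c \<Rightarrow> 'a" and encA :: "('v \<Rightarrow>\<^sub>0 'l) \<Rightarrow> 'a"
  assumes X_0: "0 \<in> \<Lambda>" and X_add: "\<And>u v. u \<in> \<Lambda> \<Longrightarrow> v \<in> \<Lambda> \<Longrightarrow> u + v \<in> \<Lambda>"
    and X_uminus: "\<And>u. u \<in> \<Lambda> \<Longrightarrow> - u \<in> \<Lambda>" and X_G: "\<And>g u. g \<in> G \<Longrightarrow> u \<in> \<Lambda> \<Longrightarrow> g u \<in> \<Lambda>"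
    and e_X: "\<And>j. j < n \<Longrightarrow> e j \<in> \<Lambda>"
    and e_gen: "\<And>H. 0 \<in> H \<Longrightarrow> (\<And>u v. u \<in> H \<Longrightarrow> v \<in> H \<Longrightarrow> u + v \<in> H) \<Longrightarrow> (\<And>u. u \<in> H \<Longrightarrow> - u \<in> H)
        \<Longrightarrow> (\<And>j. j < n \<Longrightarrow> e j \<in> H) \<Longrightarrow> \<Lambda> \<subseteq> H"
    and crd_add: "\<And>j u v. j < n \<Longrightarrow> u \<in> \<Lambda> \<Longrightarrow> v \<in> \<Lambda> \<Longrightarrow> crd j (u + v) = crd j u + crd j v"
    and crd_e: "\<And>i j. i < n \<Longrightarrow> j < n \<Longrightarrow> crd j (e i) = (if i = j then 1 else 0)"
    and crd_inj: "\<And>u v. u \<in> \<Lambda> \<Longrightarrow> v \<in> \<Lambda> \<Longrightarrow> (\<And>j. j < n \<Longrightarrow> crd j u = crd j v) \<Longrightarrow> u = v"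
    and emb_add: "\<And>x y. emb (x + y) = emb x + emb y" and emb_mult: "\<And>x y. emb (x * y) = emb x * emb y"
    and emb_1: "emb 1 = 1" and inj_encK: "inj encK" and inj_encA: "inj encA"
begin

definition \<kappa> :: "'l \<Rightarrow> 'a" where "\<kappa> c = encK (emb c)"

definition kk :: "'a ring" where
  "kk = \<lparr>carrier = encK ` (emb ` k0),
     monoid.mult = (\<lambda>x y. encK (inv_into UNIV encK x * inv_into UNIV encK y)), one = encK 1,
     ring.zero = encK 0, add = (\<lambda>x y. encK (inv_into UNIV encK x + inv_into UNIV encK y))\<rparr>"

definition A0 :: "('v \<Rightarrow>\<^sub>0 'l) set" where "A0 = {p \<in> inv0. supp p \<subseteq> \<Lambda>}"

definition AA :: "'a alg" where
  "AA = transport encA A0 (\<lambda>c x. encA (mon 0 (inv_into UNIV \<kappa> c) * inv_into UNIV encA x))"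

lemma emb_0: "emb 0 = 0"
  using emb_add[of 0 0] by simp

lemma emb_uminus: "emb (- x) = - emb x"
  using emb_add[of x "- x"] emb_0 by (simp add: eq_neg_iff_add_eq_0 add.commute)

lemma emb_inj: "inj emb"
proof (rule injI)
  fix x y assume "emb x = emb y"
  then have "emb (x - y) = 0" using emb_add[of x "- y"] by (simp add: emb_uminus)
  moreover have "emb z \<noteq> 0" if "z \<noteq> 0" for z
    using emb_mult[of z "inverse z"] that by (auto simp: emb_1)
  ultimately show "x = y" by (metis eq_iff_diff_eq_0)
qed

lemma inj_\<kappa>: "inj \<kappa>"
  unfolding \<kappa>_def using inj_encK emb_inj by (auto simp: inj_on_def)

lemma dec [simp]: "inv_into UNIV encK (encK x) = x" "inv_into UNIV encA (encA p) = p" "inv_into UNIV \<kappa> (\<kappa> c) = c"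
  using inj_encK inj_encA inj_\<kappa> by simp_all

lemma kk_simps [simp]:
  "carrier kk = \<kappa> ` k0" "\<kappa> x \<otimes>\<^bsub>kk\<^esub> \<kappa> y = \<kappa> (x * y)" "\<kappa> x \<oplus>\<^bsub>kk\<^esub> \<kappa> y = \<kappa> (x + y)"
  "\<one>\<^bsub>kk\<^esub> = \<kappa> 1" "\<zero>\<^bsub>kk\<^esub> = \<kappa> 0"
  by (simp_all add: kk_def \<kappa>_def image_image emb_add emb_mult emb_1 emb_0)

lemma AA_simps [simp]:
  "carrier AA = encA ` A0" "encA p \<otimes>\<^bsub>AA\<^esub> encA q = encA (p * q)" "encA p \<oplus>\<^bsub>AA\<^esub> encA q = encA (p + q)"
  "\<one>\<^bsub>AA\<^esub> = encA 1" "\<zero>\<^bsub>AA\<^esub> = encA 0" "\<kappa> c \<odot>\<^bsub>AA\<^esub> encA p = encA (mon 0 c * p)"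
  by (simp_all add: AA_def transport_simps[OF inj_encA])

lemma encA_eq [simp]: "encA p = encA q \<longleftrightarrow> p = q"
  using inj_encA by (auto simp: inj_on_def)

lemma \<kappa>_eq [simp]: "\<kappa> c = \<kappa> d \<longleftrightarrow> c = d"
  using inj_\<kappa> by (auto simp: inj_on_def)

lemma cring_kk: "cring kk"
proof (rule cringI)
  show "abelian_group kk"
  proof (rule abelian_groupI)
    fix x assume "x \<in> carrier kk"
    then obtain c where c: "x = \<kappa> c" "c \<in> k0" by auto
    then show "\<exists>y\<in>carrier kk. y \<oplus>\<^bsub>kk\<^esub> x = \<zero>\<^bsub>kk\<^esub>"
      by (intro bexI[of _ "\<kappa> (- c)"]) auto
  qed (auto simp: add_ac)
  show "comm_monoid kk"
    by (rule comm_monoidI) (auto simp: mult_ac)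
qed (auto simp: algebra_simps)

lemma field_kk: "field kk"
proof -
  interpret cring kk by (rule cring_kk)
  show ?thesis
  proof (rule cring_fieldI)
    have "y \<in> Units kk" if y: "y \<in> carrier kk" "y \<noteq> \<zero>\<^bsub>kk\<^esub>" for y
    proof -
      obtain c where c: "y = \<kappa> c" "c \<in> k0" "c \<noteq> 0" using y by auto
      then have "\<kappa> (inverse c) \<in> carrier kk" "\<kappa> (inverse c) \<otimes>\<^bsub>kk\<^esub> y = \<one>\<^bsub>kk\<^esub>" "y \<otimes>\<^bsub>kk\<^esub> \<kappa> (inverse c) = \<one>\<^bsub>kk\<^esub>"
        by auto
      then show ?thesis using y(1) unfolding Units_def by blast
    qed
    moreover have "\<zero>\<^bsub>kk\<^esub> \<notin> Units kk" by (auto simp: Units_def)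
    ultimately show "Units kk = carrier kk - {\<zero>\<^bsub>kk\<^esub>}" using Units_closed by blast
  qed
qed

lemma \<tau>_A0: "v \<in> \<Lambda> \<Longrightarrow> \<tau> c v \<in> A0"
  using supp_\<tau>[of c v] X_G by (auto simp: A0_def \<tau>_inv0)

lemma A0_closed:
  "0 \<in> A0" "1 \<in> A0" "p \<in> A0 \<Longrightarrow> q \<in> A0 \<Longrightarrow> p + q \<in> A0" "p \<in> A0 \<Longrightarrow> q \<in> A0 \<Longrightarrow> p * q \<in> A0"
  "p \<in> A0 \<Longrightarrow> - p \<in> A0" "c \<in> k0 \<Longrightarrow> p \<in> A0 \<Longrightarrow> mon 0 c * p \<in> A0"
proof -
  show "p + q \<in> A0" if "p \<in> A0" "q \<in> A0"
    using that Poly_Mapping.keys_add[of p q] by (auto simp: A0_def inv0_closed)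
  show "p * q \<in> A0" if "p \<in> A0" "q \<in> A0"
    using that keys_mult[of p q] X_add by (fastforce simp: A0_def inv0_mult)
  show "mon 0 c * p \<in> A0" if "c \<in> k0" "p \<in> A0"
    using that by (auto simp: A0_def inv0_closed in_keys_iff cf_const_mult subset_iff)
qed (auto simp: A0_def inv0_closed X_0 in_keys_iff subset_iff lookup_one when_def split: if_splits)

lemma A0_sum: "(\<And>i. i \<in> I \<Longrightarrow> f i \<in> A0) \<Longrightarrow> sum f I \<in> A0"
  by (induction I rule: infinite_finite_induct) (auto simp: A0_closed)

lemma algebra_AA: "algebra kk AA"
proof (rule algebraI)
  show "cring AA" unfolding AA_def by (rule cring_transport[OF inj_encA]) (auto simp: A0_closed)
qed (auto simp: cring_kk A0_closed single_add distrib_left distrib_right mult.assoc[symmetric] mult_single)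

definition \<theta> :: 'l where "\<theta> = inverse (of_nat (card G))"

lemma \<theta>_k0: "\<theta> \<in> k0"
  unfolding \<theta>_def using k0_of_nat by blast

lemma Tr_\<theta>: "Tr \<theta> = 1"
  using card_G_pos k0_act[OF \<theta>_k0] by (simp add: Tr_def) (simp add: \<theta>_def)

lemma A0_eq_sum_\<tau>: "p \<in> A0 \<Longrightarrow> p = (\<Sum>v\<in>supp p. \<tau> (\<theta> * cf p v) v)"
  unfolding \<theta>_def by (rule inv0_eq_sum_\<tau>) (simp add: A0_def)

definition ct :: "'a alg \<Rightarrow> ('l \<Rightarrow> 'a) \<Rightarrow> ('l \<Rightarrow> 'a) \<Rightarrow> 'l \<Rightarrow> 'a" where
  "ct R l1 l2 c = (\<Oplus>\<^bsub>R\<^esub>i\<in>{..<m}. l1 (\<beta> i) \<otimes>\<^bsub>R\<^esub> l2 (c * \<alpha> i))"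

definition fam :: "('a \<Rightarrow> 'a) \<Rightarrow> 'v \<Rightarrow> 'l \<Rightarrow> 'a" where
  "fam f v c = f (encA (\<tau> c v))"

definition TT :: "'a gfunctor" where
  "TT R = \<lparr>carrier = alg_hom kk AA R,
     monoid.mult = (\<lambda>f g. THE h. h \<in> alg_hom kk AA R \<and> (\<forall>v\<in>\<Lambda>. \<forall>c. fam h v c = ct R (fam f v) (fam g v) c)),
     one = (THE h. h \<in> alg_hom kk AA R \<and> (\<forall>v\<in>\<Lambda>. \<forall>c. fam h v c = \<kappa> (Tr c) \<odot>\<^bsub>R\<^esub> \<one>\<^bsub>R\<^esub>))\<rparr>"

lemma carrier_TT [simp]: "carrier (TT R) = alg_hom kk AA R"
  by (simp add: TT_def)

end

lemma alg_homI:
  assumes "\<And>x. x \<in> carrier A \<Longrightarrow> f x \<in> carrier R"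
    and "\<And>x y. x \<in> carrier A \<Longrightarrow> y \<in> carrier A \<Longrightarrow> f (x \<otimes>\<^bsub>A\<^esub> y) = f x \<otimes>\<^bsub>R\<^esub> f y"
    and "\<And>x y. x \<in> carrier A \<Longrightarrow> y \<in> carrier A \<Longrightarrow> f (x \<oplus>\<^bsub>A\<^esub> y) = f x \<oplus>\<^bsub>R\<^esub> f y"
    and "f \<one>\<^bsub>A\<^esub> = \<one>\<^bsub>R\<^esub>"
    and "\<And>c x. c \<in> carrier k \<Longrightarrow> x \<in> carrier A \<Longrightarrow> f (c \<odot>\<^bsub>A\<^esub> x) = c \<odot>\<^bsub>R\<^esub> f x"
    and "f \<in> extensional (carrier A)"
  shows "f \<in> alg_hom k A R"
  using assms by (auto simp: alg_hom_def PiE_def intro!: ring_hom_memI)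

lemma alg_hom_compose:
  assumes f: "f \<in> alg_hom k A R" and g: "g \<in> alg_hom k R S" and A: "algebra k A"
  shows "compose (carrier A) g f \<in> alg_hom k A S"
proof -
  interpret A: algebra k A by (rule A)
  show ?thesis
    using f g
    by (intro alg_homI) (auto simp: alg_hom_def compose_def PiE_iff Pi_iff ring_hom_def)
qed

locale torus_point = torus_data G act \<alpha> \<beta> m \<Lambda> e n crd emb encK encA
  for G :: "('v::ab_group_add \<Rightarrow> 'v) set" and act :: "('v \<Rightarrow> 'v) \<Rightarrow> 'l::field_char_0 \<Rightarrow> 'l" and \<alpha> \<beta> m
    and \<Lambda> :: "'v set" and e :: "nat \<Rightarrow> 'v" and n :: nat and crd :: "nat \<Rightarrow> 'v \<Rightarrow> int"
    and emb :: "'l \<Rightarrow> 'c::field_char_0" and encK :: "'c \<Rightarrow> 'a" and encA :: "('v \<Rightarrow>\<^sub>0 'l) \<Rightarrow> 'a" +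
  fixes R :: "'a alg" (structure)
  assumes alg_R: "algebra kk R"
begin

sublocale S: algebra kk R by (rule alg_R)

definition klin :: "('l \<Rightarrow> 'a) \<Rightarrow> bool" where
  "klin l \<longleftrightarrow> (\<forall>c. l c \<in> carrier R) \<and> (\<forall>c d. l (c + d) = l c \<oplus> l d) \<and>
     (\<forall>k\<in>k0. \<forall>c. l (k * c) = \<kappa> k \<odot> l c)"

lemma klin_closed: "klin l \<Longrightarrow> l c \<in> carrier R"
  and klin_add: "klin l \<Longrightarrow> l (c + d) = l c \<oplus> l d"
  and klin_scale: "klin l \<Longrightarrow> k \<in> k0 \<Longrightarrow> l (k * c) = \<kappa> k \<odot> l c"
  by (auto simp: klin_def)

lemma smult_closed': "k \<in> k0 \<Longrightarrow> x \<in> carrier R \<Longrightarrow> \<kappa> k \<odot> x \<in> carrier R"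
  by (rule S.smult_closed) auto

lemma klin_0: "klin l \<Longrightarrow> l 0 = \<zero>"
  using klin_add[of l 0 0] klin_closed[of l 0] S.add.r_cancel_one' by (metis add_0)

lemma klin_sum: "finite I \<Longrightarrow> klin l \<Longrightarrow> l (sum f I) = (\<Oplus>i\<in>I. l (f i))"
proof (induction I rule: finite_induct)
  case (insert i I)
  then show ?case by (subst S.finsum_insert) (auto simp: klin_add klin_closed)
qed (simp add: klin_0)

lemma ct_closed: "klin l1 \<Longrightarrow> klin l2 \<Longrightarrow> ct R l1 l2 c \<in> carrier R"
  unfolding ct_def by (auto intro!: S.finsum_closed simp: klin_closed)

lemma smult_finsum:
  "finite I \<Longrightarrow> k \<in> k0 \<Longrightarrow> (\<And>i. i \<in> I \<Longrightarrow> f i \<in> carrier R) \<Longrightarrow> \<kappa> k \<odot> (\<Oplus>i\<in>I. f i) = (\<Oplus>i\<in>I. \<kappa> k \<odot> f i)"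
proof (induction I rule: finite_induct)
  case (insert i I)
  then show ?case by (auto simp: S.finsum_insert S.smult_r_distr)
qed auto

lemma ct_klin: assumes "klin l1" "klin l2" shows "klin (ct R l1 l2)"
  unfolding klin_def
proof (intro conjI allI ballI)
  note [simp] = assms[THEN klin_closed]
  show "ct R l1 l2 c \<in> carrier R" for c using assms by (rule ct_closed)
  show "ct R l1 l2 (c + d) = ct R l1 l2 c \<oplus> ct R l1 l2 d" for c d
    unfolding ct_def
    by (subst S.finsum_addf[symmetric]) (auto intro!: S.finsum_cong' simp: distrib_right klin_add[OF assms(2)] S.r_distr)
  show "ct R l1 l2 (k * c) = \<kappa> k \<odot> ct R l1 l2 c" if "k \<in> k0" for k c
    unfolding ct_def using that
    by (subst smult_finsum)
       (auto intro!: S.finsum_cong' simp: mult.assoc klin_scale[OF assms(2)] smult_closed' S.smult_assoc2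
          S.m_comm[of "l1 _"])
qed

text \<open>
  The canonical element of \<open>L \<otimes>\<^sub>k L\<close> does not depend on the chosen pair of dual bases.
\<close>

lemma canonical_ct:
  assumes can: "canonical I p q" and l: "klin l1" "klin l2"
  shows "(\<Oplus>i\<in>I. l1 (x * p i) \<otimes> l2 (y * q i)) = ct R l1 l2 (x * y)"
proof -
  note [simp] = l[THEN klin_closed]
  have fin: "finite I" using can by (simp add: canonical_def)
  define t where "t i j = Tr (x * p i * \<alpha> j)" for i j
  have t: "t i j \<in> k0" for i j by (simp add: t_def Tr_k0)
  have "(\<Oplus>i\<in>I. l1 (x * p i) \<otimes> l2 (y * q i)) = (\<Oplus>i\<in>I. \<Oplus>j\<in>{..<m}. l1 (\<beta> j) \<otimes> l2 (t i j * (y * q i)))"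
  proof (rule S.finsum_cong')
    fix i assume "i \<in> I"
    have "l1 (x * p i) = (\<Oplus>j\<in>{..<m}. \<kappa> (t i j) \<odot> l1 (\<beta> j))"
      by (subst expand_\<beta>) (auto simp: klin_sum[OF _ l(1)] klin_scale[OF l(1)] t_def Tr_k0 smult_closed' intro!: S.finsum_cong')
    then have "l1 (x * p i) \<otimes> l2 (y * q i) = (\<Oplus>j\<in>{..<m}. \<kappa> (t i j) \<odot> l1 (\<beta> j) \<otimes> l2 (y * q i))"
      by (simp add: S.finsum_ldistr smult_closed' t Pi_iff)
    also have "\<dots> = (\<Oplus>j\<in>{..<m}. l1 (\<beta> j) \<otimes> l2 (t i j * (y * q i)))"
      using t by (intro S.finsum_cong')
        (auto simp: klin_scale[OF l(2)] S.smult_assoc2 smult_closed' S.m_comm[of "l1 _"])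
    finally show "l1 (x * p i) \<otimes> l2 (y * q i) = (\<Oplus>j\<in>{..<m}. l1 (\<beta> j) \<otimes> l2 (t i j * (y * q i)))" .
  qed auto
  also have "\<dots> = (\<Oplus>j\<in>{..<m}. \<Oplus>i\<in>I. l1 (\<beta> j) \<otimes> l2 (t i j * (y * q i)))"
    using fin by (intro S.finsum_swap) auto
  also have "\<dots> = (\<Oplus>j\<in>{..<m}. l1 (\<beta> j) \<otimes> l2 (x * y * \<alpha> j))"
  proof (rule S.finsum_cong')
    fix j assume "j \<in> {..<m}"
    have "(\<Oplus>i\<in>I. l1 (\<beta> j) \<otimes> l2 (t i j * (y * q i))) = l1 (\<beta> j) \<otimes> l2 (\<Sum>i\<in>I. t i j * (y * q i))"
      using fin by (subst S.finsum_rdistr[symmetric]) (auto simp: klin_sum[OF _ l(2)])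
    also have "(\<Sum>i\<in>I. t i j * (y * q i)) = y * (\<Sum>i\<in>I. Tr (p i * (x * \<alpha> j)) * q i)"
      by (simp add: t_def sum_distrib_left algebra_simps)
    also have "(\<Sum>i\<in>I. Tr (p i * (x * \<alpha> j)) * q i) = x * \<alpha> j" using can by (simp add: canonical_def)
    finally show "(\<Oplus>i\<in>I. l1 (\<beta> j) \<otimes> l2 (t i j * (y * q i))) = l1 (\<beta> j) \<otimes> l2 (x * y * \<alpha> j)"
      by (simp add: algebra_simps)
  qed auto
  finally show ?thesis by (simp add: ct_def)
qed

lemma ct_assoc:
  assumes l: "klin l1" "klin l2" "klin l3"
  shows "ct R (ct R l1 l2) l3 c = ct R l1 (ct R l2 l3) c"
proof -
  note [simp] = l[THEN klin_closed]
  have "ct R (ct R l1 l2) l3 c = (\<Oplus>i\<in>{..<m}. \<Oplus>j\<in>{..<m}. l1 (\<beta> j) \<otimes> (l2 (\<alpha> j * \<beta> i) \<otimes> l3 (c * \<alpha> i)))"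
    unfolding ct_def
    by (intro S.finsum_cong') (auto simp: S.finsum_ldistr Pi_iff S.m_assoc mult.commute)
  also have "\<dots> = (\<Oplus>j\<in>{..<m}. \<Oplus>i\<in>{..<m}. l1 (\<beta> j) \<otimes> (l2 (\<alpha> j * \<beta> i) \<otimes> l3 (c * \<alpha> i)))"
    by (intro S.finsum_swap) auto
  also have "\<dots> = (\<Oplus>j\<in>{..<m}. l1 (\<beta> j) \<otimes> (\<Oplus>i\<in>{..<m}. l2 (\<alpha> j * \<beta> i) \<otimes> l3 (c * \<alpha> i)))"
    by (intro S.finsum_cong') (auto simp: S.finsum_rdistr Pi_iff)
  also have "\<dots> = ct R l1 (ct R l2 l3) c"
    unfolding ct_def[of R l1]
    by (intro S.finsum_cong') (auto simp: canonical_ct[OF canonical_\<beta>\<alpha>] l ct_closed mult.commute)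
  finally show ?thesis .
qed

lemma klin_one: "klin (\<lambda>c. \<kappa> (Tr c) \<odot> \<one>)"
  by (auto simp: klin_def Tr_k0 Tr_add Tr_scale smult_closed' S.smult_l_distr[symmetric] S.smult_assoc1[symmetric])

lemma ct_one: assumes l: "klin l" shows "ct R (\<lambda>c. \<kappa> (Tr c) \<odot> \<one>) l c = l c"
proof -
  note [simp] = l[THEN klin_closed]
  have "ct R (\<lambda>c. \<kappa> (Tr c) \<odot> \<one>) l c = (\<Oplus>i\<in>{..<m}. l (c * (Tr (\<beta> i) * \<alpha> i)))"
    unfolding ct_def
  proof (intro S.finsum_cong')
    fix i
    have "l (Tr (\<beta> i) * (c * \<alpha> i)) = \<kappa> (Tr (\<beta> i)) \<odot> l (c * \<alpha> i)" by (rule klin_scale[OF l Tr_k0])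
    moreover have "Tr (\<beta> i) * (c * \<alpha> i) = c * (Tr (\<beta> i) * \<alpha> i)" by (simp add: algebra_simps)
    ultimately show "\<kappa> (Tr (\<beta> i)) \<odot> \<one> \<otimes> l (c * \<alpha> i) = l (c * (Tr (\<beta> i) * \<alpha> i))"
      by (simp add: S.smult_assoc2 Tr_k0)
  qed auto
  also have "\<dots> = l (c * (\<Sum>i<m. Tr (\<beta> i) * \<alpha> i))"
    by (simp add: klin_sum[OF _ l] sum_distrib_left)
  also have "(\<Sum>i<m. Tr (\<beta> i) * \<alpha> i) = 1"
    using canonical_\<beta>\<alpha> unfolding canonical_def by (auto dest: spec[of _ 1])
  finally show ?thesis by simp
qed

definition family :: "('v \<Rightarrow> 'l \<Rightarrow> 'a) \<Rightarrow> bool" where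
  "family \<phi> \<longleftrightarrow> (\<forall>v\<in>\<Lambda>. klin (\<phi> v)) \<and> (\<forall>g\<in>G. \<forall>v\<in>\<Lambda>. \<forall>c. \<phi> (g v) (act g c) = \<phi> v c) \<and>
     (\<forall>c. \<phi> 0 c = \<kappa> (Tr c) \<odot> \<one>) \<and>
     (\<forall>u\<in>\<Lambda>. \<forall>v\<in>\<Lambda>. \<forall>c d. \<phi> u c \<otimes> \<phi> v d = (\<Oplus>g\<in>G. \<phi> (u + g v) (c * act g d)))"

lemma familyD:
  assumes "family \<phi>"
  shows "v \<in> \<Lambda> \<Longrightarrow> klin (\<phi> v)" "g \<in> G \<Longrightarrow> v \<in> \<Lambda> \<Longrightarrow> \<phi> (g v) (act g c) = \<phi> v c"
    "\<phi> 0 c = \<kappa> (Tr c) \<odot> \<one>"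
    "u \<in> \<Lambda> \<Longrightarrow> v \<in> \<Lambda> \<Longrightarrow> \<phi> u c \<otimes> \<phi> v d = (\<Oplus>g\<in>G. \<phi> (u + g v) (c * act g d))"
  using assms unfolding family_def by blast+

lemma point_simps:
  assumes f: "f \<in> alg_hom kk AA R"
  shows "p \<in> A0 \<Longrightarrow> f (encA p) \<in> carrier R" "p \<in> A0 \<Longrightarrow> q \<in> A0 \<Longrightarrow> f (encA (p + q)) = f (encA p) \<oplus> f (encA q)"
    "p \<in> A0 \<Longrightarrow> q \<in> A0 \<Longrightarrow> f (encA (p * q)) = f (encA p) \<otimes> f (encA q)"
    "f (encA 1) = \<one>" "k \<in> k0 \<Longrightarrow> p \<in> A0 \<Longrightarrow> f (encA (mon 0 k * p)) = \<kappa> k \<odot> f (encA p)"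
proof -
  have h: "f \<in> ring_hom AA R" and s: "\<And>c a. c \<in> carrier kk \<Longrightarrow> a \<in> carrier AA \<Longrightarrow> f (c \<odot>\<^bsub>AA\<^esub> a) = c \<odot> f a"
    using f by (auto simp: alg_hom_def)
  show "p \<in> A0 \<Longrightarrow> f (encA p) \<in> carrier R" using ring_hom_memE(1)[OF h, of "encA p"] by auto
  show "p \<in> A0 \<Longrightarrow> q \<in> A0 \<Longrightarrow> f (encA (p + q)) = f (encA p) \<oplus> f (encA q)"
    using ring_hom_memE(3)[OF h, of "encA p" "encA q"] by auto
  show "p \<in> A0 \<Longrightarrow> q \<in> A0 \<Longrightarrow> f (encA (p * q)) = f (encA p) \<otimes> f (encA q)"
    using ring_hom_memE(2)[OF h, of "encA p" "encA q"] by auto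
  show "f (encA 1) = \<one>" using ring_hom_memE(4)[OF h] by auto
  show "k \<in> k0 \<Longrightarrow> p \<in> A0 \<Longrightarrow> f (encA (mon 0 k * p)) = \<kappa> k \<odot> f (encA p)"
    using s[of "\<kappa> k" "encA p"] by auto
qed

lemma point_0: "f \<in> alg_hom kk AA R \<Longrightarrow> f (encA 0) = \<zero>"
  using point_simps(2)[of f 0 0] point_simps(1)[of f 0] S.add.r_cancel_one' A0_closed(1) by (metis add_0)

lemma point_sum:
  "finite I \<Longrightarrow> f \<in> alg_hom kk AA R \<Longrightarrow> (\<And>i. i \<in> I \<Longrightarrow> p i \<in> A0) \<Longrightarrow> f (encA (\<Sum>i\<in>I. p i)) = (\<Oplus>i\<in>I. f (encA (p i)))"
proof (induction I rule: finite_induct)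
  case (insert i I)
  then show ?case by (subst S.finsum_insert) (auto simp: point_simps A0_sum)
qed (auto simp: point_0)

lemma point_family:
  assumes f: "f \<in> alg_hom kk AA R" shows "family (fam f)"
proof -
  have "klin (fam f v)" if "v \<in> \<Lambda>" for v
    using that by (auto simp: klin_def fam_def \<tau>_add \<tau>_scale \<tau>_A0 point_simps[OF f])
  moreover have "fam f u c \<otimes> fam f v d = (\<Oplus>g\<in>G. fam f (u + g v) (c * act g d))"
    if "u \<in> \<Lambda>" "v \<in> \<Lambda>" for u v c d
    using that unfolding fam_def
    by (simp add: point_simps(3)[OF f, symmetric] \<tau>_A0 \<tau>_mult point_sum[OF _ f] finite_G X_add X_G)
  moreover have "fam f 0 c = \<kappa> (Tr c) \<odot> \<one>" for c
    using point_simps(5)[OF f Tr_k0 A0_closed(2), of c] by (simp add: fam_def \<tau>_zero point_simps(4)[OF f])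
  ultimately show ?thesis by (simp add: family_def) (simp add: fam_def \<tau>_act)
qed

lemma point_eq:
  assumes f: "f \<in> alg_hom kk AA R" and p: "p \<in> A0"
  shows "f (encA p) = (\<Oplus>v\<in>supp p. fam f v (\<theta> * cf p v))"
proof -
  have "supp p \<subseteq> \<Lambda>" using p by (simp add: A0_def)
  then have "f (encA (\<Sum>v\<in>supp p. \<tau> (\<theta> * cf p v) v)) = (\<Oplus>v\<in>supp p. fam f v (\<theta> * cf p v))"
    unfolding fam_def by (intro point_sum f) (auto simp: \<tau>_A0)
  then show ?thesis using A0_eq_sum_\<tau>[OF p] by simp
qed

lemma point_eqI:
  assumes f: "f \<in> alg_hom kk AA R" and g: "g \<in> alg_hom kk AA R"
    and eq: "\<And>v c. v \<in> \<Lambda> \<Longrightarrow> fam f v c = fam g v c"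
  shows "f = g"
proof (rule extensionalityI[where A = "carrier AA"])
  show "f \<in> extensional (carrier AA)" "g \<in> extensional (carrier AA)"
    using f g by (auto simp: alg_hom_def PiE_iff)
  fix x assume "x \<in> carrier AA"
  then obtain p where p: "x = encA p" "p \<in> A0" by auto
  then have "supp p \<subseteq> \<Lambda>" by (simp add: A0_def)
  then have "(\<Oplus>v\<in>supp p. fam f v (\<theta> * cf p v)) = (\<Oplus>v\<in>supp p. fam g v (\<theta> * cf p v))"
    using klin_closed[OF familyD(1)[OF point_family[OF g]]] eq by (intro S.finsum_cong') auto
  then show "f x = g x" using p point_eq[OF f p(2)] point_eq[OF g p(2)] by simp
qed

text \<open>The converse: a family extends additively to \<open>L[\<Lambda>]\<close>; restricted to invariants it is multiplicative.\<close>

definition \<Psi> :: "('v \<Rightarrow> 'l \<Rightarrow> 'a) \<Rightarrow> ('v \<Rightarrow>\<^sub>0 'l) \<Rightarrow> 'a" where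
  "\<Psi> \<phi> p = (\<Oplus>v\<in>supp p. \<phi> v (\<theta> * cf p v))"

context
  fixes \<phi> assumes \<phi>: "family \<phi>"
begin

lemma \<Psi>_superset:
  assumes "supp p \<subseteq> W" "finite W" "W \<subseteq> \<Lambda>" shows "\<Psi> \<phi> p = (\<Oplus>v\<in>W. \<phi> v (\<theta> * cf p v))"
  unfolding \<Psi>_def using assms familyD(1)[OF \<phi>]
  by (intro S.finsum_superset) (auto simp: klin_closed klin_0 in_keys_iff subset_iff)

lemma \<Psi>_closed: "supp p \<subseteq> \<Lambda> \<Longrightarrow> \<Psi> \<phi> p \<in> carrier R"
  unfolding \<Psi>_def using familyD(1)[OF \<phi>] by (auto intro!: S.finsum_closed simp: klin_closed subset_iff)

lemma \<Psi>_add: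
  assumes "supp p \<subseteq> \<Lambda>" "supp q \<subseteq> \<Lambda>" shows "\<Psi> \<phi> (p + q) = \<Psi> \<phi> p \<oplus> \<Psi> \<phi> q"
proof -
  let ?W = "supp p \<union> supp q"
  have W: "finite ?W" "?W \<subseteq> \<Lambda>" "supp (p + q) \<subseteq> ?W" using assms Poly_Mapping.keys_add[of p q] by auto
  have cl: "\<phi> v c \<in> carrier R" if "v \<in> ?W" for v c
    using W(2) that familyD(1)[OF \<phi>, of v] by (auto simp: klin_closed)
  have ad: "\<phi> v (\<theta> * cf (p + q) v) = \<phi> v (\<theta> * cf p v) \<oplus> \<phi> v (\<theta> * cf q v)" if "v \<in> ?W" for v
    using W(2) that familyD(1)[OF \<phi>, of v] by (auto simp: lookup_add distrib_left klin_add)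
  have "\<Psi> \<phi> (p + q) = (\<Oplus>v\<in>?W. \<phi> v (\<theta> * cf (p + q) v))" using W by (intro \<Psi>_superset) auto
  also have "\<dots> = (\<Oplus>v\<in>?W. \<phi> v (\<theta> * cf p v) \<oplus> \<phi> v (\<theta> * cf q v))"
    by (rule S.finsum_cong') (auto simp: ad cl)
  also have "\<dots> = (\<Oplus>v\<in>?W. \<phi> v (\<theta> * cf p v)) \<oplus> (\<Oplus>v\<in>?W. \<phi> v (\<theta> * cf q v))"
    by (rule S.finsum_addf) (auto simp: cl)
  also have "(\<Oplus>v\<in>?W. \<phi> v (\<theta> * cf p v)) = \<Psi> \<phi> p" using W by (intro \<Psi>_superset[symmetric]) auto
  also have "(\<Oplus>v\<in>?W. \<phi> v (\<theta> * cf q v)) = \<Psi> \<phi> q" using W by (intro \<Psi>_superset[symmetric]) auto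
  finally show ?thesis .
qed

lemma \<Psi>_sum:
  assumes "finite I" "\<And>i. i \<in> I \<Longrightarrow> supp (p i) \<subseteq> \<Lambda>"
  shows "\<Psi> \<phi> (\<Sum>i\<in>I. p i) = (\<Oplus>i\<in>I. \<Psi> \<phi> (p i))"
  using assms
proof (induction I rule: finite_induct)
  case empty then show ?case by (simp add: \<Psi>_def)
next
  case (insert i I)
  have "supp (\<Sum>i\<in>I. p i) \<subseteq> \<Lambda>" using insert.prems keys_sum[of p I] by blast
  then show ?case using insert by (subst S.finsum_insert) (auto simp: \<Psi>_add \<Psi>_closed)
qed

lemma \<Psi>_mon: "v \<in> \<Lambda> \<Longrightarrow> \<Psi> \<phi> (mon v c) = \<phi> v (\<theta> * c)"
  using familyD(1)[OF \<phi>, of v] by (subst \<Psi>_superset[of _ "{v}"]) (auto simp: S.finsum_insert klin_closed)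

lemma \<Psi>_\<tau>:
  assumes v: "v \<in> \<Lambda>" shows "\<Psi> \<phi> (\<tau> c v) = \<phi> v c"
proof -
  have l: "klin (\<phi> v)" using familyD(1)[OF \<phi>] v by blast
  have "\<Psi> \<phi> (\<tau> c v) = (\<Oplus>g\<in>G. \<phi> (g v) (\<theta> * act g c))"
    unfolding \<tau>_def using v familyD(1)[OF \<phi>]
    by (subst \<Psi>_sum) (auto simp: finite_G X_G \<Psi>_mon klin_closed split: if_splits intro!: S.finsum_cong')
  also have "\<dots> = (\<Oplus>g\<in>G. \<phi> v (\<theta> * c))"
  proof (rule S.finsum_cong')
    fix g assume g: "g \<in> G"
    then have "\<theta> * act g c = act g (\<theta> * c)" by (simp add: act_mult k0_act \<theta>_k0)
    then show "\<phi> (g v) (\<theta> * act g c) = \<phi> v (\<theta> * c)" using familyD(2)[OF \<phi> g v] by simp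
  qed (use l in \<open>auto simp: klin_closed\<close>)
  also have "\<dots> = \<phi> v (\<Sum>g\<in>G. \<theta> * c)" using l finite_G by (simp only: klin_sum)
  also have "(\<Sum>g\<in>G. \<theta> * c) = c" using card_G_pos by (simp add: \<theta>_def)
  finally show ?thesis .
qed

lemma \<Psi>_mult:
  assumes p: "p \<in> A0" and q: "q \<in> A0" shows "\<Psi> \<phi> (p * q) = \<Psi> \<phi> p \<otimes> \<Psi> \<phi> q"
proof -
  have s: "supp p \<subseteq> \<Lambda>" "supp q \<subseteq> \<Lambda>" using p q by (auto simp: A0_def)
  have s\<tau>: "supp (\<tau> c v) \<subseteq> \<Lambda>" if "v \<in> \<Lambda>" for c v using \<tau>_A0[OF that, of c] by (simp add: A0_def)
  have cl: "\<phi> v c \<in> carrier R" if "v \<in> \<Lambda>" for v c using familyD(1)[OF \<phi> that] by (simp add: klin_closed)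
  define P where "P u v = (\<Sum>g\<in>G. \<tau> (\<theta> * cf p u * act g (\<theta> * cf q v)) (u + g v))" for u v
  have \<Psi>P: "\<Psi> \<phi> (P u v) = \<phi> u (\<theta> * cf p u) \<otimes> \<phi> v (\<theta> * cf q v)" if "u \<in> supp p" "v \<in> supp q" for u v
  proof -
    have uv: "u \<in> \<Lambda>" "v \<in> \<Lambda>" using that s by auto
    have "\<Psi> \<phi> (P u v) = (\<Oplus>g\<in>G. \<phi> (u + g v) (\<theta> * cf p u * act g (\<theta> * cf q v)))"
      unfolding P_def using uv
      by (subst \<Psi>_sum) (auto simp: finite_G s\<tau> X_add X_G \<Psi>_\<tau> cl intro!: S.finsum_cong' dest!: subsetD[OF s\<tau>, rotated])
    then show ?thesis using familyD(4)[OF \<phi> uv] by simp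
  qed
  have sP: "supp (P u v) \<subseteq> \<Lambda>" if "u \<in> supp p" "v \<in> supp q" for u v
  proof -
    have "u \<in> \<Lambda>" "v \<in> \<Lambda>" using that s by auto
    then have "u + g v \<in> \<Lambda>" if "g \<in> G" for g using X_add[of u "g v"] X_G[OF that, of v] by auto
    then have "P u v \<in> A0" unfolding P_def by (intro A0_sum \<tau>_A0)
    then show ?thesis by (simp add: A0_def)
  qed
  have sPs: "supp (\<Sum>v\<in>supp q. P u v) \<subseteq> \<Lambda>" if "u \<in> supp p" for u
    using keys_sum[of "P u" "supp q"] sP[OF that] by blast
  have "p * q = (\<Sum>u\<in>supp p. \<Sum>v\<in>supp q. P u v)"
    using arg_cong2[OF A0_eq_sum_\<tau>[OF p] A0_eq_sum_\<tau>[OF q], of "(*)"]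
    by (simp only: sum_product \<tau>_mult P_def)
  then have "\<Psi> \<phi> (p * q) = (\<Oplus>u\<in>supp p. \<Psi> \<phi> (\<Sum>v\<in>supp q. P u v))"
    using sPs by (simp only: \<Psi>_sum finite_keys)
  also have "\<dots> = (\<Oplus>u\<in>supp p. \<Oplus>v\<in>supp q. \<Psi> \<phi> (P u v))"
    using sP by (intro S.finsum_cong' \<Psi>_sum) (auto intro!: S.finsum_closed \<Psi>_closed)
  also have "\<dots> = (\<Oplus>u\<in>supp p. \<Oplus>v\<in>supp q. \<phi> u (\<theta> * cf p u) \<otimes> \<phi> v (\<theta> * cf q v))"
    using s by (intro S.finsum_cong') (auto simp: \<Psi>P cl subset_iff intro!: S.finsum_cong')
  also have "\<dots> = \<Psi> \<phi> p \<otimes> \<Psi> \<phi> q"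
    unfolding \<Psi>_def using s by (intro S.finsum_mult[symmetric]) (auto simp: cl)
  finally show ?thesis .
qed

lemma family_point_ex: "\<exists>f. f \<in> alg_hom kk AA R \<and> (\<forall>v\<in>\<Lambda>. \<forall>c. fam f v c = \<phi> v c)"
proof (intro exI conjI ballI allI)
  let ?f = "\<lambda>x\<in>carrier AA. \<Psi> \<phi> (inv_into UNIV encA x)"
  have f: "?f (encA p) = \<Psi> \<phi> p" if "p \<in> A0" for p using that by auto
  have s: "p \<in> A0 \<Longrightarrow> supp p \<subseteq> \<Lambda>" for p by (simp add: A0_def)
  show "?f \<in> alg_hom kk AA R"
  proof (rule alg_homI)
    show "?f \<one>\<^bsub>AA\<^esub> = \<one>"
      using f[OF A0_closed(2)] \<Psi>_\<tau>[OF X_0, of \<theta>] familyD(3)[OF \<phi>, of \<theta>] S.smult_one[OF S.one_closed]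
      by (simp add: \<tau>_zero Tr_\<theta>)
    fix c x assume "c \<in> carrier kk" "x \<in> carrier AA"
    then obtain k p where kp: "c = \<kappa> k" "k \<in> k0" "x = encA p" "p \<in> A0" by auto
    have "supp (mon 0 k * p) \<subseteq> supp p" by (auto simp: in_keys_iff cf_const_mult)
    then have "\<Psi> \<phi> (mon 0 k * p) = (\<Oplus>v\<in>supp p. \<phi> v (k * (\<theta> * cf p v)))"
      using s[OF kp(4)] by (simp add: \<Psi>_superset cf_const_mult mult.left_commute)
    also have "\<dots> = \<kappa> k \<odot> \<Psi> \<phi> p"
      unfolding \<Psi>_def using s[OF kp(4)] familyD(1)[OF \<phi>] kp(2)
      by (subst smult_finsum) (auto simp: klin_closed klin_scale smult_closed' subset_iff intro!: S.finsum_cong')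
    finally show "?f (c \<odot>\<^bsub>AA\<^esub> x) = c \<odot> ?f x" using kp by (simp add: f A0_closed del: restrict_apply AA_simps(1))
  qed (use s in \<open>auto simp: A0_closed \<Psi>_closed \<Psi>_add \<Psi>_mult\<close>)
  show "fam ?f v c = \<phi> v c" if "v \<in> \<Lambda>" for v c
    using that by (simp add: fam_def \<tau>_A0 \<Psi>_\<tau>)
qed

end

lemma the_point:
  assumes "family \<phi>"
  defines "h \<equiv> THE h. h \<in> alg_hom kk AA R \<and> (\<forall>v\<in>\<Lambda>. \<forall>c. fam h v c = \<phi> v c)"
  shows "h \<in> alg_hom kk AA R" "v \<in> \<Lambda> \<Longrightarrow> fam h v c = \<phi> v c"
proof -
  have "\<exists>!h. h \<in> alg_hom kk AA R \<and> (\<forall>v\<in>\<Lambda>. \<forall>c. fam h v c = \<phi> v c)"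
    using family_point_ex[OF assms(1)] point_eqI by (metis (no_types, lifting))
  from theI'[OF this] show "h \<in> alg_hom kk AA R" "v \<in> \<Lambda> \<Longrightarrow> fam h v c = \<phi> v c" by (auto simp: h_def)
qed

end

lemma (in abelian_monoid) finsum_swap4:
  assumes fin: "finite A" "finite B" "finite C" "finite D"
    and f: "\<And>a b c d. f a b c d \<in> carrier G"
  shows "(\<Oplus>a\<in>A. \<Oplus>b\<in>B. \<Oplus>c\<in>C. \<Oplus>d\<in>D. f a b c d) = (\<Oplus>c\<in>C. \<Oplus>d\<in>D. \<Oplus>b\<in>B. \<Oplus>a\<in>A. f a b c d)"
proof -
  have "(\<Oplus>a\<in>A. \<Oplus>b\<in>B. \<Oplus>c\<in>C. \<Oplus>d\<in>D. f a b c d) = (\<Oplus>b\<in>B. \<Oplus>a\<in>A. \<Oplus>c\<in>C. \<Oplus>d\<in>D. f a b c d)"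
    using f by (intro finsum_swap fin) auto
  also have "\<dots> = (\<Oplus>b\<in>B. \<Oplus>c\<in>C. \<Oplus>a\<in>A. \<Oplus>d\<in>D. f a b c d)"
    using f by (intro finsum_cong' finsum_swap fin) auto
  also have "\<dots> = (\<Oplus>c\<in>C. \<Oplus>b\<in>B. \<Oplus>a\<in>A. \<Oplus>d\<in>D. f a b c d)"
    using f by (intro finsum_swap fin) auto
  also have "\<dots> = (\<Oplus>c\<in>C. \<Oplus>b\<in>B. \<Oplus>d\<in>D. \<Oplus>a\<in>A. f a b c d)"
    using f by (intro finsum_cong' finsum_swap fin) auto
  also have "\<dots> = (\<Oplus>c\<in>C. \<Oplus>d\<in>D. \<Oplus>b\<in>B. \<Oplus>a\<in>A. f a b c d)"
    using f by (intro finsum_cong' finsum_swap fin) auto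
  finally show ?thesis .
qed

context torus_point
begin

lemma family_klin: "family \<phi> \<Longrightarrow> v \<in> \<Lambda> \<Longrightarrow> klin (\<phi> v)"
  by (rule familyD)

lemma family_closed: "family \<phi> \<Longrightarrow> v \<in> \<Lambda> \<Longrightarrow> \<phi> v c \<in> carrier R"
  using familyD(1) klin_closed by blast

lemma canonical_collapse:
  assumes l: "klin l1" "klin l2" and g: "g \<in> G" and h: "h \<in> G"
  shows "(\<Oplus>j\<in>{..<m}. \<Oplus>i\<in>{..<m}. l1 (\<beta> i * act g (\<beta> j)) \<otimes> l2 (c * \<alpha> i * act h (d * \<alpha> j)))
       = (if g = h then ct R l1 l2 (c * act g d) else \<zero>)"
proof -
  have cl: "l1 x \<in> carrier R" "l2 x \<in> carrier R" for x using l by (auto simp: klin_closed)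
  have "(\<Oplus>j\<in>{..<m}. \<Oplus>i\<in>{..<m}. l1 (\<beta> i * act g (\<beta> j)) \<otimes> l2 (c * \<alpha> i * act h (d * \<alpha> j)))
      = (\<Oplus>j\<in>{..<m}. ct R l1 l2 (c * act h d * (act h (\<alpha> j) * act g (\<beta> j))))"
  proof (rule S.finsum_cong')
    fix j
    have "(\<Oplus>i\<in>{..<m}. l1 (\<beta> i * act g (\<beta> j)) \<otimes> l2 (c * \<alpha> i * act h (d * \<alpha> j)))
        = (\<Oplus>i\<in>{..<m}. l1 (act g (\<beta> j) * \<beta> i) \<otimes> l2 ((c * act h d * act h (\<alpha> j)) * \<alpha> i))"
      by (simp add: act_mult[OF h] mult_ac)
    also have "\<dots> = ct R l1 l2 (act g (\<beta> j) * (c * act h d * act h (\<alpha> j)))"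
      by (rule canonical_ct[OF canonical_\<beta>\<alpha> l])
    finally show "(\<Oplus>i\<in>{..<m}. l1 (\<beta> i * act g (\<beta> j)) \<otimes> l2 (c * \<alpha> i * act h (d * \<alpha> j)))
        = ct R l1 l2 (c * act h d * (act h (\<alpha> j) * act g (\<beta> j)))" by (simp add: mult_ac)
  qed (use l in \<open>auto simp: ct_closed\<close>)
  also have "\<dots> = ct R l1 l2 (c * act h d * (\<Sum>j<m. act h (\<alpha> j) * act g (\<beta> j)))"
    by (simp only: sum_distrib_left klin_sum[OF _ ct_klin[OF l]] finite_lessThan)
  also have "\<dots> = (if g = h then ct R l1 l2 (c * act g d) else \<zero>)"
    using coords_gen[OF h g] klin_0[OF ct_klin[OF l]] by auto
  finally show ?thesis .
qed

lemma ct_family: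
  assumes \<phi>: "family \<phi>" and \<psi>: "family \<psi>"
  shows "family (\<lambda>v. ct R (\<phi> v) (\<psi> v))"
proof -
  have "ct R (\<phi> (g v)) (\<psi> (g v)) (act g c) = ct R (\<phi> v) (\<psi> v) c" if g: "g \<in> G" and v: "v \<in> \<Lambda>" for g v c
  proof -
    have "ct R (\<phi> (g v)) (\<psi> (g v)) (act g c)
        = (\<Oplus>i\<in>{..<m}. \<phi> (g v) (act g (\<beta> i)) \<otimes> \<psi> (g v) (act g c * act g (\<alpha> i)))"
      using canonical_ct[OF canonical_act[OF g], of "\<phi> (g v)" "\<psi> (g v)" 1 "act g c"] X_G[OF g v]
      by (simp add: family_klin \<phi> \<psi>)
    also have "\<dots> = ct R (\<phi> v) (\<psi> v) c"
      using g v by (simp add: act_mult[symmetric] familyD(2)[OF \<phi>] familyD(2)[OF \<psi>] ct_def)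
    finally show ?thesis .
  qed
  moreover have "ct R (\<phi> 0) (\<psi> 0) c = \<kappa> (Tr c) \<odot> \<one>" for c
  proof -
    have "\<phi> 0 = (\<lambda>c. \<kappa> (Tr c) \<odot> \<one>)" using familyD(3)[OF \<phi>] by auto
    then show ?thesis using ct_one[OF family_klin[OF \<psi> X_0]] familyD(3)[OF \<psi>] by simp
  qed
  moreover have "ct R (\<phi> u) (\<psi> u) c \<otimes> ct R (\<phi> v) (\<psi> v) d
      = (\<Oplus>g\<in>G. ct R (\<phi> (u + g v)) (\<psi> (u + g v)) (c * act g d))" if u: "u \<in> \<Lambda>" and v: "v \<in> \<Lambda>" for u v c d
  proof -
    define F where "F i j g h = (if g \<in> G \<and> h \<in> G then
      \<phi> (u + g v) (\<beta> i * act g (\<beta> j)) \<otimes> \<psi> (u + h v) (c * \<alpha> i * act h (d * \<alpha> j)) else \<zero>)" for i j g h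
    have uv: "u + g v \<in> \<Lambda>" if "g \<in> G" for g using X_add[OF u X_G[OF that v]] .
    have cl: "\<phi> u x \<in> carrier R" "\<psi> u x \<in> carrier R" "\<phi> v x \<in> carrier R" "\<psi> v x \<in> carrier R" for x
      using u v by (auto simp: family_closed \<phi> \<psi>)
    have cl': "\<phi> (u + g v) x \<in> carrier R" "\<psi> (u + g v) x \<in> carrier R" if "g \<in> G" for g x
      using uv[OF that] by (auto simp: family_closed \<phi> \<psi>)
    have Fcl: "F i j g h \<in> carrier R" for i j g h by (auto simp: F_def cl')
    have "ct R (\<phi> u) (\<psi> u) c \<otimes> ct R (\<phi> v) (\<psi> v) d
      = (\<Oplus>i\<in>{..<m}. \<Oplus>j\<in>{..<m}. \<phi> u (\<beta> i) \<otimes> \<psi> u (c * \<alpha> i) \<otimes> (\<phi> v (\<beta> j) \<otimes> \<psi> v (d * \<alpha> j)))"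
      unfolding ct_def by (intro S.finsum_mult) (auto simp: cl)
    also have "\<dots> = (\<Oplus>i\<in>{..<m}. \<Oplus>j\<in>{..<m}. \<Oplus>g\<in>G. \<Oplus>h\<in>G. F i j g h)"
    proof (intro S.finsum_cong' refl)
      fix i j
      have "\<phi> u (\<beta> i) \<otimes> \<psi> u (c * \<alpha> i) \<otimes> (\<phi> v (\<beta> j) \<otimes> \<psi> v (d * \<alpha> j))
         = (\<phi> u (\<beta> i) \<otimes> \<phi> v (\<beta> j)) \<otimes> (\<psi> u (c * \<alpha> i) \<otimes> \<psi> v (d * \<alpha> j))"
        by (simp add: cl S.m_ac)
      also have "\<dots> = (\<Oplus>g\<in>G. \<phi> (u + g v) (\<beta> i * act g (\<beta> j))) \<otimes> (\<Oplus>h\<in>G. \<psi> (u + h v) (c * \<alpha> i * act h (d * \<alpha> j)))"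
        by (simp add: familyD(4)[OF \<phi> u v] familyD(4)[OF \<psi> u v])
      also have "\<dots> = (\<Oplus>g\<in>G. \<Oplus>h\<in>G. \<phi> (u + g v) (\<beta> i * act g (\<beta> j)) \<otimes> \<psi> (u + h v) (c * \<alpha> i * act h (d * \<alpha> j)))"
        by (intro S.finsum_mult) (auto simp: finite_G cl')
      also have "\<dots> = (\<Oplus>g\<in>G. \<Oplus>h\<in>G. F i j g h)"
        by (intro S.finsum_cong' refl) (auto simp: F_def intro!: S.finsum_closed S.m_closed cl')
      finally show "\<phi> u (\<beta> i) \<otimes> \<psi> u (c * \<alpha> i) \<otimes> (\<phi> v (\<beta> j) \<otimes> \<psi> v (d * \<alpha> j)) = (\<Oplus>g\<in>G. \<Oplus>h\<in>G. F i j g h)" .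
    qed (auto simp: Fcl)
    also have "\<dots> = (\<Oplus>g\<in>G. \<Oplus>h\<in>G. \<Oplus>j\<in>{..<m}. \<Oplus>i\<in>{..<m}. F i j g h)"
      by (rule S.finsum_swap4) (auto simp: finite_G Fcl)
    also have "\<dots> = (\<Oplus>g\<in>G. \<Oplus>h\<in>G. if g = h then ct R (\<phi> (u + g v)) (\<psi> (u + g v)) (c * act g d) else \<zero>)"
    proof (intro S.finsum_cong' refl)
      fix g h assume gh: "g \<in> G" "h \<in> G"
      have "(\<Oplus>j\<in>{..<m}. \<Oplus>i\<in>{..<m}. F i j g h)
         = (if g = h then ct R (\<phi> (u + g v)) (\<psi> (u + h v)) (c * act g d) else \<zero>)"
        using gh canonical_collapse[of "\<phi> (u + g v)" "\<psi> (u + h v)" g h c d] uv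
        by (simp add: F_def family_klin \<phi> \<psi>)
      then show "(\<Oplus>j\<in>{..<m}. \<Oplus>i\<in>{..<m}. F i j g h)
         = (if g = h then ct R (\<phi> (u + g v)) (\<psi> (u + g v)) (c * act g d) else \<zero>)" by auto
    qed (use uv in \<open>auto simp: ct_closed family_klin \<phi> \<psi>\<close>)
    also have "\<dots> = (\<Oplus>g\<in>G. ct R (\<phi> (u + g v)) (\<psi> (u + g v)) (c * act g d))"
      using uv by (intro S.finsum_cong') (auto simp: S.add.finprod_singleton finite_G ct_closed family_klin \<phi> \<psi>)
    finally show ?thesis .
  qed
  ultimately show ?thesis using \<phi> \<psi> by (simp add: family_def ct_klin)
qed

lemma one_family: "family (\<lambda>v c. \<kappa> (Tr c) \<odot> \<one>)"
proof -
  have "\<kappa> (Tr c) \<odot> \<one> \<otimes> (\<kappa> (Tr d) \<odot> \<one>) = (\<Oplus>g\<in>G. \<kappa> (Tr (c * act g d)) \<odot> \<one>)" for c d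
  proof -
    have "(\<Oplus>g\<in>G. \<kappa> (Tr (c * act g d)) \<odot> \<one>) = \<kappa> (Tr (\<Sum>g\<in>G. c * act g d)) \<odot> \<one>"
      by (rule klin_sum[OF finite_G klin_one, symmetric])
    also have "(\<Sum>g\<in>G. c * act g d) = Tr d * c" by (simp add: Tr_def sum_distrib_left mult.commute[of _ c])
    also have "\<kappa> (Tr (Tr d * c)) \<odot> \<one> = \<kappa> (Tr c) \<odot> \<one> \<otimes> (\<kappa> (Tr d) \<odot> \<one>)"
      by (simp add: Tr_scale Tr_k0 S.smult_assoc1[symmetric] S.smult_assoc2 S.m_comm[of \<one>] smult_closed' mult.commute[of "Tr c" "Tr d"])
    finally show ?thesis by simp
  qed
  then show ?thesis using klin_one by (simp add: family_def Tr_act)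
qed

lemma inv_family:
  assumes \<phi>: "family \<phi>" shows "family (\<lambda>v. \<phi> (- v))"
  unfolding family_def
proof (intro conjI ballI allI)
  fix u v c d assume uv: "u \<in> \<Lambda>" "v \<in> \<Lambda>"
  have "\<phi> (- u) c \<otimes> \<phi> (- v) d = (\<Oplus>g\<in>G. \<phi> (- u + g (- v)) (c * act g d))"
    using uv by (intro familyD(4)[OF \<phi>] X_uminus)
  also have "\<dots> = (\<Oplus>g\<in>G. \<phi> (- (u + g v)) (c * act g d))"
  proof (rule S.finsum_cong'[OF refl])
    show "(\<lambda>g. \<phi> (- (u + g v)) (c * act g d)) \<in> G \<rightarrow> carrier R"
      using uv by (intro Pi_I family_closed[OF \<phi>] X_uminus X_add) (auto intro: X_G)
    fix g assume "g \<in> G"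
    then have "- u + g (- v) = - (u + g v)" by (simp add: G_uminus)
    then show "\<phi> (- u + g (- v)) (c * act g d) = \<phi> (- (u + g v)) (c * act g d)" by simp
  qed
  finally show "\<phi> (- u) c \<otimes> \<phi> (- v) d = (\<Oplus>g\<in>G. \<phi> (- (u + g v)) (c * act g d))" .
qed (use \<phi> in \<open>auto simp: familyD family_klin X_uminus G_uminus[symmetric]\<close>)

lemma inv_family_ct:
  assumes \<phi>: "family \<phi>" and v: "v \<in> \<Lambda>"
  shows "ct R (\<phi> (- v)) (\<phi> v) c = \<kappa> (Tr c) \<odot> \<one>"
proof -
  have v': "- v \<in> \<Lambda>" using v by (rule X_uminus)
  have uv: "- v + g v \<in> \<Lambda>" if "g \<in> G" for g using X_add[OF v' X_G[OF that v]] .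
  have "ct R (\<phi> (- v)) (\<phi> v) c = (\<Oplus>i\<in>{..<m}. \<Oplus>g\<in>G. \<phi> (- v + g v) (\<beta> i * act g (c * \<alpha> i)))"
    unfolding ct_def using uv by (intro S.finsum_cong' refl) (auto simp: familyD(4)[OF \<phi> v' v] family_closed \<phi>)
  also have "\<dots> = (\<Oplus>g\<in>G. \<Oplus>i\<in>{..<m}. \<phi> (- v + g v) (\<beta> i * act g (c * \<alpha> i)))"
    using uv by (intro S.finsum_swap) (auto simp: finite_G family_closed \<phi>)
  also have "\<dots> = (\<Oplus>g\<in>G. if id = g then \<phi> 0 c else \<zero>)"
  proof (rule S.finsum_cong'[OF refl])
    fix g assume g: "g \<in> G"
    have k: "klin (\<phi> (- v + g v))" using uv[OF g] by (rule family_klin[OF \<phi>])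
    have "(\<Oplus>i\<in>{..<m}. \<phi> (- v + g v) (\<beta> i * act g (c * \<alpha> i))) = \<phi> (- v + g v) (\<Sum>i<m. \<beta> i * act g (c * \<alpha> i))"
      by (rule klin_sum[OF _ k, symmetric]) simp
    also have "(\<Sum>i<m. \<beta> i * act g (c * \<alpha> i)) = act g c * (\<Sum>i<m. act g (\<alpha> i) * act id (\<beta> i))"
      by (simp add: act_mult[OF g] act_id sum_distrib_left mult_ac)
    also have "\<dots> = (if g = id then c else 0)" unfolding coords_gen[OF g id_G] by (auto simp: act_id)
    finally show "(\<Oplus>i\<in>{..<m}. \<phi> (- v + g v) (\<beta> i * act g (c * \<alpha> i))) = (if id = g then \<phi> 0 c else \<zero>)"
      using klin_0[OF k] by auto
  qed (auto simp: family_closed \<phi> X_0)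
  also have "\<dots> = \<phi> 0 c"
    by (rule S.add.finprod_singleton[OF id_G finite_G]) (auto simp: family_closed \<phi> X_0)
  finally show ?thesis using familyD(3)[OF \<phi>] by simp
qed

lemma TT_mult:
  assumes "f \<in> alg_hom kk AA R" "g \<in> alg_hom kk AA R"
  shows "f \<otimes>\<^bsub>TT R\<^esub> g \<in> alg_hom kk AA R" "v \<in> \<Lambda> \<Longrightarrow> fam (f \<otimes>\<^bsub>TT R\<^esub> g) v c = ct R (fam f v) (fam g v) c"
  using the_point[OF ct_family[OF point_family point_family], OF assms] by (simp_all add: TT_def)

lemma TT_one:
  shows "\<one>\<^bsub>TT R\<^esub> \<in> alg_hom kk AA R" "v \<in> \<Lambda> \<Longrightarrow> fam \<one>\<^bsub>TT R\<^esub> v c = \<kappa> (Tr c) \<odot> \<one>"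
  using the_point[OF one_family] by (simp_all add: TT_def)

lemma fam_klin: "f \<in> alg_hom kk AA R \<Longrightarrow> v \<in> \<Lambda> \<Longrightarrow> klin (fam f v)"
  using point_family family_klin by blast

lemma ct_cong: "(\<And>c. l1 c = l1' c) \<Longrightarrow> (\<And>c. l2 c = l2' c) \<Longrightarrow> ct R l1 l2 c = ct R l1' l2' c"
  by (simp add: ct_def)

lemma TT_group: "group (TT R)"
proof (rule groupI)
  fix f g h assume fgh: "f \<in> carrier (TT R)" "g \<in> carrier (TT R)" "h \<in> carrier (TT R)"
  show "f \<otimes>\<^bsub>TT R\<^esub> g \<otimes>\<^bsub>TT R\<^esub> h = f \<otimes>\<^bsub>TT R\<^esub> (g \<otimes>\<^bsub>TT R\<^esub> h)"
    using fgh by (intro point_eqI) (auto simp: TT_mult fam_klin ct_assoc cong: ct_cong)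
next
  fix f assume f: "f \<in> carrier (TT R)"
  show "\<one>\<^bsub>TT R\<^esub> \<otimes>\<^bsub>TT R\<^esub> f = f"
    using f by (intro point_eqI) (auto simp: TT_mult TT_one fam_klin ct_one cong: ct_cong)
  obtain h where h: "h \<in> alg_hom kk AA R" "\<And>v c. v \<in> \<Lambda> \<Longrightarrow> fam h v c = fam f (- v) c"
    using family_point_ex[OF inv_family[OF point_family[of f]]] f by auto
  show "\<exists>h\<in>carrier (TT R). h \<otimes>\<^bsub>TT R\<^esub> f = \<one>\<^bsub>TT R\<^esub>"
    using f h by (intro bexI[of _ h] point_eqI) (auto simp: TT_mult TT_one inv_family_ct point_family cong: ct_cong)
qed (auto simp: TT_mult TT_one)

lemma TT_inv_fam:
  assumes f: "f \<in> alg_hom kk AA R" and v: "v \<in> \<Lambda>"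
  shows "fam (inv\<^bsub>TT R\<^esub> f) v c = fam f (- v) c"
proof -
  interpret T: group "TT R" by (rule TT_group)
  obtain h where h: "h \<in> alg_hom kk AA R" "\<And>v c. v \<in> \<Lambda> \<Longrightarrow> fam h v c = fam f (- v) c"
    using family_point_ex[OF inv_family[OF point_family[OF f]]] by auto
  have "h \<otimes>\<^bsub>TT R\<^esub> f = \<one>\<^bsub>TT R\<^esub>"
    using f h by (intro point_eqI) (auto simp: TT_mult TT_one inv_family_ct point_family cong: ct_cong)
  then have "inv\<^bsub>TT R\<^esub> f = h" using f h(1) by (intro T.inv_equality) auto
  then show ?thesis using h v by simp
qed

end

context torus_data
begin

lemma torus_pointI: "algebra kk R \<Longrightarrow> torus_point G act \<alpha> \<beta> m \<Lambda> e n crd emb encK encA R"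
  by (intro torus_point.intro torus_point_axioms.intro torus_data_axioms)

lemma fam_compose: "v \<in> \<Lambda> \<Longrightarrow> fam (compose (encA ` A0) f x) v c = f (fam x v c)"
  by (simp add: fam_def compose_eq \<tau>_A0)

lemma TT_functorial:
  assumes R: "algebra kk R" and S: "algebra kk S" and f: "f \<in> alg_hom kk R S"
  shows "(\<lambda>x. compose (carrier AA) f x) \<in> hom (TT R) (TT S)"
proof -
  interpret R: torus_point G act \<alpha> \<beta> m \<Lambda> e n crd emb encK encA R using R by (rule torus_pointI)
  interpret S: torus_point G act \<alpha> \<beta> m \<Lambda> e n crd emb encK encA S using S by (rule torus_pointI)
  interpret f: ring_hom_cring R S f
    using f R.S.M_cring S.S.M_cring by unfold_locales (auto simp: alg_hom_def cring_def)
  have cl: "compose (carrier AA) f x \<in> alg_hom kk AA S" if "x \<in> alg_hom kk AA R" for x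
    by (rule alg_hom_compose[OF that f algebra_AA])
  show ?thesis
  proof (rule homI)
    fix x y assume xy: "x \<in> carrier (TT R)" "y \<in> carrier (TT R)"
    show "compose (carrier AA) f (x \<otimes>\<^bsub>TT R\<^esub> y) = compose (carrier AA) f x \<otimes>\<^bsub>TT S\<^esub> compose (carrier AA) f y"
    proof (rule S.point_eqI)
      fix v c assume v: "v \<in> \<Lambda>"
      have k: "fam x v c \<in> carrier R" "fam y v c \<in> carrier R" for c
        using xy v R.fam_klin R.klin_closed by auto
      have "fam (compose (carrier AA) f (x \<otimes>\<^bsub>TT R\<^esub> y)) v c = f (ct R (fam x v) (fam y v) c)"
        using xy v by (simp add: fam_compose R.TT_mult)
      also have "\<dots> = ct S (fam (compose (carrier AA) f x) v) (fam (compose (carrier AA) f y) v) c"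
        unfolding ct_def using k v by (subst f.hom_finsum) (auto simp: fam_compose intro!: S.S.finsum_cong')
      also have "\<dots> = fam (compose (carrier AA) f x \<otimes>\<^bsub>TT S\<^esub> compose (carrier AA) f y) v c"
        using xy v cl by (simp add: S.TT_mult)
      finally show "fam (compose (carrier AA) f (x \<otimes>\<^bsub>TT R\<^esub> y)) v c
         = fam (compose (carrier AA) f x \<otimes>\<^bsub>TT S\<^esub> compose (carrier AA) f y) v c" .
    qed (use xy cl in \<open>auto simp: R.TT_mult S.TT_mult\<close>)
  qed (use cl in auto)
qed

lemma TT_group_at: "algebra kk R \<Longrightarrow> group (TT R)"
  by (rule torus_point.TT_group[OF torus_pointI])

lemma TT_group_scheme: "affine_group_scheme kk AA TT"
  unfolding affine_group_scheme_def
  using field_kk algebra_AA TT_functorial TT_group_at by auto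

end

context galois_action
begin

lemma inv0_transl:
  assumes p: "p \<in> inv0" and g: "g \<in> G"
  shows "(\<Sum>v\<in>supp p. mon (g v) (act g (cf p v))) = p"
proof -
  have iff: "g v \<in> supp p \<longleftrightarrow> v \<in> supp p" for v
    using p g by (simp add: inv0_def in_keys_iff act_eq_0_iff)
  have "g ` supp p = supp p"
  proof (intro equalityI subsetI)
    fix w assume "w \<in> supp p"
    then have "inv_into UNIV g w \<in> supp p" using iff[of "inv_into UNIV g w"] g by simp
    moreover have "w = g (inv_into UNIV g w)" using g by simp
    ultimately show "w \<in> g ` supp p" by (rule rev_image_eqI)
  next
    fix w assume "w \<in> g ` supp p"
    then obtain v where "w = g v" "v \<in> supp p" by auto
    then show "w \<in> supp p" using iff[of v] by simp
  qed
  moreover have "(\<Sum>v\<in>supp p. mon (g v) (act g (cf p v))) = (\<Sum>v\<in>g ` supp p. mon v (cf p v))"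
    using p g by (subst sum.reindex) (auto simp: inj_on_def inj_G inv0_def)
  ultimately show ?thesis using sum_mon[of p] by simp
qed

definition tr_all :: "('v \<Rightarrow>\<^sub>0 'l) \<Rightarrow> 'v \<Rightarrow>\<^sub>0 'l" where
  "tr_all p = (\<Sum>v\<in>supp p. \<tau> (cf p v) v)"

lemma tr_all_superset: "finite W \<Longrightarrow> supp p \<subseteq> W \<Longrightarrow> tr_all p = (\<Sum>v\<in>W. \<tau> (cf p v) v)"
  unfolding tr_all_def by (rule sum.mono_neutral_left) (auto simp: in_keys_iff \<tau>_0)

lemma tr_all_add: "tr_all (p + q) = tr_all p + tr_all q"
proof -
  let ?W = "supp p \<union> supp q"
  have "tr_all (p + q) = (\<Sum>v\<in>?W. \<tau> (cf (p + q) v) v)"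
    using Poly_Mapping.keys_add[of p q] by (intro tr_all_superset) auto
  moreover have "tr_all p = (\<Sum>v\<in>?W. \<tau> (cf p v) v)" "tr_all q = (\<Sum>v\<in>?W. \<tau> (cf q v) v)"
    by (auto intro: tr_all_superset)
  ultimately show ?thesis by (simp add: lookup_add \<tau>_add sum.distrib)
qed

lemma tr_all_const_mult:
  assumes p: "p \<in> inv0" shows "tr_all (mon 0 c * p) = mon 0 (Tr c) * p"
proof -
  have "tr_all (mon 0 c * p) = (\<Sum>v\<in>supp p. \<tau> (c * cf p v) v)"
    by (subst tr_all_superset[of "supp p"]) (auto simp: in_keys_iff cf_const_mult)
  also have "\<dots> = (\<Sum>g\<in>G. mon 0 (act g c) * (\<Sum>v\<in>supp p. mon (g v) (act g (cf p v))))"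
    unfolding \<tau>_def by (subst sum.swap) (auto simp: act_mult sum_distrib_left mult_single intro!: sum.cong)
  also have "\<dots> = (\<Sum>g\<in>G. mon 0 (act g c) * p)" using inv0_transl[OF p] by simp
  also have "\<dots> = mon 0 (Tr c) * p" by (simp add: Tr_def mon_sum sum_distrib_right)
  finally show ?thesis .
qed

text \<open>\<open>lspan B\<close> is the \<open>L\<close>-span of \<open>B\<close>.\<close>

inductive_set lspan :: "('v \<Rightarrow>\<^sub>0 'l) set \<Rightarrow> ('v \<Rightarrow>\<^sub>0 'l) set" for B where
  base: "a \<in> B \<Longrightarrow> mon 0 c * a \<in> lspan B"
| add: "p \<in> lspan B \<Longrightarrow> q \<in> lspan B \<Longrightarrow> p + q \<in> lspan B"

lemma lspan_scale: "p \<in> lspan B \<Longrightarrow> mon 0 c * p \<in> lspan B"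
proof (induction rule: lspan.induct)
  case (base b d)
  have "mon 0 c * (mon 0 d * b) = mon 0 (c * d) * b" by (simp add: mult_single mult.assoc[symmetric])
  then show ?case using base by (metis lspan.base)
qed (auto simp: distrib_left intro: lspan.add)

lemma lspan_mult:
  assumes B: "\<And>a b. a \<in> B \<Longrightarrow> b \<in> B \<Longrightarrow> a * b \<in> B"
  shows "p \<in> lspan B \<Longrightarrow> q \<in> lspan B \<Longrightarrow> p * q \<in> lspan B"
proof (induction rule: lspan.induct)
  case (base b c)
  from base(2) have "b * q \<in> lspan B"
  proof (induction rule: lspan.induct)
    case (base b' c')
    have "b * (mon 0 c' * b') = mon 0 c' * (b * b')" by (simp add: mult_ac)
    then show ?case using B[OF \<open>b \<in> B\<close> base] by (metis lspan.base)
  qed (auto simp: distrib_left intro: lspan.add)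
  then show ?case using lspan_scale[of "b * q" B c] by (simp add: mult.assoc)
qed (auto simp: distrib_right intro: lspan.add)

lemma lspan_tr_all:
  assumes B: "B \<subseteq> inv0" "\<And>a b. a \<in> B \<Longrightarrow> b \<in> B \<Longrightarrow> a + b \<in> B" "\<And>c b. c \<in> k0 \<Longrightarrow> b \<in> B \<Longrightarrow> mon 0 c * b \<in> B"
  shows "p \<in> lspan B \<Longrightarrow> tr_all p \<in> B"
proof (induction rule: lspan.induct)
  case (base b c)
  then show ?case using B(1,3) by (auto simp: tr_all_const_mult Tr_k0)
qed (use B in \<open>auto simp: tr_all_add\<close>)

end

context torus_data
begin

lemma A0_generated:
  assumes B: "B \<subseteq> A0" "1 \<in> B" "\<And>a b. a \<in> B \<Longrightarrow> b \<in> B \<Longrightarrow> a + b \<in> B" "\<And>a b. a \<in> B \<Longrightarrow> b \<in> B \<Longrightarrow> a * b \<in> B"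
    "\<And>c b. c \<in> k0 \<Longrightarrow> b \<in> B \<Longrightarrow> mon 0 c * b \<in> B"
    and e: "\<And>j. j < n \<Longrightarrow> \<exists>c. c \<noteq> 0 \<and> (\<forall>i<m. \<tau> (\<beta> i * c) (e j) \<in> B)"
    and e': "\<And>j. j < n \<Longrightarrow> \<exists>c. c \<noteq> 0 \<and> (\<forall>i<m. \<tau> (\<beta> i * c) (- e j) \<in> B)"
  shows "B = A0"
proof
  have B0: "B \<subseteq> inv0" using B(1) by (auto simp: A0_def)
  have l0: "0 \<in> lspan B" using lspan.base[OF B(2), of 0] by simp
  have lsum: "(\<And>i. i \<in> I \<Longrightarrow> f i \<in> lspan B) \<Longrightarrow> sum f I \<in> lspan B" for f :: "'i \<Rightarrow> _" and I
    by (induction I rule: infinite_finite_induct) (auto simp: l0 lspan.add)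
  have key: "mon v c \<in> lspan B" if d: "d \<noteq> 0" "\<forall>i<m. \<tau> (\<beta> i * d) v \<in> B" for v c d
  proof -
    have "mon v d = (\<Sum>i<m. mon 0 (\<alpha> i) * \<tau> (\<beta> i * d) v)" by (rule mon_eq_sum_\<tau>)
    also have "\<dots> \<in> lspan B" using d(2) by (intro lsum lspan.base) auto
    finally have "mon 0 (c / d) * mon v d \<in> lspan B" by (rule lspan_scale)
    then show ?thesis using d(1) by (simp add: mult_single)
  qed
  let ?H = "{v. \<forall>c. mon v c \<in> lspan B \<and> mon (- v) c \<in> lspan B}"
  have "\<Lambda> \<subseteq> ?H"
  proof (rule e_gen)
    show "0 \<in> ?H" using lspan.base[OF B(2)] by auto
    show "u + v \<in> ?H" if "u \<in> ?H" "v \<in> ?H" for u v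
    proof -
      have "mon u c * mon v 1 \<in> lspan B" "mon (- u) c * mon (- v) 1 \<in> lspan B" for c
        using that by (auto intro!: lspan_mult B)
      then show ?thesis by (simp add: mult_single)
    qed
    show "e j \<in> ?H" if "j < n" for j using e[OF that] e'[OF that] key by blast
  qed auto
  then have mon: "mon v c \<in> lspan B" if "v \<in> \<Lambda>" for v c using that by blast
  show "A0 \<subseteq> B"
  proof
    fix p assume p: "p \<in> A0"
    then have pi: "p \<in> inv0" and ps: "supp p \<subseteq> \<Lambda>" by (auto simp: A0_def)
    have "(\<Sum>v\<in>supp p. mon v (cf p v)) \<in> lspan B" using ps by (intro lsum mon) auto
    then have "tr_all p \<in> B" using lspan_tr_all[OF B0 B(3,5)] by (simp add: sum_mon)
    moreover have "inverse (of_nat (card G)) \<in> k0" using k0_of_nat by blast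
    ultimately have "mon 0 (inverse (of_nat (card G))) * tr_all p \<in> B" by (intro B(5))
    moreover have "mon 0 (inverse (of_nat (card G))) * tr_all p = p"
      using card_G_pos unfolding tr_all_def inv0_sum_\<tau>[OF pi, symmetric] mult.assoc[symmetric] mult_single by simp
    ultimately show "p \<in> B" by simp
  qed
qed (rule B)

lemma generate_AA:
  assumes H: "H \<subseteq> carrier AA"
    and e: "\<And>j. j < n \<Longrightarrow> \<exists>c. c \<noteq> 0 \<and> (\<forall>i<m. encA (\<tau> (\<beta> i * c) (e j)) \<in> H)"
    and e': "\<And>j. j < n \<Longrightarrow> \<exists>c. c \<noteq> 0 \<and> (\<forall>i<m. encA (\<tau> (\<beta> i * c) (- e j)) \<in> H)"
  shows "generate_alg kk AA H = carrier AA"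
proof -
  interpret AA: algebra kk AA by (rule algebra_AA)
  let ?K = "{c \<odot>\<^bsub>AA\<^esub> \<one>\<^bsub>AA\<^esub> | c. c \<in> carrier kk}"
  let ?g = "generate_ring AA (?K \<union> H)"
  have sub: "?K \<union> H \<subseteq> carrier AA" using H by auto (metis A0_closed(2,6) imageI mult.right_neutral)
  then have g: "?g \<subseteq> carrier AA" by (rule AA.generate_ring_incl)
  let ?B = "{p \<in> A0. encA p \<in> ?g}"
  have "?B = A0"
  proof (rule A0_generated)
    show "1 \<in> ?B" using generate_ring.one[of AA] by (auto simp: A0_closed)
    show "a + b \<in> ?B" "a * b \<in> ?B" if "a \<in> ?B" "b \<in> ?B" for a b
      using that generate_ring.eng_add[of "encA a" AA _ "encA b"] generate_ring.eng_mult[of "encA a" AA _ "encA b"]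
      by (auto simp: A0_closed)
    show "mon 0 c * b \<in> ?B" if c: "c \<in> k0" and b: "b \<in> ?B" for c b
    proof -
      have "encA (mon 0 c) \<in> ?K" using c by (auto intro!: exI[of _ "\<kappa> c"])
      then have "encA (mon 0 c) \<otimes>\<^bsub>AA\<^esub> encA b \<in> ?g"
        using b by (intro generate_ring.eng_mult) (auto intro: generate_ring.incl)
      then show ?thesis using b c by (simp add: A0_closed)
    qed
    show "\<exists>c. c \<noteq> 0 \<and> (\<forall>i<m. \<tau> (\<beta> i * c) (e j) \<in> ?B)" if "j < n" for j
      using e[OF that] e_X[OF that] by (auto simp: \<tau>_A0 generate_ring.incl)
    show "\<exists>c. c \<noteq> 0 \<and> (\<forall>i<m. \<tau> (\<beta> i * c) (- e j) \<in> ?B)" if "j < n" for j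
      using e'[OF that] X_uminus[OF e_X[OF that]] by (auto simp: \<tau>_A0 generate_ring.incl)
  qed auto
  then show ?thesis using g unfolding generate_alg_def by auto
qed

lemma TT_algebraic_group: "affine_algebraic_group kk AA TT"
proof -
  let ?H = "(\<lambda>(i, j). encA (\<tau> (\<beta> i) (e j))) ` ({..<m} \<times> {..<n}) \<union> (\<lambda>(i, j). encA (\<tau> (\<beta> i) (- e j))) ` ({..<m} \<times> {..<n})"
  have H: "?H \<subseteq> carrier AA" by (auto simp: \<tau>_A0 e_X X_uminus)
  have "generate_alg kk AA ?H = carrier AA"
    by (rule generate_AA[OF H]) (auto intro!: exI[of _ 1])
  moreover have "finite ?H" by simp
  ultimately show ?thesis using TT_group_scheme H unfolding affine_algebraic_group_def by blast
qed

end

context torus_data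
begin

definition KK :: "'a ring" where
  "KK = \<lparr>carrier = range encK,
     monoid.mult = (\<lambda>x y. encK (inv_into UNIV encK x * inv_into UNIV encK y)), one = encK 1,
     ring.zero = encK 0, add = (\<lambda>x y. encK (inv_into UNIV encK x + inv_into UNIV encK y))\<rparr>"

lemma KK_simps [simp]:
  "carrier KK = range encK" "encK x \<otimes>\<^bsub>KK\<^esub> encK y = encK (x * y)" "encK x \<oplus>\<^bsub>KK\<^esub> encK y = encK (x + y)"
  "\<one>\<^bsub>KK\<^esub> = encK 1" "\<zero>\<^bsub>KK\<^esub> = encK 0"
  by (simp_all add: KK_def)

lemma \<kappa>_KK: "\<kappa> c \<in> carrier KK" "\<kappa> c \<oplus>\<^bsub>KK\<^esub> \<kappa> d = \<kappa> (c + d)" "\<kappa> c \<otimes>\<^bsub>KK\<^esub> \<kappa> d = \<kappa> (c * d)" "\<one>\<^bsub>KK\<^esub> = \<kappa> 1"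
  by (simp_all add: \<kappa>_def emb_add emb_mult emb_1)

lemma cring_KK: "cring KK"
proof (rule cringI)
  show "abelian_group KK"
  proof (rule abelian_groupI)
    fix x assume "x \<in> carrier KK"
    then obtain c where c: "x = encK c" by auto
    then show "\<exists>y\<in>carrier KK. y \<oplus>\<^bsub>KK\<^esub> x = \<zero>\<^bsub>KK\<^esub>"
      by (intro bexI[of _ "encK (- c)"]) auto
  qed (auto simp: add_ac)
  show "comm_monoid KK"
    by (rule comm_monoidI) (auto simp: mult_ac)
qed (auto simp: algebra_simps)

lemma field_KK: "field KK"
proof -
  interpret cring KK by (rule cring_KK)
  show ?thesis
  proof (rule cring_fieldI)
    have "y \<in> Units KK" if y: "y \<in> carrier KK" "y \<noteq> \<zero>\<^bsub>KK\<^esub>" for y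
    proof -
      obtain c where c: "y = encK c" "c \<noteq> 0" using y by auto
      then have "encK (inverse c) \<in> carrier KK" "encK (inverse c) \<otimes>\<^bsub>KK\<^esub> y = \<one>\<^bsub>KK\<^esub>" "y \<otimes>\<^bsub>KK\<^esub> encK (inverse c) = \<one>\<^bsub>KK\<^esub>"
        by auto
      then show ?thesis using y(1) unfolding Units_def by blast
    qed
    moreover have "encK x \<noteq> encK y" if "x \<noteq> y" for x y using that inj_encK by (auto simp: inj_on_def)
    then have "\<zero>\<^bsub>KK\<^esub> \<notin> Units KK" by (auto simp: Units_def)
    ultimately show "Units KK = carrier KK - {\<zero>\<^bsub>KK\<^esub>}" using Units_closed by blast
  qed
qed

lemma algebra_restrict:
  assumes "algebra KK R" shows "algebra kk R"
proof -
  interpret algebra KK R by (rule assms)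
  have k: "x \<in> carrier KK" "y \<in> carrier KK \<Longrightarrow> x \<oplus>\<^bsub>kk\<^esub> y = x \<oplus>\<^bsub>KK\<^esub> y" "x \<otimes>\<^bsub>kk\<^esub> y = x \<otimes>\<^bsub>KK\<^esub> y"
    if "x \<in> carrier kk" for x y using that by (auto simp: kk_def KK_def)
  have o: "\<one>\<^bsub>kk\<^esub> = \<one>\<^bsub>KK\<^esub>" by (simp add: \<kappa>_def emb_1)
  show ?thesis
    by (rule algebraI)
       (auto simp: cring_kk M_cring k smult_l_distr smult_r_distr smult_assoc1 smult_assoc2 o simp del: kk_simps KK_simps)
qed

lemma restrict_id [simp]: "restrict_scalars (\<lambda>x. x) R = R"
  by (simp add: restrict_scalars_def)

end

locale torus_point_K = torus_point G act \<alpha> \<beta> m \<Lambda> e n crd emb encK encA R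
  for G :: "('v::ab_group_add \<Rightarrow> 'v) set" and act :: "('v \<Rightarrow> 'v) \<Rightarrow> 'l::field_char_0 \<Rightarrow> 'l" and \<alpha> \<beta> m
    and \<Lambda> :: "'v set" and e :: "nat \<Rightarrow> 'v" and n :: nat and crd :: "nat \<Rightarrow> 'v \<Rightarrow> int"
    and emb :: "'l \<Rightarrow> 'c::field_char_0" and encK :: "'c \<Rightarrow> 'a" and encA :: "('v \<Rightarrow>\<^sub>0 'l) \<Rightarrow> 'a"
    and R :: "'a alg" (structure) +
  assumes alg_KR: "algebra KK R"

context torus_data
begin

lemma torus_point_KI: "algebra KK R \<Longrightarrow> torus_point_K G act \<alpha> \<beta> m \<Lambda> e n crd emb encK encA R"
  by (intro torus_point_K.intro torus_point_K_axioms.intro torus_pointI algebra_restrict)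

end

context torus_point_K
begin

sublocale T: algebra KK R by (rule alg_KR)

lemma sc_closed [simp]: "x \<in> carrier R \<Longrightarrow> \<kappa> c \<odot> x \<in> carrier R"
  by (rule T.smult_closed[OF \<kappa>_KK(1)])

lemma sc_add: "x \<in> carrier R \<Longrightarrow> \<kappa> (c + d) \<odot> x = \<kappa> c \<odot> x \<oplus> \<kappa> d \<odot> x"
  using T.smult_l_distr[OF \<kappa>_KK(1) \<kappa>_KK(1), of x c d] by (simp only: \<kappa>_KK)

lemma sc_mult: "x \<in> carrier R \<Longrightarrow> \<kappa> (c * d) \<odot> x = \<kappa> c \<odot> (\<kappa> d \<odot> x)"
  using T.smult_assoc1[OF \<kappa>_KK(1) \<kappa>_KK(1), of x c d] by (simp only: \<kappa>_KK)

lemma sc_1 [simp]: "x \<in> carrier R \<Longrightarrow> \<kappa> 1 \<odot> x = x"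
  using T.smult_one by (simp only: \<kappa>_KK)

lemma sc_radd: "x \<in> carrier R \<Longrightarrow> y \<in> carrier R \<Longrightarrow> \<kappa> c \<odot> (x \<oplus> y) = \<kappa> c \<odot> x \<oplus> \<kappa> c \<odot> y"
  by (rule T.smult_r_distr[OF \<kappa>_KK(1)])

lemma sc_lmult: "x \<in> carrier R \<Longrightarrow> y \<in> carrier R \<Longrightarrow> (\<kappa> c \<odot> x) \<otimes> y = \<kappa> c \<odot> (x \<otimes> y)"
  by (rule T.smult_assoc2[OF \<kappa>_KK(1)])

lemma sc_finsum: "finite I \<Longrightarrow> (\<And>i. i \<in> I \<Longrightarrow> f i \<in> carrier R) \<Longrightarrow> \<kappa> c \<odot> (\<Oplus>i\<in>I. f i) = (\<Oplus>i\<in>I. \<kappa> c \<odot> f i)"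
proof (induction I rule: finite_induct)
  case empty then show ?case using T.smult_r_null[OF \<kappa>_KK(1)] by simp
next
  case (insert i I)
  then show ?case by (auto simp: S.finsum_insert sc_radd)
qed

definition sca :: "'l \<Rightarrow> 'a" where "sca c = \<kappa> c \<odot> \<one>"

lemma sca_closed [simp]: "sca c \<in> carrier R" by (simp add: sca_def)

lemma sca_klin: "klin sca"
  by (auto simp: klin_def sca_def sc_add sc_mult)

lemma sca_mult: "sca (c * d) = sca c \<otimes> sca d"
  by (simp add: sca_def sc_mult sc_lmult)

lemma sca_1: "sca 1 = \<one>" by (simp add: sca_def)

lemma sca_0: "sca 0 = \<zero>" using klin_0[OF sca_klin] .

lemma sca_sum: "finite I \<Longrightarrow> sca (sum f I) = (\<Oplus>i\<in>I. sca (f i))"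
  by (rule klin_sum[OF _ sca_klin])

lemma sca_scale: "x \<in> carrier R \<Longrightarrow> \<kappa> c \<odot> x = sca c \<otimes> x"
  by (simp add: sca_def sc_lmult)

lemma ct_sca: assumes l: "klin l" shows "ct R l sca c = sca c \<otimes> ct R l sca 1"
  unfolding ct_def using klin_closed[OF l]
  by (subst S.finsum_rdistr) (auto simp: sca_mult S.m_ac intro!: S.finsum_cong')

definition chi :: "('a \<Rightarrow> 'a) \<Rightarrow> 'v \<Rightarrow> 'a" where
  "chi f v = ct R (fam f v) sca 1"

lemma chi_closed: "f \<in> alg_hom kk AA R \<Longrightarrow> v \<in> \<Lambda> \<Longrightarrow> chi f v \<in> carrier R"
  unfolding chi_def by (intro ct_closed fam_klin sca_klin)

lemma chi_add:
  assumes f: "f \<in> alg_hom kk AA R" and u: "u \<in> \<Lambda>" and v: "v \<in> \<Lambda>"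
  shows "chi f (u + v) = chi f u \<otimes> chi f v"
proof -
  have fa: "family (fam f)" using f by (rule point_family)
  have uv: "u + g v \<in> \<Lambda>" if "g \<in> G" for g using X_add[OF u X_G[OF that v]] .
  have cl: "fam f u x \<in> carrier R" "fam f v x \<in> carrier R" for x
    using u v by (auto simp: family_closed fa)
  define F where "F i j g = (if g \<in> G then fam f (u + g v) (\<beta> i * act g (\<beta> j)) \<otimes> sca (1 * \<alpha> i * act id (1 * \<alpha> j)) else \<zero>)" for i j g
  have Fcl: "F i j g \<in> carrier R" for i j g using uv by (auto simp: F_def family_closed fa)
  have "chi f u \<otimes> chi f v = (\<Oplus>i\<in>{..<m}. \<Oplus>j\<in>{..<m}. fam f u (\<beta> i) \<otimes> sca (1 * \<alpha> i) \<otimes> (fam f v (\<beta> j) \<otimes> sca (1 * \<alpha> j)))"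
    unfolding chi_def ct_def by (intro S.finsum_mult) (auto simp: cl)
  also have "\<dots> = (\<Oplus>i\<in>{..<m}. \<Oplus>j\<in>{..<m}. \<Oplus>g\<in>G. F i j g)"
  proof (intro S.finsum_cong' refl)
    fix i j
    have "fam f u (\<beta> i) \<otimes> sca (1 * \<alpha> i) \<otimes> (fam f v (\<beta> j) \<otimes> sca (1 * \<alpha> j))
        = (fam f u (\<beta> i) \<otimes> fam f v (\<beta> j)) \<otimes> sca (1 * \<alpha> i * act id (1 * \<alpha> j))"
      by (simp add: cl S.m_ac sca_mult act_id)
    also have "\<dots> = (\<Oplus>g\<in>G. F i j g)"
      using uv by (simp add: familyD(4)[OF fa u v] F_def)
        (subst S.finsum_ldistr, auto simp: finite_G family_closed fa intro!: S.finsum_cong' S.m_closed)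
    finally show "fam f u (\<beta> i) \<otimes> sca (1 * \<alpha> i) \<otimes> (fam f v (\<beta> j) \<otimes> sca (1 * \<alpha> j)) = (\<Oplus>g\<in>G. F i j g)" .
  qed (auto simp: Fcl)
  also have "\<dots> = (\<Oplus>i\<in>{..<m}. \<Oplus>g\<in>G. \<Oplus>j\<in>{..<m}. F i j g)"
    by (intro S.finsum_cong' refl S.finsum_swap) (auto simp: finite_G Fcl)
  also have "\<dots> = (\<Oplus>g\<in>G. \<Oplus>i\<in>{..<m}. \<Oplus>j\<in>{..<m}. F i j g)"
    by (intro S.finsum_swap) (auto simp: finite_G Fcl)
  also have "\<dots> = (\<Oplus>g\<in>G. \<Oplus>j\<in>{..<m}. \<Oplus>i\<in>{..<m}. F i j g)"
    by (intro S.finsum_cong' refl S.finsum_swap) (auto simp: finite_G Fcl)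
  also have "\<dots> = (\<Oplus>g\<in>G. if id = g then chi f (u + v) else \<zero>)"
  proof (intro S.finsum_cong' refl)
    fix g assume g: "g \<in> G"
    show "(\<Oplus>j\<in>{..<m}. \<Oplus>i\<in>{..<m}. F i j g) = (if id = g then chi f (u + v) else \<zero>)"
      using g canonical_collapse[OF family_klin[OF fa uv[OF g]] sca_klin g id_G, of 1 1]
      by (auto simp: F_def chi_def act_1 act_id)
  qed (auto simp: chi_closed f X_add u v)
  also have "\<dots> = chi f (u + v)"
    by (rule S.add.finprod_singleton[OF id_G finite_G]) (auto simp: chi_closed f X_add u v)
  finally show ?thesis by simp
qed

lemma chi_0: assumes f: "f \<in> alg_hom kk AA R" shows "chi f 0 = \<one>"
proof -
  have "fam f 0 = (\<lambda>c. \<kappa> (Tr c) \<odot> \<one>)" using familyD(3)[OF point_family[OF f]] by auto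
  then show ?thesis using ct_one[OF sca_klin] by (simp add: chi_def sca_1)
qed

lemma chi_Units: assumes f: "f \<in> alg_hom kk AA R" and v: "v \<in> \<Lambda>" shows "chi f v \<in> Units R"
proof -
  have "chi f (- v) \<otimes> chi f v = \<one>" "chi f v \<otimes> chi f (- v) = \<one>"
    using chi_add[OF f X_uminus[OF v] v] chi_add[OF f v X_uminus[OF v]] chi_0[OF f] by auto
  then show ?thesis using chi_closed[OF f v] chi_closed[OF f X_uminus[OF v]] unfolding Units_def by blast
qed

lemma chi_uminus: assumes f: "f \<in> alg_hom kk AA R" and v: "v \<in> \<Lambda>" shows "chi f (- v) = inv\<^bsub>R\<^esub> (chi f v)"
proof -
  have "chi f (- v) \<otimes> chi f v = \<one>"
    using chi_add[OF f X_uminus[OF v] v] chi_0[OF f] by auto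
  then show ?thesis
    using S.comm_inv_char[of "chi f v" "chi f (- v)"] chi_closed[OF f v] chi_closed[OF f X_uminus[OF v]] by (simp add: S.m_comm)
qed

lemma chi_TT_mult:
  assumes f: "f \<in> alg_hom kk AA R" and g: "g \<in> alg_hom kk AA R" and v: "v \<in> \<Lambda>"
  shows "chi (f \<otimes>\<^bsub>TT R\<^esub> g) v = chi f v \<otimes> chi g v"
proof -
  have k: "klin (fam f v)" "klin (fam g v)" using f g v by (auto simp: fam_klin)
  have "chi (f \<otimes>\<^bsub>TT R\<^esub> g) v = ct R (ct R (fam f v) (fam g v)) sca 1"
    unfolding chi_def using f g v by (intro ct_cong) (auto simp: TT_mult)
  also have "\<dots> = ct R (fam f v) (ct R (fam g v) sca) 1"
    by (rule ct_assoc[OF k sca_klin])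
  also have "\<dots> = (\<Oplus>i\<in>{..<m}. (fam f v (\<beta> i) \<otimes> sca (1 * \<alpha> i)) \<otimes> chi g v)"
    unfolding ct_def[of R "fam f v"]
  proof (intro S.finsum_cong' refl)
    fix i
    have "ct R (fam g v) sca (1 * \<alpha> i) = sca (1 * \<alpha> i) \<otimes> chi g v"
      unfolding chi_def by (rule ct_sca[OF k(2)])
    then show "fam f v (\<beta> i) \<otimes> ct R (fam g v) sca (1 * \<alpha> i) = fam f v (\<beta> i) \<otimes> sca (1 * \<alpha> i) \<otimes> chi g v"
      using chi_closed[OF g v] klin_closed[OF k(1)] by (simp add: S.m_assoc)
  qed (use chi_closed[OF g v] klin_closed[OF k(1)] in auto)
  also have "\<dots> = chi f v \<otimes> chi g v"
    unfolding chi_def[of f] ct_def[of R "fam f v"] using chi_closed[OF g v] k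
    by (intro S.finsum_ldistr[symmetric]) (auto simp: klin_closed)
  finally show ?thesis .
qed

lemma fam_eq_chi:
  assumes f: "f \<in> alg_hom kk AA R" and v: "v \<in> \<Lambda>"
  shows "fam f v c = (\<Oplus>g\<in>G. sca (act g c) \<otimes> chi f (g v))"
proof -
  have k: "klin (fam f v)" by (rule fam_klin[OF f v])
  note [simp] = klin_closed[OF k]
  have ch: "sca (act g c) \<otimes> chi f (g v) = (\<Oplus>i\<in>{..<m}. fam f v (\<beta> i) \<otimes> sca (act g (c * \<alpha> i)))" if g: "g \<in> G" for g
  proof -
    have kg: "klin (fam f (g v))" by (rule fam_klin[OF f X_G[OF g v]])
    have "chi f (g v) = (\<Oplus>i\<in>{..<m}. fam f (g v) (act g (\<beta> i)) \<otimes> sca (act g (\<alpha> i)))"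
      using canonical_ct[OF canonical_act[OF g] kg sca_klin, of 1 1] by (simp add: chi_def)
    also have "\<dots> = (\<Oplus>i\<in>{..<m}. fam f v (\<beta> i) \<otimes> sca (act g (\<alpha> i)))"
      using g v by (simp add: fam_def \<tau>_act)
    finally show ?thesis
      by (simp, subst S.finsum_rdistr) (auto simp: act_mult[OF g] sca_mult S.m_ac intro!: S.finsum_cong')
  qed
  have "(\<Oplus>g\<in>G. sca (act g c) \<otimes> chi f (g v)) = (\<Oplus>g\<in>G. \<Oplus>i\<in>{..<m}. fam f v (\<beta> i) \<otimes> sca (act g (c * \<alpha> i)))"
    by (intro S.finsum_cong') (auto simp: ch)
  also have "\<dots> = (\<Oplus>i\<in>{..<m}. \<Oplus>g\<in>G. fam f v (\<beta> i) \<otimes> sca (act g (c * \<alpha> i)))"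
    by (intro S.finsum_swap) (auto simp: finite_G)
  also have "\<dots> = (\<Oplus>i\<in>{..<m}. fam f v (Tr (c * \<alpha> i) * \<beta> i))"
  proof (intro S.finsum_cong' refl)
    fix i
    have "(\<Oplus>g\<in>G. fam f v (\<beta> i) \<otimes> sca (act g (c * \<alpha> i))) = fam f v (\<beta> i) \<otimes> sca (Tr (c * \<alpha> i))"
      unfolding Tr_def by (subst sca_sum[OF finite_G], subst S.finsum_rdistr) (auto simp: finite_G)
    also have "\<dots> = fam f v (Tr (c * \<alpha> i) * \<beta> i)"
      unfolding klin_scale[OF k Tr_k0] by (subst sca_scale) (auto simp: S.m_comm)
    finally show "(\<Oplus>g\<in>G. fam f v (\<beta> i) \<otimes> sca (act g (c * \<alpha> i))) = fam f v (Tr (c * \<alpha> i) * \<beta> i)" .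
  qed auto
  also have "\<dots> = fam f v c"
    by (subst (2) expand_\<beta>[of c]) (simp add: klin_sum[OF _ k])
  finally show ?thesis by simp
qed

lemma point_eq_chi:
  assumes f: "f \<in> alg_hom kk AA R" and g: "g \<in> alg_hom kk AA R"
    and eq: "\<And>v. v \<in> \<Lambda> \<Longrightarrow> chi f v = chi g v"
  shows "f = g"
proof (rule point_eqI[OF f g])
  fix v c assume v: "v \<in> \<Lambda>"
  then show "fam f v c = fam g v c"
    unfolding fam_eq_chi[OF f v] fam_eq_chi[OF g v]
    by (intro S.finsum_cong') (auto simp: eq X_G chi_closed g)
qed

lemma point_eq_chi_basis:
  assumes f: "f \<in> alg_hom kk AA R" and g: "g \<in> alg_hom kk AA R"
    and eq: "\<And>j. j < n \<Longrightarrow> chi f (e j) = chi g (e j)"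
  shows "f = g"
proof -
  have "\<Lambda> \<subseteq> {v\<in>\<Lambda>. chi f v = chi g v}"
    by (rule e_gen) (use f g in \<open>auto simp: chi_0 chi_add chi_uminus eq e_X X_0 X_add X_uminus\<close>)
  then show ?thesis using point_eq_chi[OF f g] by blast
qed

text \<open>Conversely, each character of \<open>\<Lambda>\<close> with values in \<open>R\<close> comes from a point.\<close>

lemma char_point:
  assumes cl: "\<And>v. v \<in> \<Lambda> \<Longrightarrow> \<chi> v \<in> carrier R" and c0: "\<chi> 0 = \<one>"
    and cadd: "\<And>u v. u \<in> \<Lambda> \<Longrightarrow> v \<in> \<Lambda> \<Longrightarrow> \<chi> (u + v) = \<chi> u \<otimes> \<chi> v"
  obtains f where "f \<in> alg_hom kk AA R" "\<And>v. v \<in> \<Lambda> \<Longrightarrow> chi f v = \<chi> v"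
    "\<And>v c. v \<in> \<Lambda> \<Longrightarrow> fam f v c = (\<Oplus>g\<in>G. sca (act g c) \<otimes> \<chi> (g v))"
proof -
  define \<phi> where "\<phi> v c = (\<Oplus>g\<in>G. sca (act g c) \<otimes> \<chi> (g v))" for v c
  have clG: "\<chi> (g v) \<in> carrier R" if "g \<in> G" "v \<in> \<Lambda>" for g v using cl[OF X_G[OF that]] .
  have "family \<phi>"
    unfolding family_def
  proof (intro conjI ballI allI)
    fix v assume v: "v \<in> \<Lambda>"
    show "klin (\<phi> v)"
      unfolding klin_def
    proof (intro conjI allI ballI)
      show "\<phi> v c \<in> carrier R" for c unfolding \<phi>_def using clG v by (auto intro!: S.finsum_closed)
      show "\<phi> v (c + d) = \<phi> v c \<oplus> \<phi> v d" for c d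
      proof -
        have "\<phi> v (c + d) = (\<Oplus>g\<in>G. sca (act g c) \<otimes> \<chi> (g v) \<oplus> sca (act g d) \<otimes> \<chi> (g v))"
          unfolding \<phi>_def using clG[OF _ v]
          by (intro S.finsum_cong') (auto simp: act_add klin_add[OF sca_klin] S.l_distr)
        also have "\<dots> = \<phi> v c \<oplus> \<phi> v d"
          unfolding \<phi>_def using clG[OF _ v] by (intro S.finsum_addf) auto
        finally show ?thesis .
      qed
      show "\<phi> v (k * c) = \<kappa> k \<odot> \<phi> v c" if "k \<in> k0" for k c
        unfolding \<phi>_def using that clG[OF _ v] finite_G
        by (subst sc_finsum) (auto simp: act_mult k0_act sca_mult sc_lmult[symmetric] sca_scale S.m_assoc intro!: S.finsum_cong')
    qed
  next
    fix g v c assume g: "g \<in> G" and v: "v \<in> \<Lambda>"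
    have "\<phi> (g v) (act g c) = (\<Oplus>h\<in>G. sca (act (h \<circ> g) c) \<otimes> \<chi> ((h \<circ> g) v))"
      unfolding \<phi>_def
    proof (intro S.finsum_cong' refl)
      fix h assume h: "h \<in> G"
      show "sca (act h (act g c)) \<otimes> \<chi> (h (g v)) = sca (act (h \<circ> g) c) \<otimes> \<chi> ((h \<circ> g) v)"
        using g h by (simp add: act_comp)
    qed (use clG[OF _ X_G[OF g v]] in auto)
    also have "\<dots> = \<phi> v c"
      unfolding \<phi>_def using clG[OF _ v]
      by (intro S.finsum_bij[OF bij_right[OF g], where f = "\<lambda>h. sca (act h c) \<otimes> \<chi> (h v)"]) auto
    finally show "\<phi> (g v) (act g c) = \<phi> v c" .
  next
    fix c
    have "\<phi> 0 c = (\<Oplus>g\<in>G. sca (act g c))" unfolding \<phi>_def by (intro S.finsum_cong') (auto simp: G_zero c0)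
    then show "\<phi> 0 c = \<kappa> (Tr c) \<odot> \<one>" using sca_sum[OF finite_G, of "\<lambda>g. act g c"] by (simp add: sca_def Tr_def)
  next
    fix u v c d assume u: "u \<in> \<Lambda>" and v: "v \<in> \<Lambda>"
    define F where "F h g = sca (act h c) \<otimes> sca (act g d) \<otimes> (\<chi> (h u) \<otimes> \<chi> (g v))" for h g
    have Fcl: "F h g \<in> carrier R" if "h \<in> G" "g \<in> G" for h g using that u v by (auto simp: F_def clG)
    have "(\<Oplus>g\<in>G. \<phi> (u + g v) (c * act g d)) = (\<Oplus>g\<in>G. \<Oplus>h\<in>G. F h (h \<circ> g))"
      unfolding \<phi>_def
    proof (intro S.finsum_cong' refl)
      fix g h assume gh: "g \<in> G" "h \<in> G"
      show "sca (act h (c * act g d)) \<otimes> \<chi> (h (u + g v)) = F h (h \<circ> g)"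
        using gh u v by (simp add: F_def act_mult act_comp additive_G cadd X_G sca_mult)
    qed (auto intro!: S.finsum_closed Fcl comp_G)
    also have "\<dots> = (\<Oplus>h\<in>G. \<Oplus>g\<in>G. F h (h \<circ> g))"
      by (intro S.finsum_swap) (auto simp: finite_G intro!: Fcl comp_G)
    also have "\<dots> = (\<Oplus>h\<in>G. \<Oplus>g\<in>G. F h g)"
    proof (rule S.finsum_cong'[OF refl])
      fix h assume h: "h \<in> G"
      show "(\<Oplus>g\<in>G. F h (h \<circ> g)) = (\<Oplus>g\<in>G. F h g)"
        using h by (intro S.finsum_bij[OF bij_left[OF h]] Fcl) auto
    qed (auto intro!: S.finsum_closed Fcl)
    also have "\<dots> = (\<Oplus>h\<in>G. \<Oplus>g\<in>G. (sca (act h c) \<otimes> \<chi> (h u)) \<otimes> (sca (act g d) \<otimes> \<chi> (g v)))"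
      using u v by (intro S.finsum_cong' refl) (auto simp: F_def clG S.m_ac intro!: S.finsum_closed)
    also have "\<dots> = \<phi> u c \<otimes> \<phi> v d"
      unfolding \<phi>_def using u v by (intro S.finsum_mult[symmetric]) (auto simp: finite_G clG)
    finally show "\<phi> u c \<otimes> \<phi> v d = (\<Oplus>g\<in>G. \<phi> (u + g v) (c * act g d))" by simp
  qed
  from family_point_ex[OF this] obtain f where f: "f \<in> alg_hom kk AA R" "\<And>v c. v \<in> \<Lambda> \<Longrightarrow> fam f v c = \<phi> v c"
    by blast
  have "chi f v = \<chi> v" if v: "v \<in> \<Lambda>" for v
  proof -
    have "chi f v = (\<Oplus>i\<in>{..<m}. \<Oplus>g\<in>G. sca (\<alpha> i * act g (\<beta> i)) \<otimes> \<chi> (g v))"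
      unfolding chi_def ct_def
    proof (intro S.finsum_cong' refl)
      fix i
      have "fam f v (\<beta> i) \<otimes> sca (1 * \<alpha> i) = (\<Oplus>g\<in>G. sca (act g (\<beta> i)) \<otimes> \<chi> (g v) \<otimes> sca (\<alpha> i))"
        unfolding f(2)[OF v] \<phi>_def using v clG by (subst S.finsum_ldistr) (auto simp: finite_G)
      also have "\<dots> = (\<Oplus>g\<in>G. sca (\<alpha> i * act g (\<beta> i)) \<otimes> \<chi> (g v))"
        using v clG by (intro S.finsum_cong') (auto simp: sca_mult S.m_ac)
      finally show "fam f v (\<beta> i) \<otimes> sca (1 * \<alpha> i) = (\<Oplus>g\<in>G. sca (\<alpha> i * act g (\<beta> i)) \<otimes> \<chi> (g v))" .
    qed (use v clG in \<open>auto intro!: S.finsum_closed\<close>)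
    also have "\<dots> = (\<Oplus>g\<in>G. \<Oplus>i\<in>{..<m}. sca (\<alpha> i * act g (\<beta> i)) \<otimes> \<chi> (g v))"
      using v clG by (intro S.finsum_swap) (auto simp: finite_G)
    also have "\<dots> = (\<Oplus>g\<in>G. if id = g then \<chi> v else \<zero>)"
    proof (intro S.finsum_cong' refl)
      fix g assume g: "g \<in> G"
      have "(\<Oplus>i\<in>{..<m}. sca (\<alpha> i * act g (\<beta> i)) \<otimes> \<chi> (g v)) = sca (\<Sum>i<m. \<alpha> i * act g (\<beta> i)) \<otimes> \<chi> (g v)"
        using g v clG by (subst sca_sum) (auto simp: S.finsum_ldistr Pi_iff)
      then show "(\<Oplus>i\<in>{..<m}. sca (\<alpha> i * act g (\<beta> i)) \<otimes> \<chi> (g v)) = (if id = g then \<chi> v else \<zero>)"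
        using coords[OF g] cl[OF v] clG[OF g v] by (auto simp: sca_1 sca_0)
    qed (use cl v in auto)
    also have "\<dots> = \<chi> v"
      by (rule S.add.finprod_singleton[OF id_G finite_G]) (use cl v in auto)
    finally show ?thesis .
  qed
  then show ?thesis using that f by (auto simp: \<phi>_def)
qed

end

context torus_data
begin

lemma crd_0: "j < n \<Longrightarrow> crd j 0 = 0"
  using crd_add[of j 0 0] X_0 by simp

end

context torus_point_K
begin

definition chr :: "(nat \<Rightarrow> 'a) \<Rightarrow> 'v \<Rightarrow> 'a" where
  "chr u v = finprod (units_of R) (\<lambda>j. u j [^]\<^bsub>units_of R\<^esub> crd j v) {..<n}"

lemma chr_props:
  assumes u: "\<And>j. j < n \<Longrightarrow> u j \<in> Units R"
  shows "chr u v \<in> Units R" "chr u 0 = \<one>" "w \<in> \<Lambda> \<Longrightarrow> w' \<in> \<Lambda> \<Longrightarrow> chr u (w + w') = chr u w \<otimes> chr u w'"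
    "i < n \<Longrightarrow> chr u (e i) = u i"
proof -
  interpret U: comm_group "units_of R" by (rule S.units_comm_group)
  have u': "u j \<in> carrier (units_of R)" if "j < n" for j using u[OF that] by (simp add: units_of_carrier)
  have p: "u j [^]\<^bsub>units_of R\<^esub> i \<in> carrier (units_of R)" if "j < n" for i :: int and j
    using u'[OF that] by (rule U.int_pow_closed)
  show "chr u v \<in> Units R"
    unfolding chr_def units_of_carrier[symmetric] by (rule U.finprod_closed) (auto simp: p)
  show "chr u 0 = \<one>"
    unfolding chr_def by (subst U.finprod_one_eqI) (auto simp: crd_0 units_of_one)
  show "chr u (w + w') = chr u w \<otimes> chr u w'" if w: "w \<in> \<Lambda>" "w' \<in> \<Lambda>"
  proof -
    have "chr u (w + w') = finprod (units_of R) (\<lambda>j. u j [^]\<^bsub>units_of R\<^esub> crd j w \<otimes>\<^bsub>units_of R\<^esub> u j [^]\<^bsub>units_of R\<^esub> crd j w') {..<n}"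
      unfolding chr_def using w by (intro U.finprod_cong') (auto simp: p crd_add U.int_pow_mult u')
    also have "\<dots> = chr u w \<otimes>\<^bsub>units_of R\<^esub> chr u w'"
      unfolding chr_def by (rule U.finprod_multf) (auto simp: p)
    finally show ?thesis by (simp add: units_of_mult)
  qed
  show "chr u (e i) = u i" if i: "i < n"
  proof -
    have "chr u (e i) = finprod (units_of R) (\<lambda>j. if i = j then u j else \<one>\<^bsub>units_of R\<^esub>) {..<n}"
      unfolding chr_def using i by (intro U.finprod_cong') (auto simp: crd_e u' U.int_pow_1)
    also have "\<dots> = u i" using i u' by (intro U.finprod_singleton) auto
    finally show ?thesis .
  qed
qed

lemma chr_point:
  assumes u: "\<And>j. j < n \<Longrightarrow> u j \<in> Units R"
  shows "\<exists>f. f \<in> alg_hom kk AA R \<and> (\<forall>v\<in>\<Lambda>. chi f v = chr u v)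
    \<and> (\<forall>v\<in>\<Lambda>. \<forall>c. fam f v c = (\<Oplus>g\<in>G. sca (act g c) \<otimes> chr u (g v)))"
proof (rule char_point[of "chr u"])
  show "chr u v \<in> carrier R" for v by (rule S.Units_closed[OF chr_props(1)[OF u]])
  show "chr u 0 = \<one>" by (rule chr_props(2)[OF u])
  show "chr u (v + w) = chr u v \<otimes> chr u w" if "v \<in> \<Lambda>" "w \<in> \<Lambda>" for v w
    by (rule chr_props(3)[OF u that])
qed blast

lemma TT_iso_Gm_power: "(\<lambda>f. \<lambda>j\<in>{..<n}. chi f (e j)) \<in> iso (TT R) (Gm_power n R)"
proof (rule isoI)
  show "(\<lambda>f. \<lambda>j\<in>{..<n}. chi f (e j)) \<in> hom (TT R) (Gm_power n R)"
    by (rule homI) (auto simp: Gm_power_def chi_Units e_X units_of_carrier units_of_mult chi_TT_mult)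
  show "bij_betw (\<lambda>f. \<lambda>j\<in>{..<n}. chi f (e j)) (carrier (TT R)) (carrier (Gm_power n R))"
    unfolding bij_betw_def
  proof
    show "inj_on (\<lambda>f. \<lambda>j\<in>{..<n}. chi f (e j)) (carrier (TT R))"
    proof (rule inj_onI)
      fix f g assume fg: "f \<in> carrier (TT R)" "g \<in> carrier (TT R)"
        and eq: "(\<lambda>j\<in>{..<n}. chi f (e j)) = (\<lambda>j\<in>{..<n}. chi g (e j))"
      have "chi f (e j) = chi g (e j)" if "j < n" for j using fun_cong[OF eq, of j] that by simp
      then show "f = g" using fg by (intro point_eq_chi_basis) auto
    qed
    show "(\<lambda>f. \<lambda>j\<in>{..<n}. chi f (e j)) ` carrier (TT R) = carrier (Gm_power n R)"
    proof (intro equalityI subsetI)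
      fix u assume u: "u \<in> carrier (Gm_power n R)"
      then have uU: "\<And>j. j < n \<Longrightarrow> u j \<in> Units R" and ext: "u \<in> extensional {..<n}"
        by (auto simp: Gm_power_def PiE_iff units_of_carrier)
      obtain f where f: "f \<in> alg_hom kk AA R" "\<forall>v\<in>\<Lambda>. chi f v = chr u v"
        using chr_point[of u] uU by blast
      have "u = (\<lambda>j\<in>{..<n}. chi f (e j))"
        using ext f uU by (intro extensionalityI[of u "{..<n}"]) (auto simp: e_X chr_props)
      then show "u \<in> (\<lambda>f. \<lambda>j\<in>{..<n}. chi f (e j)) ` carrier (TT R)" using f(1) by auto
    qed (auto simp: Gm_power_def chi_Units e_X units_of_carrier split: if_splits)
  qed
qed

end

context torus_data
begin

lemma base_change_TT: "base_change_iso_Gm_power KK (\<lambda>x. x) AA TT n"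
proof -
  define \<phi> where "\<phi> R = (\<lambda>f. \<lambda>j\<in>{..<n}. torus_point_K.chi G act \<alpha> \<beta> m emb encK encA R f (e j))" for R
  have "\<phi> R \<in> iso (TT R) (Gm_power n R)" if "algebra KK R" for R
    unfolding \<phi>_def by (rule torus_point_K.TT_iso_Gm_power[OF torus_point_KI[OF that]])
  moreover have "\<phi> S (compose (carrier AA) f x) = compose {..<n} f (\<phi> R x)"
    if RS: "algebra KK R" "algebra KK S" and f: "f \<in> alg_hom KK R S" and x: "x \<in> carrier (TT R)" for R S f x
  proof -
    interpret R: torus_point_K G act \<alpha> \<beta> m \<Lambda> e n crd emb encK encA R using RS(1) by (rule torus_point_KI)
    interpret S: torus_point_K G act \<alpha> \<beta> m \<Lambda> e n crd emb encK encA S using RS(2) by (rule torus_point_KI)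
    interpret f: ring_hom_cring R S f
      using f R.S.M_cring S.S.M_cring by unfold_locales (auto simp: alg_hom_def cring_def)
    have sc: "f (R.sca c) = S.sca c" for c
    proof -
      have "f (\<kappa> c \<odot>\<^bsub>R\<^esub> \<one>\<^bsub>R\<^esub>) = \<kappa> c \<odot>\<^bsub>S\<^esub> f \<one>\<^bsub>R\<^esub>"
        using f \<kappa>_KK(1)[of c] R.S.one_closed unfolding alg_hom_def by blast
      then show ?thesis by (simp add: R.sca_def S.sca_def)
    qed
    have "f (R.chi x v) = S.chi (compose (carrier AA) f x) v" if v: "v \<in> \<Lambda>" for v
    proof -
      have k: "fam x v c \<in> carrier R" for c using x R.klin_closed[OF R.fam_klin[OF _ v]] by simp
      show ?thesis
        unfolding R.chi_def S.chi_def ct_def using k v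
        by (subst f.hom_finsum) (auto simp: sc fam_compose intro!: S.S.finsum_cong')
    qed
    then show ?thesis
      unfolding \<phi>_def by (auto simp: compose_def e_X fun_eq_iff)
  qed
  ultimately show ?thesis
    unfolding base_change_iso_Gm_power_def restrict_id by blast
qed

end

lemma map_poly_mult_hom:
  fixes h :: "'x::comm_ring_1 \<Rightarrow> 'y::comm_ring_1"
  assumes h: "h 0 = 0" "\<And>x y. h (x + y) = h x + h y" "\<And>x y. h (x * y) = h x * h y"
  shows "map_poly h (p * q) = map_poly h p * map_poly h q"
proof -
  have hs: "h (sum f I) = (\<Sum>i\<in>I. h (f i))" for f :: "nat \<Rightarrow> 'x" and I
    by (induction I rule: infinite_finite_induct) (auto simp: h)
  show ?thesis by (rule poly_eqI) (simp add: coeff_map_poly h coeff_mult hs)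
qed

lemma map_poly_prod_hom:
  fixes h :: "'x::comm_ring_1 \<Rightarrow> 'y::comm_ring_1"
  assumes h: "h 0 = 0" "h 1 = 1" "\<And>x y. h (x + y) = h x + h y" "\<And>x y. h (x * y) = h x * h y"
  shows "map_poly h (prod f I) = (\<Prod>i\<in>I. map_poly h (f i))"
  by (induction I rule: infinite_finite_induct) (auto simp: map_poly_mult_hom h)

locale torus_sep = torus_data G act \<alpha> \<beta> m \<Lambda> e n crd emb encK encA
  for G :: "('v::ab_group_add \<Rightarrow> 'v) set" and act :: "('v \<Rightarrow> 'v) \<Rightarrow> 'l::field_char_0 \<Rightarrow> 'l" and \<alpha> \<beta> m
    and \<Lambda> :: "'v set" and e :: "nat \<Rightarrow> 'v" and n :: nat and crd :: "nat \<Rightarrow> 'v \<Rightarrow> int"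
    and emb :: "'l \<Rightarrow> 'c::field_char_0" and encK :: "'c \<Rightarrow> 'a" and encA :: "('v \<Rightarrow>\<^sub>0 'l) \<Rightarrow> 'a" +
  assumes alg_closed: "\<And>p :: 'c poly. Polynomial.degree p > 0 \<Longrightarrow> \<exists>x. poly p x = 0"
    and alg_emb: "\<And>x :: 'c. \<exists>p. p \<noteq> 0 \<and> poly (map_poly emb p) x = 0"
begin

lemma algebraic_k0:
  "\<exists>p. p \<noteq> 0 \<and> (\<forall>i. Polynomial.coeff p i \<in> k0) \<and> poly (map_poly emb p) x = 0"
proof -
  obtain p where p: "p \<noteq> 0" "poly (map_poly emb p) x = 0" using alg_emb by blast
  let ?q = "\<Prod>g\<in>G. map_poly (act g) p"
  have hom: "map_poly (act g) (map_poly (act h) p) = map_poly (act (g \<circ> h)) p" if "g \<in> G" "h \<in> G" for g h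
    using that by (intro poly_eqI) (simp add: coeff_map_poly act_0 act_comp comp_G)
  have "map_poly (act g) ?q = ?q" if g: "g \<in> G" for g
  proof -
    have "map_poly (act g) ?q = (\<Prod>h\<in>G. map_poly (act (g \<circ> h)) p)"
      using g by (subst map_poly_prod_hom) (auto simp: act_0 act_1 act_add act_mult hom)
    also have "\<dots> = ?q" by (rule prod.reindex_bij_betw[OF bij_left[OF g]])
    finally show ?thesis .
  qed
  then have "act g (Polynomial.coeff ?q i) = Polynomial.coeff ?q i" if "g \<in> G" for g i
    using that by (metis act_0 coeff_map_poly)
  then have c: "Polynomial.coeff ?q i \<in> k0" for i by (simp add: k0_def)
  have "map_poly (act g) p \<noteq> 0" if "g \<in> G" for g
  proof
    assume z: "map_poly (act g) p = 0"
    have "act g (Polynomial.coeff p i) = 0" for i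
      using arg_cong[OF z, of "\<lambda>r. Polynomial.coeff r i"] that by (simp add: coeff_map_poly act_0)
    then show False using p(1) that by (auto simp: act_eq_0_iff poly_eq_iff)
  qed
  then have nz: "?q \<noteq> 0" using finite_G by auto
  have "map_poly (act id) p = p" by (intro poly_eqI) (simp add: coeff_map_poly act_id)
  then have "?q = p * (\<Prod>g\<in>G - {id}. map_poly (act g) p)"
    using prod.remove[OF finite_G id_G, of "\<lambda>g. map_poly (act g) p"] by simp
  then have "poly (map_poly emb ?q) x = 0"
    using p(2) by (simp add: map_poly_mult_hom emb_0 emb_add emb_mult)
  then show ?thesis using nz c by blast
qed

lemma pow_KK: "encK z [^]\<^bsub>KK\<^esub> (i :: nat) = encK (z ^ i)"
proof -
  interpret K: field KK by (rule field_KK)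
  show ?thesis by (induction i) (auto simp: mult.commute)
qed

lemma eval_KK: "ring.eval KK (map encK xs) (encK z) = encK (poly (Poly (rev xs)) z)"
proof -
  interpret K: field KK by (rule field_KK)
  show ?thesis
    by (induction xs) (auto simp: Poly_append poly_monom pow_KK add.commute mult.commute)
qed

lemma list_KK: "set p \<subseteq> carrier KK \<Longrightarrow> p = map encK (map (inv_into UNIV encK) p)"
  by (induction p) auto

lemma splitted_KK: "p \<in> carrier (poly_ring KK) \<Longrightarrow> ring.splitted KK p"
proof -
  interpret K: field KK by (rule field_KK)
  have "algebraically_closed KK"
  proof (rule K.algebraically_closedI)
    fix p assume p: "p \<in> carrier (poly_ring KK)" and deg: "1 < Polynomials.degree p"
    then have ne: "p \<noteq> []" by auto
    have s: "set p \<subseteq> carrier KK" "hd p \<noteq> \<zero>\<^bsub>KK\<^esub>"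
      using p ne unfolding univ_poly_carrier[symmetric] polynomial_def by auto
    define xs where "xs = map (inv_into UNIV encK) p"
    have xs: "p = map encK xs" using list_KK[OF s(1)] by (simp add: xs_def)
    have "length xs > 1" using deg xs by auto
    moreover have "hd xs \<noteq> 0" using s(2) xs ne by (cases xs) auto
    then have "coeffs (Poly (rev xs)) = rev xs" using ne xs by (cases xs) simp_all
    ultimately have "Polynomial.degree (Poly (rev xs)) > 0"
      by (simp add: degree_eq_length_coeffs)
    then obtain z where "poly (Poly (rev xs)) z = 0" using alg_closed by blast
    then have "ring.eval KK p (encK z) = \<zero>\<^bsub>KK\<^esub>" by (simp add: xs eval_KK)
    then show "\<exists>x\<in>carrier KK. ring.eval KK p x = \<zero>\<^bsub>KK\<^esub>" by auto
  qed
  then show "p \<in> carrier (poly_ring KK) \<Longrightarrow> ring.splitted KK p"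
    by (rule algebraically_closed.roots_over_carrier)
qed

lemma kk_KK: "kk = KK \<lparr>carrier := \<kappa> ` k0\<rparr>"
  by (simp add: kk_def KK_def \<kappa>_def image_image)

lemma subfield_kk: "subfield (\<kappa> ` k0) KK"
proof -
  interpret K: field KK by (rule field_KK)
  have sr: "subring (\<kappa> ` k0) KK"
  proof (rule K.subringI)
    show "\<ominus>\<^bsub>KK\<^esub> h \<in> \<kappa> ` k0" if h: "h \<in> \<kappa> ` k0" for h
    proof -
      obtain c where c: "h = \<kappa> c" "c \<in> k0" using h by blast
      have "\<kappa> (- c) \<oplus>\<^bsub>KK\<^esub> \<kappa> c = \<zero>\<^bsub>KK\<^esub>" unfolding \<kappa>_KK by (simp add: \<kappa>_def emb_0)
      then have "\<ominus>\<^bsub>KK\<^esub> h = \<kappa> (- c)" using c K.minus_equality \<kappa>_KK(1) by metis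
      then show ?thesis using c by auto
    qed
  next
    show "\<one>\<^bsub>KK\<^esub> \<in> \<kappa> ` k0" using \<kappa>_KK(4) by blast
    show "h1 \<otimes>\<^bsub>KK\<^esub> h2 \<in> \<kappa> ` k0" "h1 \<oplus>\<^bsub>KK\<^esub> h2 \<in> \<kappa> ` k0" if "h1 \<in> \<kappa> ` k0" "h2 \<in> \<kappa> ` k0" for h1 h2
      using that by (auto simp only: \<kappa>_KK intro!: imageI k0_closed)
  qed (use \<kappa>_KK(1) in blast)
  show ?thesis
  proof (rule K.subfieldI'[OF sr])
    fix k assume k: "k \<in> \<kappa> ` k0 - {\<zero>\<^bsub>KK\<^esub>}"
    have z: "\<zero>\<^bsub>KK\<^esub> = \<kappa> 0" by (simp add: \<kappa>_def emb_0)
    obtain c where c: "k = \<kappa> c" "c \<in> k0" "c \<noteq> 0" using k unfolding z by auto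
    then have "\<kappa> c \<otimes>\<^bsub>KK\<^esub> \<kappa> (inverse c) = \<one>\<^bsub>KK\<^esub>" unfolding \<kappa>_KK by simp
    then have "inv\<^bsub>KK\<^esub> k = \<kappa> (inverse c)" using c K.comm_inv_char \<kappa>_KK(1) by metis
    then show "inv\<^bsub>KK\<^esub> k \<in> \<kappa> ` k0" using c by auto
  qed
qed

lemma add_pow_kk: "c \<in> k0 \<Longrightarrow> add_pow kk (i :: nat) (\<kappa> c) = \<kappa> (of_nat i * c)"
proof -
  interpret k: field kk by (rule field_kk)
  assume "c \<in> k0"
  then show ?thesis by (induction i) (auto simp: k.add.nat_pow_Suc algebra_simps)
qed

lemma poly_deriv_kk:
  assumes p: "p \<in> carrier (poly_ring kk)" "length p \<ge> 2"
  shows "poly_deriv kk p \<in> carrier (poly_ring kk)" "length (poly_deriv kk p) = length p - 1"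
proof -
  interpret k: field kk by (rule field_kk)
  have s: "set p \<subseteq> carrier kk" "hd p \<noteq> \<zero>\<^bsub>kk\<^esub>"
    using p unfolding univ_poly_carrier[symmetric] polynomial_def by auto
  let ?q = "map (\<lambda>i. add_pow kk (length p - 1 - i) (p ! i)) [0..<length p - 1]"
  have q: "set ?q \<subseteq> carrier kk" using s(1) by (auto intro!: k.add.nat_pow_closed simp del: kk_simps)
  have ne: "p \<noteq> []" "?q \<noteq> []" using p(2) by auto
  have "hd ?q = add_pow kk (length p - 1) (hd p)"
    unfolding hd_conv_nth[OF ne(1)] hd_conv_nth[OF ne(2)] using p(2) by simp
  moreover have "hd p \<in> carrier kk" using s(1) p(2) by (cases p) auto
  then obtain c where "hd p = \<kappa> c" "c \<in> k0" "c \<noteq> 0" using s(2) by auto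
  ultimately have "hd ?q \<noteq> \<zero>\<^bsub>kk\<^esub>" using p(2) by (simp add: add_pow_kk)
  then have "k.normalize ?q = ?q" using p(2) by (cases ?q) auto
  then show "length (poly_deriv kk p) = length p - 1" by (simp add: poly_deriv_def)
  show "poly_deriv kk p \<in> carrier (poly_ring kk)"
    unfolding poly_deriv_def univ_poly_carrier[symmetric] by (rule k.normalize_gives_polynomial[OF q])
qed

lemma separable_root:
  assumes x: "x \<in> carrier KK"
  shows "\<exists>p. separable_poly kk p \<and> ring.eval KK p x = \<zero>\<^bsub>KK\<^esub>"
proof -
  interpret K: field KK by (rule field_KK)
  interpret k: field kk by (rule field_kk)
  let ?k = "\<kappa> ` k0"
  have sr: "subring ?k KK" using subfield_kk by (rule subfieldE(1))
  have up: "univ_poly kk = univ_poly KK" unfolding kk_KK by (rule K.univ_poly_consistent[OF sr])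
  have ck: "carrier kk = ?k" by simp
  obtain z where z: "x = encK z" using x by auto
  obtain q where q: "q \<noteq> 0" "\<And>i. Polynomial.coeff q i \<in> k0" "poly (map_poly emb q) z = 0"
    using algebraic_k0 by blast
  define cs where "cs = map emb (rev (coeffs q))"
  have "hd (map encK cs) = \<kappa> (Polynomial.lead_coeff q)"
    using q(1) by (simp add: cs_def hd_map hd_rev last_coeffs_eq_coeff_degree \<kappa>_def)
  then have "map encK cs \<in> carrier (univ_poly KK ?k)" "map encK cs \<noteq> []"
    using q(1,2) unfolding univ_poly_carrier[symmetric] polynomial_def
    by (auto simp: cs_def \<kappa>_def[symmetric] coeffs_def emb_0[symmetric] simp del: emb_0)
  moreover have "Poly (rev cs) = map_poly emb q"
    by (simp add: cs_def rev_map map_poly_def)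
  then have "ring.eval KK (map encK cs) x = \<zero>\<^bsub>KK\<^esub>" by (simp add: z eval_KK q(3))
  ultimately have alg: "(K.algebraic over ?k) x" by (rule K.algebraicI)
  define p where "p = K.Irr ?k x"
  note p = K.IrrE[OF subfield_kk x alg, folded p_def]
  have p1: "p \<in> carrier (poly_ring kk)" using p(1) up by simp
  note pE = K.pirreducibleE[OF sr p(1,2)]
  have len: "length p \<ge> 2"
  proof (rule ccontr)
    assume "\<not> ?thesis"
    then obtain a where a: "p = [a]" using pE(1) by (cases p) (auto simp: Suc_le_eq)
    then have "a = \<one>\<^bsub>KK\<^esub>" using p(3) by simp
    then show False using p(4) a x injD[OF inj_encK, of 1 0] by auto
  qed
  note d = poly_deriv_kk[OF p1 len]
  interpret P: domain "univ_poly KK ?k" by (rule K.univ_poly_is_domain[OF sr])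
  have "separable_poly kk p"
    unfolding separable_poly_def
  proof (intro conjI ballI impI p1)
    fix f assume f: "f \<in> carrier (poly_ring kk)" and dv: "f pdivides\<^bsub>kk\<^esub> p \<and> f pdivides\<^bsub>kk\<^esub> (poly_deriv kk p)"
    have f': "f \<in> carrier (univ_poly KK ?k)" using f up by simp
    obtain r s where r: "r \<in> carrier (univ_poly KK ?k)" "p = f \<otimes>\<^bsub>univ_poly KK ?k\<^esub> r"
      and s: "s \<in> carrier (univ_poly KK ?k)" "poly_deriv kk p = f \<otimes>\<^bsub>univ_poly KK ?k\<^esub> s"
      using dv unfolding pdivides_def factor_def up ck by auto
    show "f \<in> Units (poly_ring kk)"
    proof (rule ccontr)
      assume "\<not> ?thesis"
      then have "f \<notin> Units (univ_poly KK ?k)" by (simp add: up)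
      then have ru: "r \<in> Units (univ_poly KK ?k)" using pE(3)[OF f' r] by blast
      define t where "t = inv\<^bsub>univ_poly KK ?k\<^esub> r"
      have t: "t \<in> carrier (univ_poly KK ?k)" "r \<otimes>\<^bsub>univ_poly KK ?k\<^esub> t = \<one>\<^bsub>univ_poly KK ?k\<^esub>"
        using ru by (auto simp: t_def)
      have "f = p \<otimes>\<^bsub>univ_poly KK ?k\<^esub> t"
        using f' r t by (simp add: P.m_assoc)
      then have "poly_deriv kk p = p \<otimes>\<^bsub>univ_poly KK ?k\<^esub> (t \<otimes>\<^bsub>univ_poly KK ?k\<^esub> s)"
        using s p(1) t by (simp add: P.m_assoc)
      then have "p pdivides\<^bsub>kk\<^esub> poly_deriv kk p"
        unfolding pdivides_def factor_def up ck using t(1) s(1) by (intro bexI[of _ "t \<otimes>\<^bsub>univ_poly KK ?k\<^esub> s"]) auto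
      moreover have "poly_deriv kk p \<noteq> []" using d(2) len by auto
      ultimately have "Polynomials.degree p \<le> Polynomials.degree (poly_deriv kk p)"
        using k.pdivides_imp_degree_le[OF k.carrier_is_subring p1 d(1)] by blast
      then show False using d(2) len by simp
    qed
  qed
  then show ?thesis using p(4) by blast
qed

lemma separable_closure_KK: "separable_closure kk KK (\<lambda>x. x)"
  unfolding separable_closure_def
proof (intro conjI ballI allI impI)
  show "(\<lambda>x. x) \<in> ring_hom kk KK"
    by (rule ring_hom_memI) (auto simp: \<kappa>_KK(4)[simplified] \<kappa>_def emb_add emb_mult kk_def)
  show "\<exists>p. separable_poly kk p \<and> ring.eval KK (map (\<lambda>x. x) p) x = \<zero>\<^bsub>KK\<^esub>" if "x \<in> carrier KK" for x
    using separable_root[OF that] by simp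
  show "ring.splitted KK p" if "separable_poly KK p" for p
    using that by (intro splitted_KK) (simp add: separable_poly_def)
qed (rule field_kk field_KK)+

theorem TT_torus: "torus_of_dim kk AA TT n"
  unfolding torus_of_dim_def using TT_algebraic_group separable_closure_KK base_change_TT by blast

end

lemma mat_monoid_simps:
  "carrier (mat_monoid r R) = {..<r} \<times> {..<r} \<rightarrow>\<^sub>E carrier R"
  "i < r \<Longrightarrow> j < r \<Longrightarrow> (M \<otimes>\<^bsub>mat_monoid r R\<^esub> N) (i, j) = (\<Oplus>\<^bsub>R\<^esub>l\<in>{..<r}. M (i, l) \<otimes>\<^bsub>R\<^esub> N (l, j))"
  "i < r \<Longrightarrow> j < r \<Longrightarrow> \<one>\<^bsub>mat_monoid r R\<^esub> (i, j) = (if i = j then \<one>\<^bsub>R\<^esub> else \<zero>\<^bsub>R\<^esub>)"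
  by (simp_all add: mat_monoid_def)

lemma mat_eqI:
  assumes "M \<in> extensional ({..<r} \<times> {..<r})" "N \<in> extensional ({..<r} \<times> {..<r})"
    "\<And>i j. i < r \<Longrightarrow> j < r \<Longrightarrow> M (i, j) = N (i, j)"
  shows "M = N"
  using assms by (intro extensionalityI[of M "{..<r} \<times> {..<r}" N]) auto

lemma mat_ext:
  "M \<otimes>\<^bsub>mat_monoid r R\<^esub> N \<in> extensional ({..<r} \<times> {..<r})" "\<one>\<^bsub>mat_monoid r R\<^esub> \<in> extensional ({..<r} \<times> {..<r})"
  "M \<in> carrier (mat_monoid r R) \<Longrightarrow> M \<in> extensional ({..<r} \<times> {..<r})"
  by (auto simp: mat_monoid_def extensional_def)

lemma mat_entry: "M \<in> carrier (mat_monoid r R) \<Longrightarrow> i < r \<Longrightarrow> j < r \<Longrightarrow> M (i, j) \<in> carrier R"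
  by (auto simp: mat_monoid_simps PiE_iff)

lemma mat_mult_closed:
  assumes "cring R" "M \<in> carrier (mat_monoid r R)" "N \<in> carrier (mat_monoid r R)"
  shows "M \<otimes>\<^bsub>mat_monoid r R\<^esub> N \<in> carrier (mat_monoid r R)"
proof -
  interpret cring R by (rule assms)
  show ?thesis unfolding mat_monoid_simps(1)
    by (intro PiE_I) (auto simp: mat_monoid_simps mat_ext extensional_arb[OF mat_ext(1)] intro!: finsum_closed mat_entry[OF assms(2)] mat_entry[OF assms(3)])
qed

lemma mat_monoid_monoid:
  fixes R :: "'a alg" (structure)
  assumes "cring R" shows "monoid (mat_monoid r R)"
proof -
  interpret cring R by (rule assms)
  note cl = mat_entry
  show ?thesis
  proof (rule monoidI)
    show one: "\<one>\<^bsub>mat_monoid r R\<^esub> \<in> carrier (mat_monoid r R)" by (auto simp: mat_monoid_def)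
    fix M N P assume M: "M \<in> carrier (mat_monoid r R)" and N: "N \<in> carrier (mat_monoid r R)" and P: "P \<in> carrier (mat_monoid r R)"
    show "M \<otimes>\<^bsub>mat_monoid r R\<^esub> N \<otimes>\<^bsub>mat_monoid r R\<^esub> P = M \<otimes>\<^bsub>mat_monoid r R\<^esub> (N \<otimes>\<^bsub>mat_monoid r R\<^esub> P)"
    proof (rule mat_eqI[OF mat_ext(1) mat_ext(1)])
      fix i j assume ij: "i < r" "j < r"
      have "(M \<otimes>\<^bsub>mat_monoid r R\<^esub> N \<otimes>\<^bsub>mat_monoid r R\<^esub> P) (i, j)
          = (\<Oplus>l\<in>{..<r}. \<Oplus>k\<in>{..<r}. M (i, k) \<otimes> (N (k, l) \<otimes> P (l, j)))"
        using ij by (simp add: mat_monoid_simps)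
          (intro finsum_cong', auto simp: mat_monoid_simps cl[OF M] cl[OF N] cl[OF P] finsum_ldistr m_assoc Pi_iff intro!: finsum_cong' finsum_closed)
      also have "\<dots> = (\<Oplus>k\<in>{..<r}. \<Oplus>l\<in>{..<r}. M (i, k) \<otimes> (N (k, l) \<otimes> P (l, j)))"
        using ij by (intro finsum_swap) (auto simp: cl[OF M] cl[OF N] cl[OF P])
      also have "\<dots> = (M \<otimes>\<^bsub>mat_monoid r R\<^esub> (N \<otimes>\<^bsub>mat_monoid r R\<^esub> P)) (i, j)"
        using ij by (simp add: mat_monoid_simps)
          (intro finsum_cong', auto simp: mat_monoid_simps cl[OF M] cl[OF N] cl[OF P] finsum_rdistr Pi_iff intro!: finsum_closed)
      finally show "(M \<otimes>\<^bsub>mat_monoid r R\<^esub> N \<otimes>\<^bsub>mat_monoid r R\<^esub> P) (i, j)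
          = (M \<otimes>\<^bsub>mat_monoid r R\<^esub> (N \<otimes>\<^bsub>mat_monoid r R\<^esub> P)) (i, j)" .
    qed
  next
    fix M assume M: "M \<in> carrier (mat_monoid r R)"
    show "\<one>\<^bsub>mat_monoid r R\<^esub> \<otimes>\<^bsub>mat_monoid r R\<^esub> M = M"
    proof (rule mat_eqI[OF mat_ext(1) mat_ext(3)[OF M]])
      fix i j assume ij: "i < r" "j < r"
      then have "(\<one>\<^bsub>mat_monoid r R\<^esub> \<otimes>\<^bsub>mat_monoid r R\<^esub> M) (i, j) = (\<Oplus>l\<in>{..<r}. if i = l then M (l, j) else \<zero>)"
        by (simp add: mat_monoid_simps) (intro finsum_cong', auto simp: mat_monoid_simps cl[OF M])
      also have "\<dots> = M (i, j)" using ij by (intro add.finprod_singleton) (auto simp: cl[OF M])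
      finally show "(\<one>\<^bsub>mat_monoid r R\<^esub> \<otimes>\<^bsub>mat_monoid r R\<^esub> M) (i, j) = M (i, j)" .
    qed
    show "M \<otimes>\<^bsub>mat_monoid r R\<^esub> \<one>\<^bsub>mat_monoid r R\<^esub> = M"
    proof (rule mat_eqI[OF mat_ext(1) mat_ext(3)[OF M]])
      fix i j assume ij: "i < r" "j < r"
      then have "(M \<otimes>\<^bsub>mat_monoid r R\<^esub> \<one>\<^bsub>mat_monoid r R\<^esub>) (i, j) = (\<Oplus>l\<in>{..<r}. if j = l then M (i, l) else \<zero>)"
        by (simp add: mat_monoid_simps) (intro finsum_cong', auto simp: mat_monoid_simps cl[OF M])
      also have "\<dots> = M (i, j)" using ij by (intro add.finprod_singleton) (auto simp: cl[OF M])
      finally show "(M \<otimes>\<^bsub>mat_monoid r R\<^esub> \<one>\<^bsub>mat_monoid r R\<^esub>) (i, j) = M (i, j)" .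
    qed
  qed (rule mat_mult_closed[OF assms])
qed

lemma GL_group: "cring R \<Longrightarrow> group (GL r R)"
  unfolding GL_def by (rule monoid.units_group[OF mat_monoid_monoid])

lemma GL_carrier: "M \<in> carrier (GL r R) \<Longrightarrow> M \<in> carrier (mat_monoid r R)"
  by (auto simp: GL_def units_of_def Units_def)

lemma GL_mult: "M \<otimes>\<^bsub>GL r R\<^esub> N = M \<otimes>\<^bsub>mat_monoid r R\<^esub> N"
  by (simp add: GL_def units_of_def)

lemma GL_carrierI:
  "M \<in> carrier (mat_monoid r R) \<Longrightarrow> N \<in> carrier (mat_monoid r R) \<Longrightarrow> M \<otimes>\<^bsub>mat_monoid r R\<^esub> N = \<one>\<^bsub>mat_monoid r R\<^esub>
   \<Longrightarrow> N \<otimes>\<^bsub>mat_monoid r R\<^esub> M = \<one>\<^bsub>mat_monoid r R\<^esub> \<Longrightarrow> M \<in> carrier (GL r R)"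
  by (auto simp: GL_def units_of_def Units_def)

context torus_data
begin

lemma m_pos: "m > 0"
  using coords[OF id_G] by (cases m) auto

text \<open>
  A torus acts on \<open>L \<otimes> R\<close>, through the character \<open>e\<^sub>j\<close>, by multiplication.  The block diagonal matrix of
  these actions, in the basis \<open>\<alpha>\<close>, is a faithful representation.
\<close>

definition rho :: "'a alg \<Rightarrow> ('a \<Rightarrow> 'a) \<Rightarrow> (nat \<times> nat \<Rightarrow> 'a)" where
  "rho R f = (\<lambda>(i, l)\<in>{..<n * m} \<times> {..<n * m}.
     if i div m = l div m then fam f (e (i div m)) (\<beta> (i mod m) * \<alpha> (l mod m)) else \<zero>\<^bsub>R\<^esub>)"

lemma rho_ext: "rho R f \<in> extensional ({..<n * m} \<times> {..<n * m})"
  by (simp add: rho_def extensional_def)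

lemma div_m: "i < n * m \<Longrightarrow> i div m < n"
  by (simp add: less_mult_imp_div_less)

end

context torus_point
begin

lemma rho_closed: "f \<in> alg_hom kk AA R \<Longrightarrow> rho R f \<in> carrier (mat_monoid (n * m) R)"
  unfolding mat_monoid_simps(1)
  by (intro PiE_I) (auto simp: rho_def e_X div_m intro!: klin_closed[OF fam_klin])

lemma block_sum:
  assumes J: "J < n" and f: "\<And>q. q < m \<Longrightarrow> f q \<in> carrier R"
  shows "(\<Oplus>p\<in>{..<n * m}. if p div m = J then f (p mod m) else \<zero>) = (\<Oplus>q\<in>{..<m}. f q)"
proof -
  let ?B = "{p. p < n * m \<and> p div m = J}"
  have lt: "J * m + q < n * m" if "q < m" for q
  proof -
    have "J * m + q < Suc J * m" using that by simp
    also have "\<dots> \<le> n * m" using J by (intro mult_right_mono) auto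
    finally show ?thesis .
  qed
  have bij: "bij_betw (\<lambda>q. J * m + q) {..<m} ?B"
    by (rule bij_betwI[where g = "\<lambda>p. p mod m"]) (use lt m_pos in auto)
  have "(\<Oplus>p\<in>{..<n * m}. if p div m = J then f (p mod m) else \<zero>) = (\<Oplus>p\<in>?B. if p div m = J then f (p mod m) else \<zero>)"
    using m_pos f by (intro S.finsum_superset[symmetric]) auto
  also have "\<dots> = (\<Oplus>q\<in>{..<m}. if (J * m + q) div m = J then f ((J * m + q) mod m) else \<zero>)"
    using m_pos f by (intro S.finsum_bij[OF bij, symmetric]) auto
  also have "\<dots> = (\<Oplus>q\<in>{..<m}. f q)"
    using m_pos f by (intro S.finsum_cong') auto
  finally show ?thesis .
qed

lemma rho_mult:
  assumes f: "f \<in> alg_hom kk AA R" and g: "g \<in> alg_hom kk AA R"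
  shows "rho R (f \<otimes>\<^bsub>TT R\<^esub> g) = rho R f \<otimes>\<^bsub>mat_monoid (n * m) R\<^esub> rho R g"
proof (rule mat_eqI[OF rho_ext mat_ext(1)])
  fix i l assume il: "i < n * m" "l < n * m"
  let ?J = "i div m"
  have eJ: "e ?J \<in> \<Lambda>" using il by (simp add: e_X div_m)
  have k: "klin (fam f (e ?J))" "klin (fam g (e ?J))" using f g eJ by (auto simp: fam_klin)
  show "rho R (f \<otimes>\<^bsub>TT R\<^esub> g) (i, l) = (rho R f \<otimes>\<^bsub>mat_monoid (n * m) R\<^esub> rho R g) (i, l)"
  proof (cases "i div m = l div m")
    case True
    have "(rho R f \<otimes>\<^bsub>mat_monoid (n * m) R\<^esub> rho R g) (i, l)
        = (\<Oplus>p\<in>{..<n * m}. if p div m = ?J then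
             fam f (e ?J) (\<beta> (i mod m) * \<alpha> (p mod m)) \<otimes> fam g (e ?J) (\<alpha> (l mod m) * \<beta> (p mod m)) else \<zero>)"
      unfolding mat_monoid_simps(2)[OF il] using il True k
      by (intro S.finsum_cong') (auto simp: rho_def klin_closed mult.commute)
    also have "\<dots> = (\<Oplus>q\<in>{..<m}. fam f (e ?J) (\<beta> (i mod m) * \<alpha> q) \<otimes> fam g (e ?J) (\<alpha> (l mod m) * \<beta> q))"
      using il k by (intro block_sum) (auto simp: klin_closed div_m)
    also have "\<dots> = ct R (fam f (e ?J)) (fam g (e ?J)) (\<beta> (i mod m) * \<alpha> (l mod m))"
      by (rule canonical_ct[OF canonical_\<alpha>\<beta> k])
    finally show ?thesis using il True eJ by (simp add: rho_def TT_mult[OF f g])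
  next
    case False
    have "(rho R f \<otimes>\<^bsub>mat_monoid (n * m) R\<^esub> rho R g) (i, l) = (\<Oplus>p\<in>{..<n * m}. \<zero>)"
      unfolding mat_monoid_simps(2)[OF il] 
    proof (rule S.finsum_cong')
      fix p assume p: "p \<in> {..<n * m}"
      have "rho R f (i, p) \<in> carrier R" "rho R g (p, l) \<in> carrier R"
        using mat_entry[OF rho_closed[OF f]] mat_entry[OF rho_closed[OF g]] p il by auto
      moreover have "rho R f (i, p) = \<zero> \<or> rho R g (p, l) = \<zero>"
        using p il False by (auto simp: rho_def)
      ultimately show "rho R f (i, p) \<otimes> rho R g (p, l) = \<zero>" by auto
    qed auto
    then show ?thesis using il False by (simp add: rho_def)
  qed
qed

lemma rho_one: "rho R \<one>\<^bsub>TT R\<^esub> = \<one>\<^bsub>mat_monoid (n * m) R\<^esub>"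
proof (rule mat_eqI[OF rho_ext mat_ext(2)])
  fix i l assume il: "i < n * m" "l < n * m"
  have "i = l \<longleftrightarrow> i div m = l div m \<and> i mod m = l mod m" by (metis div_mult_mod_eq)
  moreover have "Tr (\<beta> (i mod m) * \<alpha> (l mod m)) = (if i mod m = l mod m then 1 else 0)"
    using m_pos by (intro dual) auto
  moreover have "\<kappa> 1 \<odot> \<one> = \<one>" "\<kappa> 0 \<odot> \<one> = \<zero>"
    using S.smult_one[OF S.one_closed] S.smult_l_null[OF S.one_closed] by simp_all
  ultimately show "rho R \<one>\<^bsub>TT R\<^esub> (i, l) = \<one>\<^bsub>mat_monoid (n * m) R\<^esub> (i, l)"
    using il by (cases "i mod m = l mod m") (auto simp: rho_def mat_monoid_simps TT_one e_X div_m)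
qed

lemma rho_hom: "rho R \<in> hom (TT R) (GL (n * m) R)"
proof (rule homI)
  interpret T: group "TT R" by (rule TT_group)
  fix f assume f: "f \<in> carrier (TT R)"
  then have fi: "inv\<^bsub>TT R\<^esub> f \<in> alg_hom kk AA R" using T.inv_closed by simp
  have f': "f \<in> alg_hom kk AA R" using f by simp
  show "rho R f \<in> carrier (GL (n * m) R)"
    using rho_mult[OF f' fi] rho_mult[OF fi f'] f
    by (intro GL_carrierI[OF rho_closed[OF f'] rho_closed[OF fi]]) (simp_all add: rho_one T.r_inv T.l_inv)
qed (simp add: rho_mult GL_mult)

end

context torus_data
begin

lemma rho_representation: "representation kk AA TT (n * m) rho"
  unfolding representation_def
proof (intro conjI allI impI)
  fix R :: "'a alg" assume "algebra kk R" then show "rho R \<in> hom (TT R) (GL (n * m) R)"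
    by (rule torus_point.rho_hom[OF torus_pointI])
next
  fix R S :: "'a alg" and f x assume RS: "algebra kk R" "algebra kk S" and f: "f \<in> alg_hom kk R S" and x: "x \<in> carrier (TT R)"
  interpret R: algebra kk R by (rule RS)
  interpret S: algebra kk S by (rule RS)
  interpret f: ring_hom_cring R S f
    using f R.M_cring S.M_cring by unfold_locales (auto simp: alg_hom_def cring_def)
  show "rho S (compose (carrier AA) f x) = compose ({..<n * m} \<times> {..<n * m}) f (rho R x)"
    by (auto simp: rho_def compose_def fun_eq_iff fam_def \<tau>_A0 e_X div_m)
qed

lemma id_point: "(\<lambda>a\<in>carrier AA. a) \<in> alg_hom kk AA AA"
proof -
  interpret algebra kk AA by (rule algebra_AA)
  show ?thesis by (rule alg_homI) (auto simp: A0_closed)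
qed

lemma fam_id: "v \<in> \<Lambda> \<Longrightarrow> fam (\<lambda>a\<in>carrier AA. a) v c = encA (\<tau> c v)"
  by (simp add: fam_def \<tau>_A0)

lemma rho_faithful: "faithful_embedding kk AA TT (n * m) rho"
proof -
  interpret A: torus_point G act \<alpha> \<beta> m \<Lambda> e n crd emb encK encA AA by (rule torus_pointI[OF algebra_AA])
  interpret T: group "TT AA" by (rule A.TT_group)
  interpret GL: group "GL (n * m) AA" by (rule GL_group[OF A.S.M_cring])
  interpret h: group_hom "TT AA" "GL (n * m) AA" "rho AA"
    by unfold_locales (rule A.rho_hom)
  let ?id = "\<lambda>a\<in>carrier AA. a"
  have idc: "?id \<in> carrier (TT AA)" using id_point by simp
  define I where "I = inv\<^bsub>TT AA\<^esub> ?id"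
  have I: "I \<in> alg_hom kk AA AA" using T.inv_closed[OF idc] by (simp add: I_def)
  have inv: "inv\<^bsub>GL (n * m) AA\<^esub> (rho AA ?id) = rho AA I" unfolding I_def by (rule h.hom_inv[OF idc, symmetric])
  have cl: "rho AA f ` ({..<n * m} \<times> {..<n * m}) \<subseteq> carrier AA" if "f \<in> alg_hom kk AA AA" for f
    using mat_entry[OF A.rho_closed[OF that]] by (auto simp del: AA_simps)
  have \<alpha>0: "\<alpha> 0 \<noteq> 0" using dual[of 0 0] m_pos by (auto simp: Tr_0)
  have entry: "fam f (e j) (\<beta> i * \<alpha> 0) \<in> rho AA f ` ({..<n * m} \<times> {..<n * m})" if "j < n" "i < m" for f i j
  proof -
    have lt: "j * m + i' < n * m" if "i' < m" for i'
    proof -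
      have "j * m + i' < Suc j * m" using that by simp
      also have "\<dots> \<le> n * m" using \<open>j < n\<close> by (intro mult_right_mono) auto
      finally show ?thesis .
    qed
    have "rho AA f (j * m + i, j * m + 0) = fam f (e j) (\<beta> i * \<alpha> 0)"
      using lt[OF \<open>i < m\<close>] lt[OF m_pos] \<open>i < m\<close> by (simp add: rho_def)
    then show ?thesis using lt[OF \<open>i < m\<close>] lt[OF m_pos] by (metis SigmaI image_eqI lessThan_iff)
  qed
  have "generate_alg kk AA (rho AA ?id ` ({..<n * m} \<times> {..<n * m}) \<union> rho AA I ` ({..<n * m} \<times> {..<n * m})) = carrier AA"
  proof (rule generate_AA)
    fix j assume j: "j < n"
    show "\<exists>c. c \<noteq> 0 \<and> (\<forall>i<m. encA (\<tau> (\<beta> i * c) (e j)) \<in> rho AA ?id ` ({..<n * m} \<times> {..<n * m}) \<union> rho AA I ` ({..<n * m} \<times> {..<n * m}))"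
      using \<alpha>0 entry[OF j, of _ ?id] fam_id[OF e_X[OF j]] by (intro exI[of _ "\<alpha> 0"]) (auto simp del: AA_simps)
    have "fam I (e j) c = encA (\<tau> c (- e j))" for c
      unfolding I_def using A.TT_inv_fam[OF id_point e_X[OF j]] fam_id[OF X_uminus[OF e_X[OF j]]] by simp
    then show "\<exists>c. c \<noteq> 0 \<and> (\<forall>i<m. encA (\<tau> (\<beta> i * c) (- e j)) \<in> rho AA ?id ` ({..<n * m} \<times> {..<n * m}) \<union> rho AA I ` ({..<n * m} \<times> {..<n * m}))"
      using \<alpha>0 entry[OF j, of _ I] by (intro exI[of _ "\<alpha> 0"]) auto
  qed (use cl[OF id_point] cl[OF I] in blast)
  then show ?thesis using rho_representation inv by (simp add: faithful_embedding_def Let_def del: AA_simps)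
qed

end

lemma independent_characters:
  fixes w :: "'u \<Rightarrow> 'v \<Rightarrow> 'c::field"
  assumes fin: "finite S"
    and mul: "\<And>u u'. u \<in> U \<Longrightarrow> u' \<in> U \<Longrightarrow> mul u u' \<in> U"
    and wmul: "\<And>u u' v. u \<in> U \<Longrightarrow> u' \<in> U \<Longrightarrow> v \<in> S \<Longrightarrow> w (mul u u') v = w u v * w u' v"
    and sep: "\<And>v v'. v \<in> S \<Longrightarrow> v' \<in> S \<Longrightarrow> v \<noteq> v' \<Longrightarrow> \<exists>u\<in>U. w u v \<noteq> w u v'"
    and u0: "u0 \<in> U" "\<And>v. v \<in> S \<Longrightarrow> w u0 v \<noteq> 0"
    and zero: "\<And>u. u \<in> U \<Longrightarrow> (\<Sum>v\<in>S. a v * w u v) = 0"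
  shows "v \<in> S \<Longrightarrow> a v = 0"
  using fin wmul sep u0(2) zero
proof (induction S arbitrary: a v rule: finite_induct)
  case (insert x S)
  have aS: "a y = 0" if y: "y \<in> S" for y
  proof -
    have "x \<noteq> y" using insert.hyps y by auto
    then obtain u1 where u1: "u1 \<in> U" "w u1 x \<noteq> w u1 y" using insert.prems(3)[of x y] y by auto
    have "a y * (w u1 y - w u1 x) = 0"
    proof (rule insert.IH[OF y, where a = "\<lambda>y. a y * (w u1 y - w u1 x)"])
      fix u assume u: "u \<in> U"
      have "(\<Sum>v\<in>insert x S. a v * w (mul u1 u) v) = (\<Sum>v\<in>insert x S. a v * (w u1 v * w u v))"
        by (rule sum.cong) (simp_all only: insert.prems(2)[OF u1(1) u])
      then have "0 = (\<Sum>v\<in>insert x S. a v * (w u1 v * w u v)) - w u1 x * (\<Sum>v\<in>insert x S. a v * w u v)"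
        using insert.prems(5) u u1 mul by simp
      also have "\<dots> = (\<Sum>v\<in>insert x S. a v * (w u1 v - w u1 x) * w u v)"
        by (simp only: sum_distrib_left sum_subtractf[symmetric]) (simp add: algebra_simps)
      also have "\<dots> = (\<Sum>v\<in>S. a v * (w u1 v - w u1 x) * w u v)" using insert.hyps by simp
      finally show "(\<Sum>v\<in>S. a v * (w u1 v - w u1 x) * w u v) = 0" by simp
    qed (use insert.prems in auto)
    then show ?thesis using u1(2) by auto
  qed
  have "(\<Sum>v\<in>insert x S. a v * w u0 v) = 0" using insert.prems(5) u0(1) by blast
  then have "a x * w u0 x = 0" using insert.hyps aS by simp
  then have "a x = 0" using insert.prems(4)[of x] by simp
  then show ?case using aS insert.prems(1) by auto
qed simp

lemma sum_fun_apply: "sum f I x = (\<Sum>i\<in>I. f i x)" for f :: "'i \<Rightarrow> 'x \<Rightarrow> 'y::comm_monoid_add"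
  by (induction I rule: infinite_finite_induct) auto

lemma card_orthogonal_idempotents:
  fixes C :: "'v \<Rightarrow> nat \<Rightarrow> nat \<Rightarrow> 'c::field"
  assumes fin: "finite S"
    and orth: "\<And>v v' i j. v \<in> S \<Longrightarrow> v' \<in> S \<Longrightarrow> i < r \<Longrightarrow> j < r \<Longrightarrow>
      (\<Sum>l<r. C v i l * C v' l j) = (if v = v' then C v i j else 0)"
    and nz: "\<And>v. v \<in> S \<Longrightarrow> \<exists>i<r. \<exists>j<r. C v i j \<noteq> 0"
  shows "card S \<le> r"
proof -
  interpret vs: vector_space "\<lambda>c (f :: nat \<Rightarrow> 'c) i. c * f i"
    by unfold_locales (auto simp: fun_eq_iff algebra_simps)
  obtain jj where jj: "\<And>v. v \<in> S \<Longrightarrow> jj v < r \<and> (\<exists>i<r. C v i (jj v) \<noteq> 0)" using nz by metis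
  define x where "x v = (\<lambda>i. if i < r then C v i (jj v) else 0)" for v
  have act: "(\<Sum>l<r. C v' i l * x v l) = (if v = v' then x v i else 0)" if "v \<in> S" "v' \<in> S" "i < r" for v v' i
    using orth[of v' v i "jj v"] jj[of v] that by (auto simp: x_def)
  have xnz: "\<exists>i<r. x v i \<noteq> 0" if "v \<in> S" for v using jj[OF that] by (auto simp: x_def)
  have inj: "inj_on x S"
  proof (rule inj_onI, rule ccontr)
    fix v v' assume v: "v \<in> S" "v' \<in> S" "x v = x v'" "v \<noteq> v'"
    have "x v i = 0" if "i < r" for i using act[of v v i] act[of v' v i] v that by simp
    then show False using xnz[OF v(1)] by auto
  qed
  have "vs.independent (x ` S)"
  proof (rule vs.independent_if_scalars_zero)
    fix a y assume s: "(\<Sum>y\<in>x ` S. (\<lambda>i. a y * y i)) = 0" and y: "y \<in> x ` S"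
    then obtain v where v: "v \<in> S" "y = x v" by auto
    obtain i where i: "i < r" "x v i \<noteq> 0" using xnz v by auto
    have z: "(\<Sum>u\<in>S. a (x u) * x u l) = 0" for l
      using fun_cong[OF s, of l] inj by (simp add: sum.reindex sum_fun_apply)
    have "0 = (\<Sum>l<r. C v i l * (\<Sum>u\<in>S. a (x u) * x u l))" by (simp add: z)
    also have "\<dots> = (\<Sum>u\<in>S. a (x u) * (\<Sum>l<r. C v i l * x u l))"
      by (simp add: sum_distrib_left) (subst sum.swap, simp add: mult_ac)
    also have "\<dots> = (\<Sum>u\<in>S. if u = v then a (x u) * x u i else 0)"
      using v i by (intro sum.cong) (auto simp: act)
    also have "\<dots> = a (x v) * x v i" using v fin by simp
    finally show "a y = 0" using i v by simp
  qed (use fin in simp)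
  moreover have "x ` S \<subseteq> vs.span ((\<lambda>j i. if i = j then 1 else 0) ` {..<r})"
  proof (rule image_subsetI)
    fix v
    have "x v = (\<Sum>j<r. (\<lambda>i. x v j * (if i = j then 1 else 0)))"
      by (rule ext) (simp add: sum_fun_apply if_distrib cong: if_cong, simp add: x_def)
    also have "\<dots> \<in> vs.span ((\<lambda>j i. if i = j then 1 else 0) ` {..<r})"
      by (intro vs.span_sum vs.span_scale vs.span_base) auto
    finally show "x v \<in> vs.span ((\<lambda>j i. if i = j then 1 else 0) ` {..<r})" .
  qed
  ultimately have "card (x ` S) \<le> card ((\<lambda>j i. if i = j then 1 else 0 :: 'c) ` {..<r})"
    by (intro vs.independent_span_bound[THEN conjunct2]) auto
  also have "\<dots> \<le> r" using card_image_le[of "{..<r}"] by simp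
  finally show ?thesis using inj by (simp add: card_image)
qed

context torus_data
begin

definition KA :: "'a alg" where
  "KA = transport encK UNIV (\<lambda>x y. encK (inv_into UNIV encK x * inv_into UNIV encK y))"

lemma KA_simps [simp]:
  "carrier KA = range encK" "encK x \<otimes>\<^bsub>KA\<^esub> encK y = encK (x * y)" "encK x \<oplus>\<^bsub>KA\<^esub> encK y = encK (x + y)"
  "\<one>\<^bsub>KA\<^esub> = encK 1" "\<zero>\<^bsub>KA\<^esub> = encK 0" "encK x \<odot>\<^bsub>KA\<^esub> encK y = encK (x * y)"
  by (simp_all add: KA_def transport_simps[OF inj_encK])

lemma algebra_KA: "algebra KK KA"
proof (rule algebraI)
  show "cring KA" unfolding KA_def by (rule cring_transport[OF inj_encK]) auto
qed (auto simp: cring_KK algebra_simps)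

lemma finsum_KA: "finite I \<Longrightarrow> (\<Oplus>\<^bsub>KA\<^esub>i\<in>I. encK (f i)) = encK (\<Sum>i\<in>I. f i)"
proof -
  interpret algebra KK KA by (rule algebra_KA)
  assume "finite I" then show ?thesis by (induction I rule: finite_induct) (auto simp: finsum_insert)
qed

definition ev :: "('v \<Rightarrow> 'c) \<Rightarrow> ('v \<Rightarrow>\<^sub>0 'l) \<Rightarrow> 'c" where
  "ev w q = (\<Sum>v\<in>supp q. emb (cf q v) * w v)"

lemma ev_superset: "finite W \<Longrightarrow> supp q \<subseteq> W \<Longrightarrow> ev w q = (\<Sum>v\<in>W. emb (cf q v) * w v)"
  unfolding ev_def by (rule sum.mono_neutral_left) (auto simp: in_keys_iff emb_0)

lemma ev_add: "ev w (p + q) = ev w p + ev w q"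
proof -
  let ?W = "supp p \<union> supp q"
  have "ev w (p + q) = (\<Sum>v\<in>?W. emb (cf (p + q) v) * w v)"
    using Poly_Mapping.keys_add[of p q] by (intro ev_superset) auto
  moreover have "ev w p = (\<Sum>v\<in>?W. emb (cf p v) * w v)" "ev w q = (\<Sum>v\<in>?W. emb (cf q v) * w v)"
    by (auto intro: ev_superset)
  ultimately show ?thesis by (simp add: lookup_add emb_add sum.distrib distrib_right)
qed

lemma ev_sum: "ev w (sum f I) = (\<Sum>i\<in>I. ev w (f i))"
  by (induction I rule: infinite_finite_induct) (auto simp: ev_add, auto simp: ev_def)

lemma ev_\<tau>: "ev w (\<tau> c v) = (\<Sum>g\<in>G. emb (act g c) * w (g v))"
proof -
  have "ev w (mon u d) = emb d * w u" for u d
    by (subst ev_superset[of "{u}"]) (auto simp: emb_0)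
  then show ?thesis by (simp add: \<tau>_def ev_sum)
qed

definition wt :: "(nat \<Rightarrow> 'c) \<Rightarrow> 'v \<Rightarrow> 'c" where
  "wt u v = (\<Prod>j<n. u j powi crd j v)"

definition TU :: "(nat \<Rightarrow> 'c) set" where "TU = {u. \<forall>j<n. u j \<noteq> 0}"

lemma wt_add: "u \<in> TU \<Longrightarrow> v \<in> \<Lambda> \<Longrightarrow> v' \<in> \<Lambda> \<Longrightarrow> wt u (v + v') = wt u v * wt u v'"
  unfolding wt_def prod.distrib[symmetric] by (intro prod.cong) (auto simp: crd_add power_int_add TU_def)

lemma wt_0: "wt u 0 = 1"
  by (simp add: wt_def crd_0)

lemma wt_mult: "wt (\<lambda>j. u j * u' j) v = wt u v * wt u' v"
  by (simp add: wt_def power_int_mult_distrib prod.distrib)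

lemma wt_sep: "v \<in> \<Lambda> \<Longrightarrow> v' \<in> \<Lambda> \<Longrightarrow> v \<noteq> v' \<Longrightarrow> \<exists>u\<in>TU. wt u v \<noteq> wt u v'"
proof -
  assume "v \<in> \<Lambda>" "v' \<in> \<Lambda>" "v \<noteq> v'"
  then obtain j where j: "j < n" "crd j v \<noteq> crd j v'" using crd_inj by blast
  define u :: "nat \<Rightarrow> 'c" where "u = (\<lambda>i. if i = j then 2 else 1)"
  have "wt u x = 2 powi crd j x" for x
    unfolding wt_def using j(1) by (subst prod.remove[of _ j]) (auto simp: u_def)
  moreover have "2 powi a \<noteq> (2 powi c :: 'c)" if "a \<noteq> c" for a c :: int
  proof
    assume eq: "2 powi a = (2 powi c :: 'c)"
    have *: "2 ^ i \<noteq> (1 :: 'c)" if "i > 0" for i :: nat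
    proof
      assume "2 ^ i = (1 :: 'c)"
      then have "of_nat (2 ^ i) = (of_nat 1 :: 'c)" by simp
      then have "(2 ^ i :: nat) = 1" by (simp only: of_nat_eq_iff)
      then show False using that by simp
    qed
    have p: "2 powi (a - c) = (1 :: 'c)" "2 powi (c - a) = (1 :: 'c)"
      using eq by (simp_all add: power_int_diff)
    show False
    proof (cases "a > c")
      case True
      then have "2 ^ nat (a - c) = (1 :: 'c)" using p(1) by (simp add: power_int_def)
      then show False using *[of "nat (a - c)"] True by simp
    next
      case False
      then have "2 ^ nat (c - a) = (1 :: 'c)" using p(2) by (simp add: power_int_def)
      then show False using *[of "nat (c - a)"] False that by simp
    qed
  qed
  moreover have "u \<in> TU" by (auto simp: TU_def u_def)
  ultimately show ?thesis using j(2) by metis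
qed

lemma wt_independent:
  assumes "finite S" "S \<subseteq> \<Lambda>" "\<And>u. u \<in> TU \<Longrightarrow> (\<Sum>v\<in>S. a v * wt u v) = 0" "v \<in> S"
  shows "a v = 0"
proof (rule independent_characters[OF assms(1), where U = TU and w = wt and mul = "\<lambda>u u' j. u j * u' j" and ?u0.0 = "\<lambda>_. 1"])
  show "\<exists>u\<in>TU. wt u v \<noteq> wt u v'" if "v \<in> S" "v' \<in> S" "v \<noteq> v'" for v v'
    using that assms(2) by (intro wt_sep) auto
qed (use assms in \<open>auto simp: TU_def wt_mult\<close>, auto simp: wt_def)

lemma wt_point:
  assumes u: "u \<in> TU"
  shows "\<exists>f. f \<in> alg_hom kk AA KA \<and> (\<forall>q\<in>A0. f (encA q) = encK (ev (wt u) q))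
    \<and> (\<forall>v\<in>\<Lambda>. torus_point_K.chi G act \<alpha> \<beta> m emb encK encA KA f v = encK (wt u v))"
proof -
  interpret K: torus_point_K G act \<alpha> \<beta> m \<Lambda> e n crd emb encK encA KA
    by (rule torus_point_KI[OF algebra_KA])
  have sca: "K.sca c = encK (emb c)" for c by (simp add: K.sca_def \<kappa>_def)
  obtain f where f: "f \<in> alg_hom kk AA KA" "\<And>v. v \<in> \<Lambda> \<Longrightarrow> K.chi f v = encK (wt u v)"
      "\<And>v c. v \<in> \<Lambda> \<Longrightarrow> fam f v c = (\<Oplus>\<^bsub>KA\<^esub>g\<in>G. K.sca (act g c) \<otimes>\<^bsub>KA\<^esub> encK (wt u (g v)))"
    by (rule K.char_point[of "\<lambda>v. encK (wt u v)"]) (auto simp: wt_0 wt_add[OF u])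
  have fam: "fam f v c = encK (ev (wt u) (\<tau> c v))" if "v \<in> \<Lambda>" for v c
    using f(3)[OF that] by (simp add: sca finsum_KA[OF finite_G] ev_\<tau>)
  have "f (encA q) = encK (ev (wt u) q)" if q: "q \<in> A0" for q
  proof -
    have "f (encA q) = (\<Oplus>\<^bsub>KA\<^esub>v\<in>supp q. encK (ev (wt u) (\<tau> (\<theta> * cf q v) v)))"
      unfolding K.point_eq[OF f(1) q] using q by (intro K.S.finsum_cong') (auto simp: fam A0_def)
    also have "\<dots> = encK (ev (wt u) (\<Sum>v\<in>supp q. \<tau> (\<theta> * cf q v) v))" by (simp add: finsum_KA ev_sum)
    finally show ?thesis using A0_eq_sum_\<tau>[OF q] by simp
  qed
  then show ?thesis using f(1,2) by blast
qed

lemma faithful_weights: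
  assumes "faithful_embedding kk AA TT r \<rho>"
  shows "\<exists>S. finite S \<and> S \<subseteq> \<Lambda> \<and> (\<forall>g\<in>G. \<forall>v\<in>S. g v \<in> S) \<and>
    (\<forall>H. 0 \<in> H \<and> (\<forall>u\<in>H. \<forall>v\<in>H. u + v \<in> H) \<and> (\<forall>u\<in>H. - u \<in> H) \<and> S \<subseteq> H \<longrightarrow> \<Lambda> \<subseteq> H) \<and> card S \<le> r"
proof -
  let ?id = "\<lambda>a\<in>carrier AA. a"
  define M where "M = \<rho> AA ?id"
  have rep: "representation kk AA TT r \<rho>" and
    gen: "generate_alg kk AA (M ` ({..<r} \<times> {..<r}) \<union> (inv\<^bsub>GL r AA\<^esub> M) ` ({..<r} \<times> {..<r})) = carrier AA"
    using assms by (auto simp: faithful_embedding_def Let_def M_def simp del: AA_simps)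
  have hom: "\<And>R. algebra kk R \<Longrightarrow> \<rho> R \<in> hom (TT R) (GL r R)"
    and nat: "\<And>R S f x. algebra kk R \<Longrightarrow> algebra kk S \<Longrightarrow> f \<in> alg_hom kk R S \<Longrightarrow> x \<in> carrier (TT R) \<Longrightarrow>
        \<rho> S (compose (carrier AA) f x) = compose ({..<r} \<times> {..<r}) f (\<rho> R x)"
    using rep unfolding representation_def by blast+
  interpret A: torus_point G act \<alpha> \<beta> m \<Lambda> e n crd emb encK encA AA by (rule torus_pointI[OF algebra_AA])
  interpret T: group "TT AA" by (rule A.TT_group)
  interpret GL: group "GL r AA" by (rule GL_group[OF A.S.M_cring])
  interpret h: group_hom "TT AA" "GL r AA" "\<rho> AA"
    by unfold_locales (rule hom[OF algebra_AA])
  have idc: "?id \<in> carrier (TT AA)" using id_point by simp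
  have at: "\<rho> R f (i, j) = f (M (i, j))" if R: "algebra kk R" and f: "f \<in> alg_hom kk AA R" and "i < r" "j < r" for R f i j
  proof -
    have "compose (carrier AA) f ?id = f"
      using f by (auto simp: compose_def alg_hom_def PiE_iff extensional_def fun_eq_iff)
    then show ?thesis using nat[OF algebra_AA R f idc] that by (simp add: M_def compose_def)
  qed
  have Mc: "M (i, j) \<in> encA ` A0" if "i < r" "j < r" for i j
  proof -
    have "M \<in> carrier (mat_monoid r AA)" unfolding M_def by (rule GL_carrier[OF h.hom_closed[OF idc]])
    from mat_entry[OF this that] show ?thesis by (simp only: AA_simps)
  qed
  define p where "p i j = inv_into UNIV encA (M (i, j))" for i j
  have p: "M (i, j) = encA (p i j)" "p i j \<in> A0" if "i < r" "j < r" for i j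
    using Mc[OF that] by (auto simp: p_def)
  define S where "S = (\<Union>i<r. \<Union>j<r. supp (p i j))"
  have finS: "finite S" by (simp add: S_def)
  have SL: "S \<subseteq> \<Lambda>" using p(2) by (auto simp: S_def A0_def)
  have SG: "g v \<in> S" if g: "g \<in> G" and v: "v \<in> S" for g v
  proof -
    obtain i j where ij: "i < r" "j < r" "v \<in> supp (p i j)" using v by (auto simp: S_def)
    then have "g v \<in> supp (p i j)"
      using p(2)[of i j] g by (auto simp: A0_def inv0_def in_keys_iff act_eq_0_iff)
    then show ?thesis using ij by (auto simp: S_def)
  qed
  have Sgen: "\<Lambda> \<subseteq> H" if H: "0 \<in> H" "\<forall>u\<in>H. \<forall>v\<in>H. u + v \<in> H" "\<forall>u\<in>H. - u \<in> H" "S \<subseteq> H" for H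
  proof
    let ?B = "{q \<in> A0. supp q \<subseteq> H}"
    define I where "I = inv\<^bsub>TT AA\<^esub> ?id"
    have I: "I \<in> alg_hom kk AA AA" using T.inv_closed[OF idc] by (simp add: I_def)
    have inv: "inv\<^bsub>GL r AA\<^esub> M = \<rho> AA I" unfolding I_def M_def by (rule h.hom_inv[OF idc, symmetric])
    have sB: "p i j \<in> ?B" if "i < r" "j < r" for i j using p(2)[OF that] that H(4) by (auto simp: S_def)
    have IB: "I (encA q) \<in> encA ` ?B" if q: "q \<in> ?B" for q
    proof -
      let ?q = "\<Sum>v\<in>supp q. \<tau> (\<theta> * cf q v) (- v)"
      have ql: "- v \<in> \<Lambda>" "v \<in> \<Lambda>" if "v \<in> supp q" for v using q that X_uminus by (auto simp: A0_def)
      have famI: "fam I v c = encA (\<tau> c (- v))" if "v \<in> \<Lambda>" for v c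
        unfolding I_def using A.TT_inv_fam[OF id_point that] fam_id[OF X_uminus[OF that]] by simp
      have "I (encA q) = (\<Oplus>\<^bsub>AA\<^esub>v\<in>supp q. ?id (encA (\<tau> (\<theta> * cf q v) (- v))))"
        using A.point_eq[OF I, of q] q ql
        by (simp add: famI \<tau>_A0 del: restrict_apply) (intro A.S.finsum_cong', auto simp: famI \<tau>_A0)
      also have "\<dots> = ?id (encA ?q)"
        using ql by (intro A.point_sum[OF _ id_point, symmetric]) (auto simp: \<tau>_A0)
      finally have 1: "I (encA q) = ?id (encA ?q)" .
      have qA: "?q \<in> A0" using ql by (intro A0_sum \<tau>_A0)
      have "supp ?q \<subseteq> H"
      proof
        fix y assume "y \<in> supp ?q"
        then obtain v where v: "v \<in> supp q" "y \<in> supp (\<tau> (\<theta> * cf q v) (- v))" using keys_sum[of "\<lambda>v. \<tau> (\<theta> * cf q v) (- v)" "supp q"] by blast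
        then obtain g where g: "g \<in> G" "y = - g v" using supp_\<tau>[of "\<theta> * cf q v" "- v"] by (auto simp: G_uminus)
        have "g v \<in> supp q" using q v(1) g(1) by (auto simp: A0_def inv0_def in_keys_iff act_eq_0_iff)
        then show "y \<in> H" using g q H(3) by auto
      qed
      then show ?thesis using 1 qA by auto
    qed
    have MB: "M ` ({..<r} \<times> {..<r}) \<union> (inv\<^bsub>GL r AA\<^esub> M) ` ({..<r} \<times> {..<r}) \<subseteq> encA ` ?B"
      unfolding inv using p(1) sB IB at[OF algebra_AA I] by auto
    have "x \<in> encA ` ?B" if "x \<in> carrier AA" for x
    proof -
      have "x \<in> generate_ring AA ({c \<odot>\<^bsub>AA\<^esub> \<one>\<^bsub>AA\<^esub> | c. c \<in> carrier kk} \<union> (M ` ({..<r} \<times> {..<r}) \<union> (inv\<^bsub>GL r AA\<^esub> M) ` ({..<r} \<times> {..<r})))"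
        using that gen by (simp add: generate_alg_def del: AA_simps)
      then show ?thesis
      proof (induction rule: generate_ring.induct)
        case one
        show ?case using H(1) by (auto simp: A0_closed)
      next
        case (incl x)
        then show ?case
        proof
          assume "x \<in> {c \<odot>\<^bsub>AA\<^esub> \<one>\<^bsub>AA\<^esub> | c. c \<in> carrier kk}"
          then obtain c where "c \<in> k0" "x = encA (mon 0 c * 1)" by auto
          moreover have "supp (mon 0 c * (1 :: 'v \<Rightarrow>\<^sub>0 'l)) \<subseteq> H" using H(1) by simp
          ultimately show ?thesis using A0_closed(6)[OF _ A0_closed(2)] by blast
        qed (use MB in blast)
      next
        case (a_inv x)
        then obtain q where q: "x = encA q" "q \<in> ?B" by blast
        have "encA (- q) \<oplus>\<^bsub>AA\<^esub> encA q = \<zero>\<^bsub>AA\<^esub>" by simp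
        then have "\<ominus>\<^bsub>AA\<^esub> encA q = encA (- q)" using q A0_closed(5)[of q] by (intro A.S.minus_equality) auto
        then show ?case using q by (auto simp: A0_closed)
      next
        case (eng_add x y)
        then obtain q q' where q: "x = encA q" "q \<in> ?B" "y = encA q'" "q' \<in> ?B" by blast
        then have "q + q' \<in> ?B" using Poly_Mapping.keys_add[of q q'] by (auto simp: A0_closed)
        then show ?case using q by auto
      next
        case (eng_mult x y)
        then obtain q q' where q: "x = encA q" "q \<in> ?B" "y = encA q'" "q' \<in> ?B" by blast
        have "supp (q * q') \<subseteq> H" using keys_mult[of q q'] q H(2) by blast
        then have "q * q' \<in> ?B" using q by (auto simp: A0_closed)
        then show ?case using q by auto
      qed
    qed
    note gB = this
    have B: "A0 \<subseteq> ?B"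
    proof
      fix q assume "q \<in> A0"
      then obtain q' where "encA q = encA q'" "q' \<in> ?B" using gB[of "encA q"] by auto
      then show "q \<in> ?B" by simp
    qed
    fix v assume v: "v \<in> \<Lambda>"
    have "v \<in> supp (\<tau> 1 v)" using \<tau>_coeff_1[of v] by (simp add: in_keys_iff)
    then show "v \<in> H" using B \<tau>_A0[OF v, of 1] by blast
  qed
  have "card S \<le> r"
  proof (rule card_orthogonal_idempotents[OF finS])
    interpret K: torus_point_K G act \<alpha> \<beta> m \<Lambda> e n crd emb encK encA KA
      by (rule torus_point_KI[OF algebra_KA])
    let ?C = "\<lambda>v i j. emb (cf (p i j) v)"
    have evp: "ev w (p i j) = (\<Sum>v\<in>S. ?C v i j * w v)" if "i < r" "j < r" for w i j
      using that by (intro ev_superset finS) (auto simp: S_def)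
    have mult: "ev (wt (\<lambda>j. u j * u' j)) (p i j) = (\<Sum>l<r. ev (wt u) (p i l) * ev (wt u') (p l j))"
      if u: "u \<in> TU" "u' \<in> TU" and ij: "i < r" "j < r" for u u' i j
    proof -
      have uu: "(\<lambda>j. u j * u' j) \<in> TU" using u by (auto simp: TU_def)
      obtain f where f: "f \<in> alg_hom kk AA KA" "\<forall>q\<in>A0. f (encA q) = encK (ev (wt u) q)" "\<forall>v\<in>\<Lambda>. K.chi f v = encK (wt u v)"
        using wt_point[OF u(1)] by blast
      obtain f' where f': "f' \<in> alg_hom kk AA KA" "\<forall>q\<in>A0. f' (encA q) = encK (ev (wt u') q)" "\<forall>v\<in>\<Lambda>. K.chi f' v = encK (wt u' v)"
        using wt_point[OF u(2)] by blast
      obtain f2 where f2: "f2 \<in> alg_hom kk AA KA" "\<forall>q\<in>A0. f2 (encA q) = encK (ev (wt (\<lambda>j. u j * u' j)) q)"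
          "\<forall>v\<in>\<Lambda>. K.chi f2 v = encK (wt (\<lambda>j. u j * u' j) v)"
        using wt_point[OF uu] by blast
      have "f2 = f \<otimes>\<^bsub>TT KA\<^esub> f'"
        using f f' f2 by (intro K.point_eq_chi) (auto simp: K.TT_mult K.chi_TT_mult wt_mult)
      then have "\<rho> KA f2 = \<rho> KA f \<otimes>\<^bsub>GL r KA\<^esub> \<rho> KA f'"
        using hom_mult[OF hom[OF K.alg_R]] f(1) f'(1) by simp
      then have "\<rho> KA f2 (i, j) = (\<Oplus>\<^bsub>KA\<^esub>l\<in>{..<r}. \<rho> KA f (i, l) \<otimes>\<^bsub>KA\<^esub> \<rho> KA f' (l, j))"
        using ij by (simp add: GL_mult mat_monoid_simps)
      also have "\<dots> = (\<Oplus>\<^bsub>KA\<^esub>l\<in>{..<r}. encK (ev (wt u) (p i l) * ev (wt u') (p l j)))"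
        using ij f f' by (intro K.S.finsum_cong') (auto simp: at[OF K.alg_R] p)
      also have "\<dots> = encK (\<Sum>l<r. ev (wt u) (p i l) * ev (wt u') (p l j))" by (simp add: finsum_KA)
      finally show ?thesis using ij f2 by (simp add: at[OF K.alg_R] p inj_eq[OF inj_encK])
    qed
    have step1: "?C v i j * wt u' v = (\<Sum>v'\<in>S. (\<Sum>l<r. ?C v i l * ?C v' l j) * wt u' v')"
      if v: "v \<in> S" and ij: "i < r" "j < r" and u': "u' \<in> TU" for v i j u'
    proof -
      have "?C v i j * wt u' v - (\<Sum>v'\<in>S. (\<Sum>l<r. ?C v i l * ?C v' l j) * wt u' v') = 0"
      proof (rule wt_independent[OF finS SL _ v, where a = "\<lambda>v. ?C v i j * wt u' v - (\<Sum>v'\<in>S. (\<Sum>l<r. ?C v i l * ?C v' l j) * wt u' v')"])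
        fix u assume u: "u \<in> TU"
        have "(\<Sum>v\<in>S. (\<Sum>v'\<in>S. (\<Sum>l<r. ?C v i l * ?C v' l j) * wt u' v') * wt u v)
            = (\<Sum>v\<in>S. \<Sum>v'\<in>S. \<Sum>l<r. (?C v i l * wt u v) * (?C v' l j * wt u' v'))"
          by (simp add: sum_distrib_right sum_distrib_left mult_ac)
        also have "\<dots> = (\<Sum>v\<in>S. \<Sum>l<r. \<Sum>v'\<in>S. (?C v i l * wt u v) * (?C v' l j * wt u' v'))"
          by (intro sum.cong refl sum.swap)
        also have "\<dots> = (\<Sum>l<r. \<Sum>v\<in>S. \<Sum>v'\<in>S. (?C v i l * wt u v) * (?C v' l j * wt u' v'))"
          by (rule sum.swap)
        also have "\<dots> = (\<Sum>l<r. ev (wt u) (p i l) * ev (wt u') (p l j))"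
          using ij by (simp add: evp sum_product)
        also have "\<dots> = (\<Sum>v\<in>S. ?C v i j * (wt u v * wt u' v))"
          using mult[OF u u' ij, symmetric] ij by (simp add: evp wt_mult)
        finally show "(\<Sum>v\<in>S. (?C v i j * wt u' v - (\<Sum>v'\<in>S. (\<Sum>l<r. ?C v i l * ?C v' l j) * wt u' v')) * wt u v) = 0"
          by (simp only: left_diff_distrib sum_subtractf) (simp add: mult_ac)
      qed
      then show ?thesis by simp
    qed
    show "(\<Sum>l<r. ?C v i l * ?C v' l j) = (if v = v' then ?C v i j else 0)"
      if v: "v \<in> S" "v' \<in> S" and ij: "i < r" "j < r" for v v' i j
    proof -
      have "(\<Sum>l<r. ?C v i l * ?C v' l j) - (if v = v' then ?C v i j else 0) = 0"
      proof (rule wt_independent[OF finS SL _ v(2), where a = "\<lambda>v'. (\<Sum>l<r. ?C v i l * ?C v' l j) - (if v = v' then ?C v i j else 0)"])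
        fix u assume "u \<in> TU"
        from step1[OF v(1) ij this]
        show "(\<Sum>v'\<in>S. ((\<Sum>l<r. ?C v i l * ?C v' l j) - (if v = v' then ?C v i j else 0)) * wt u v') = 0"
          using v(1) finS by (simp add: left_diff_distrib sum_subtractf if_distrib[of "\<lambda>x. x * _"] cong: if_cong)
      qed
      then show ?thesis by simp
    qed
    show "\<exists>i<r. \<exists>j<r. ?C v i j \<noteq> 0" if v: "v \<in> S" for v
    proof -
      obtain i j where ij: "i < r" "j < r" "cf (p i j) v \<noteq> 0" using v by (auto simp: S_def in_keys_iff)
      then have "?C v i j \<noteq> 0" using injD[OF emb_inj, of "cf (p i j) v" 0] by (auto simp: emb_0)
      then show ?thesis using ij by blast
    qed
  qed
  show ?thesis
  proof (intro exI[of _ S] conjI finS SL ballI allI impI \<open>card S \<le> r\<close>)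
    show "g v \<in> S" if "g \<in> G" "v \<in> S" for g v by (rule SG[OF that])
    show "\<Lambda> \<subseteq> H" if "0 \<in> H \<and> (\<forall>u\<in>H. \<forall>v\<in>H. u + v \<in> H) \<and> (\<forall>u\<in>H. - u \<in> H) \<and> S \<subseteq> H" for H
      using that Sgen by blast
  qed
qed

theorem rdim_ge:
  assumes n: "n > 0"
    and N: "\<And>S. finite S \<Longrightarrow> S \<subseteq> \<Lambda> \<Longrightarrow> (\<And>g v. g \<in> G \<Longrightarrow> v \<in> S \<Longrightarrow> g v \<in> S) \<Longrightarrow>
      (\<And>H. 0 \<in> H \<Longrightarrow> (\<And>u v. u \<in> H \<Longrightarrow> v \<in> H \<Longrightarrow> u + v \<in> H) \<Longrightarrow> (\<And>u. u \<in> H \<Longrightarrow> - u \<in> H) \<Longrightarrow> S \<subseteq> H \<Longrightarrow> \<Lambda> \<subseteq> H)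
      \<Longrightarrow> N \<le> card S"
  shows "N \<le> rdim kk AA TT"
proof -
  have "n * m > 0 \<and> (\<exists>\<rho>. faithful_embedding kk AA TT (n * m) \<rho>)" using n m_pos rho_faithful by auto
  then have "rdim kk AA TT > 0 \<and> (\<exists>\<rho>. faithful_embedding kk AA TT (rdim kk AA TT) \<rho>)"
    unfolding rdim_def by (rule LeastI)
  then obtain \<rho> where "faithful_embedding kk AA TT (rdim kk AA TT) \<rho>" by blast
  from faithful_weights[OF this] obtain S where S: "finite S" "S \<subseteq> \<Lambda>" "\<forall>g\<in>G. \<forall>v\<in>S. g v \<in> S"
    "\<forall>H. 0 \<in> H \<and> (\<forall>u\<in>H. \<forall>v\<in>H. u + v \<in> H) \<and> (\<forall>u\<in>H. - u \<in> H) \<and> S \<subseteq> H \<longrightarrow> \<Lambda> \<subseteq> H" "card S \<le> rdim kk AA TT"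
    by (elim exE conjE)
  have "N \<le> card S"
  proof (rule N[OF S(1,2)])
    show "g v \<in> S" if "g \<in> G" "v \<in> S" for g v using S(3) that by blast
    show "\<Lambda> \<subseteq> H" if "0 \<in> H" "\<And>u v. u \<in> H \<Longrightarrow> v \<in> H \<Longrightarrow> u + v \<in> H" "\<And>u. u \<in> H \<Longrightarrow> - u \<in> H" "S \<subseteq> H" for H
      using that by (intro S(4)[rule_format]) blast
  qed
  then show ?thesis using S(5) by simp
qed

end

lemma poly_map_poly_hom:
  fixes h :: "'x::comm_ring_1 \<Rightarrow> 'y::comm_ring_1"
  assumes h: "h 0 = 0" "\<And>x y. h (x + y) = h x + h y" "\<And>x y. h (x * y) = h x * h y"
  shows "poly (map_poly h p) (h x) = h (poly p x)"
  by (induction p) (auto simp: h map_poly_pCons)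

context galois_action
begin

text \<open>Lagrange interpolation at the conjugates of a primitive element yields dual bases.\<close>

lemma dual_bases_exist:
  assumes y: "\<And>g. g \<in> G \<Longrightarrow> act g y = y \<Longrightarrow> g = id"
  shows "\<exists>\<alpha> \<beta> m. galois_coords G act \<alpha> \<beta> m"
proof -
  have inj: "g = h" if "g \<in> G" "h \<in> G" "act g y = act h y" for g h
  proof -
    have "act (inv_into UNIV h \<circ> g) y = y"
      using that by (simp add: act_comp inv_G)
    then have "inv_into UNIV h \<circ> g = id" using that by (intro y comp_G inv_G)
    then have "h \<circ> (inv_into UNIV h \<circ> g) = h" by simp
    then show ?thesis using that by (simp add: comp_assoc[symmetric] comp_inv_G)
  qed
  define m where "m = card G"
  define f where "f = (\<Prod>g\<in>G - {id}. smult (inverse (y - act g y)) [:- act g y, 1:])"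
  have "Polynomial.degree f \<le> (\<Sum>g\<in>G - {id}. Polynomial.degree (smult (inverse (y - act g y)) [:- act g y, 1:]))"
    unfolding f_def by (rule degree_prod_sum_le[unfolded comp_def]) (simp add: finite_G)
  also have "\<dots> \<le> (\<Sum>g\<in>G - {id}. 1)" by (intro sum_mono) simp
  also have "\<dots> < m" using finite_G id_G by (simp add: m_def card_Diff_singleton card_G_pos)
  finally have deg: "Polynomial.degree f < m" .
  have val: "poly f (act h y) = (if h = id then 1 else 0)" if h: "h \<in> G" for h
  proof (cases "h = id")
    case True
    have "poly (smult (inverse (y - act g y)) [:- act g y, 1:]) y = 1" if "g \<in> G - {id}" for g
    proof -
      have "y - act g y \<noteq> 0" using y[of g] that by auto
      then have "inverse (y - act g y) * (y - act g y) = 1" by simp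
      moreover have "poly (smult c [:- a, 1:]) y = c * (y - a)" for c a by (simp add: algebra_simps)
      ultimately show ?thesis by (simp only:)
    qed
    then show ?thesis using True by (simp add: f_def poly_prod act_id del: poly_smult poly_pCons)
  next
    case False
    then have "h \<in> G - {id}" using h by auto
    then show ?thesis using False finite_G by (auto simp: f_def poly_prod intro!: prod_zero bexI[of _ h])
  qed
  have altdef: "poly p x = (\<Sum>i<m. Polynomial.coeff p i * x ^ i)" if "Polynomial.degree p < m" for p :: "'l poly" and x
  proof -
    have "(\<Sum>i\<le>Polynomial.degree p. Polynomial.coeff p i * x ^ i) = (\<Sum>i<m. Polynomial.coeff p i * x ^ i)"
      using that by (intro sum.mono_neutral_left) (auto simp: coeff_eq_0)
    then show ?thesis by (simp add: poly_altdef)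
  qed
  have "galois_coords G act (Polynomial.coeff f) (\<lambda>i. y ^ i) m"
  proof unfold_locales
    fix g assume g: "g \<in> G"
    show "(\<Sum>i<m. Polynomial.coeff f i * act g (y ^ i)) = (if g = id then 1 else 0)"
      using altdef[OF deg, of "act g y"] val[OF g] g by (simp add: act_power)
  next
    fix i j assume ij: "i < m" "j < m"
    define q where "q = (\<Sum>g\<in>G. smult (act g (y ^ i)) (map_poly (act g) f))"
    have cq: "Polynomial.coeff q l = Tr (y ^ i * Polynomial.coeff f l)" for l
      by (simp add: q_def coeff_sum coeff_map_poly act_0 Tr_def act_mult)
    have degq: "Polynomial.degree (q - Polynomial.monom 1 i) < m"
    proof -
      have "Polynomial.coeff (q - Polynomial.monom 1 i) l = 0" if "l \<ge> m" for l
      proof -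
        have "Polynomial.coeff f l = 0" using deg that by (intro coeff_eq_0) simp
        then show ?thesis using ij that by (simp add: cq Tr_0)
      qed
      then have "Polynomial.degree (q - Polynomial.monom 1 i) \<le> m - 1" by (intro degree_le) auto
      then show ?thesis using ij by simp
    qed
    have "poly (q - Polynomial.monom 1 i) (act h y) = 0" if h: "h \<in> G" for h
    proof -
      have "poly (map_poly (act g) f) (act h y) = (if g = h then 1 else 0)" if g: "g \<in> G" for g
      proof -
        let ?u = "inv_into UNIV g \<circ> h"
        have u: "?u \<in> G" using g h by (simp add: comp_G inv_G)
        have "poly (map_poly (act g) f) (act g (act ?u y)) = act g (poly f (act ?u y))"
          using g by (intro poly_map_poly_hom) (auto simp: act_0 act_add act_mult)
        moreover have "act g (act ?u y) = act h y" using g h by (simp add: act_comp inv_G)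
        moreover have "?u = id \<longleftrightarrow> g = h" using g h by (metis comp_assoc comp_inv_G comp_id id_comp)
        ultimately show ?thesis using val[OF u] g h by (simp add: act_0 act_1)
      qed
      then have "poly q (act h y) = (\<Sum>g\<in>G. if g = h then act g y ^ i else 0)"
        by (auto simp: q_def poly_sum act_power intro!: sum.cong)
      also have "\<dots> = act h y ^ i" using h finite_G by simp
      finally show ?thesis by (simp add: poly_monom)
    qed
    then have sub: "(\<lambda>h. act h y) ` G \<subseteq> {x. poly (q - Polynomial.monom 1 i) x = 0}" by auto
    have "q - Polynomial.monom 1 i = 0"
    proof (rule ccontr)
      assume nz: "q - Polynomial.monom 1 i \<noteq> 0"
      have "m = card ((\<lambda>h. act h y) ` G)" using inj by (simp add: m_def card_image inj_on_def)
      also have "\<dots> \<le> card {x. poly (q - Polynomial.monom 1 i) x = 0}" by (rule card_mono[OF poly_roots_finite[OF nz] sub])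
      also have "\<dots> \<le> Polynomial.degree (q - Polynomial.monom 1 i)" by (rule card_poly_roots_bound[OF nz])
      finally show False using degq by simp
    qed
    then have "Polynomial.coeff q j = Polynomial.coeff (Polynomial.monom 1 i) j" by simp
    then show "Tr (y ^ i * Polynomial.coeff f j) = (if i = j then 1 else 0)" by (simp add: cq)
  qed
  then show ?thesis by blast
qed

end

instance fract :: ("{idom, ring_char_0}") field_char_0
proof
  show "inj (of_nat :: nat \<Rightarrow> 'a fract)"
    by (rule injI) (simp add: of_nat_fract eq_fract)
qed

text \<open>The action of additive bijections on the field of fractions of the group algebra over the rationals.\<close>

definition mapk :: "('w \<Rightarrow> 'w) \<Rightarrow> ('w \<Rightarrow>\<^sub>0 rat) \<Rightarrow> 'w \<Rightarrow>\<^sub>0 rat" where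
  "mapk g p = (\<Sum>v\<in>supp p. mon (g v) (cf p v))"

definition actf :: "('w \<Rightarrow> 'w) \<Rightarrow> ('w::linordered_ab_group_add \<Rightarrow>\<^sub>0 rat) fract \<Rightarrow> ('w \<Rightarrow>\<^sub>0 rat) fract" where
  "actf g q = (SOME r. \<exists>a c. c \<noteq> 0 \<and> q = Fract a c \<and> r = Fract (mapk g a) (mapk g c))"

lemma mapk_superset: "finite W \<Longrightarrow> supp p \<subseteq> W \<Longrightarrow> mapk g p = (\<Sum>v\<in>W. mon (g v) (cf p v))"
  unfolding mapk_def by (rule sum.mono_neutral_left) (auto simp: in_keys_iff)

lemma mapk_mon: "mapk g (mon v c) = mon (g v) c"
  by (subst mapk_superset[of "{v}"]) auto

lemma mapk_add: "mapk g (p + q) = mapk g p + mapk g q"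
proof -
  let ?W = "supp p \<union> supp q"
  have "mapk g (p + q) = (\<Sum>v\<in>?W. mon (g v) (cf (p + q) v))"
    using Poly_Mapping.keys_add[of p q] by (intro mapk_superset) auto
  moreover have "mapk g p = (\<Sum>v\<in>?W. mon (g v) (cf p v))" "mapk g q = (\<Sum>v\<in>?W. mon (g v) (cf q v))"
    by (auto intro: mapk_superset)
  ultimately show ?thesis by (simp add: lookup_add single_add sum.distrib)
qed

lemma mapk_0: "mapk g 0 = 0" by (simp add: mapk_def)

lemma mapk_sum: "mapk g (sum f I) = (\<Sum>i\<in>I. mapk g (f i))"
  by (induction I rule: infinite_finite_induct) (auto simp: mapk_add mapk_0)

lemma mapk_mult:
  fixes p q :: "'w::comm_monoid_add \<Rightarrow>\<^sub>0 rat"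
  assumes "\<And>u v. g (u + v) = g u + g v" shows "mapk g (p * q) = mapk g p * mapk g q"
proof -
  have "p * q = (\<Sum>u\<in>supp p. \<Sum>v\<in>supp q. mon (u + v) (cf p u * cf q v))"
    using arg_cong2[OF sum_mon[of p] sum_mon[of q], of "(*)"] by (simp add: sum_product mult_single)
  then have "mapk g (p * q) = (\<Sum>u\<in>supp p. \<Sum>v\<in>supp q. mon (g u + g v) (cf p u * cf q v))"
    by (simp add: mapk_sum mapk_mon assms)
  also have "\<dots> = mapk g p * mapk g q" by (simp add: mapk_def sum_product mult_single)
  finally show ?thesis .
qed

lemma cf_mapk: "inj g \<Longrightarrow> cf (mapk g p) (g v) = cf p v"
proof -
  assume "inj g"
  then have "cf (mapk g p) (g v) = (\<Sum>u\<in>supp p. if u = v then cf p u else 0)"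
    by (auto simp: mapk_def lookup_sum lookup_single when_def inj_eq intro!: sum.cong)
  then show ?thesis by (auto simp: in_keys_iff)
qed

lemma mapk_eq_0: "inj g \<Longrightarrow> mapk g p = 0 \<longleftrightarrow> p = 0"
  using cf_mapk[of g p] by (auto simp: mapk_0 intro!: poly_mapping_eqI)

lemma mapk_comp: "mapk (g \<circ> h) p = mapk g (mapk h p)"
  by (simp add: mapk_def[of "g \<circ> h"] mapk_def[of h] mapk_sum mapk_mon)

lemma actf_Fract:
  assumes g: "inj g" "\<And>u v. g (u + v) = g u + g v" and c: "c \<noteq> 0"
  shows "actf g (Fract a c) = Fract (mapk g a) (mapk g c)"
  unfolding actf_def
proof (rule some_equality)
  fix r assume "\<exists>a' c'. c' \<noteq> 0 \<and> Fract a c = Fract a' c' \<and> r = Fract (mapk g a') (mapk g c')"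
  then obtain a' c' where ac: "c' \<noteq> 0" "Fract a c = Fract a' c'" "r = Fract (mapk g a') (mapk g c')" by blast
  have "a * c' = a' * c" using ac(1,2) c by (simp add: eq_fract)
  then have "mapk g a * mapk g c' = mapk g a' * mapk g c" using mapk_mult[of g] g(2) by metis
  then show "r = Fract (mapk g a) (mapk g c)" using ac c by (simp add: eq_fract mapk_eq_0[OF g(1)])
qed (use c in blast)

lemma galois_action_actf:
  fixes G :: "('w::linordered_ab_group_add \<Rightarrow> 'w) set"
  assumes "finite G" "id \<in> G" "\<And>g h. g \<in> G \<Longrightarrow> h \<in> G \<Longrightarrow> g \<circ> h \<in> G"
    "\<And>g. g \<in> G \<Longrightarrow> inv_into UNIV g \<in> G" "\<And>g. g \<in> G \<Longrightarrow> bij g" "\<And>g u v. g \<in> G \<Longrightarrow> g (u + v) = g u + g v"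
  shows "galois_action G (actf :: _ \<Rightarrow> ('w \<Rightarrow>\<^sub>0 rat) fract \<Rightarrow> _)"
proof unfold_locales
  have F: "actf g (Fract a c) = Fract (mapk g a) (mapk g c)" "mapk g c \<noteq> 0" "mapk g (a * d) = mapk g a * mapk g d"
    if "g \<in> G" "c \<noteq> 0" for g and a c d :: "'w \<Rightarrow>\<^sub>0 rat"
    using that assms(6)[OF that(1)] bij_is_inj[OF assms(5)[OF that(1)]] by (auto simp: actf_Fract mapk_eq_0 mapk_mult)
  fix g h :: "'w \<Rightarrow> 'w" and x y :: "('w \<Rightarrow>\<^sub>0 rat) fract" assume g: "g \<in> G"
  obtain a c a' c' where x: "x = Fract a c" "c \<noteq> 0" and y: "y = Fract a' c'" "c' \<noteq> 0"
    by (metis Fract_cases)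
  show "actf g (x + y) = actf g x + actf g y" "actf g (x * y) = actf g x * actf g y"
    using g x(2) y(2) unfolding x y by (simp_all add: F mapk_add)
  have "mapk g 1 = 1" using assms(6)[OF g, of 0 0] mapk_mon[of g 0 1] by simp
  then show "actf g 1 = 1" using F(1)[OF g, of 1 1] by (simp add: One_fract_def)
  show "actf (g \<circ> h) x = actf g (actf h x)" if h: "h \<in> G"
    using g h x(2) assms(3)[OF g h] unfolding x by (simp add: F mapk_comp)
next
  fix x :: "('w \<Rightarrow>\<^sub>0 rat) fract"
  obtain a c where x: "x = Fract a c" "c \<noteq> 0" by (metis Fract_cases)
  have "mapk id p = p" for p :: "'w \<Rightarrow>\<^sub>0 rat" by (simp add: mapk_def sum_mon)
  then show "actf id x = x" using x by (simp add: actf_Fract)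
qed (use assms in auto)

lemma primitive_element_actf:
  fixes G :: "('w::linordered_ab_group_add \<Rightarrow> 'w) set"
  assumes fin: "finite G" and bij: "\<And>g. g \<in> G \<Longrightarrow> bij g" and add: "\<And>g u v. g \<in> G \<Longrightarrow> g (u + v) = g u + g v"
  shows "\<exists>y :: ('w \<Rightarrow>\<^sub>0 rat) fract. \<forall>g\<in>G. actf g y = y \<longrightarrow> g = id"
proof -
  have "\<forall>g\<in>G - {id}. \<exists>v. g v \<noteq> v" by (auto simp: fun_eq_iff)
  then obtain V where V: "\<And>g. g \<in> G - {id} \<Longrightarrow> g (V g) \<noteq> V g" by metis
  define W where "W = V ` (G - {id})"
  have "finite W" using fin by (simp add: W_def)
  then obtain f :: "'w \<Rightarrow> nat" where f: "inj_on f W" using finite_imp_inj_to_nat_seg by metis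
  define p :: "'w \<Rightarrow>\<^sub>0 rat" where "p = (\<Sum>w\<in>W. mon w (of_nat (Suc (f w))))"
  have cfp: "cf p w = (if w \<in> W then of_nat (Suc (f w)) else 0)" for w
    using \<open>finite W\<close> by (simp add: p_def lookup_sum lookup_single when_def)
  have "g = id" if g: "g \<in> G" and eq: "actf g (Fract p 1) = Fract p 1" for g
  proof (rule ccontr)
    assume "g \<noteq> id"
    then have gW: "g \<in> G - {id}" using g by simp
    have i: "inj g" using bij[OF g] by (rule bij_is_inj)
    have "g 0 = 0" using add[OF g, of 0 0] by simp
    then have m1: "mapk g 1 = 1" using mapk_mon[of g 0 1] by simp
    have "mapk g p = p" using eq actf_Fract[OF i add[OF g], of 1 p] by (simp add: m1 eq_fract)
    then have "cf p (g (V g)) = cf p (V g)" using cf_mapk[OF i, of p "V g"] by simp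
    moreover have "V g \<in> W" using gW by (auto simp: W_def)
    ultimately have "g (V g) \<in> W \<and> f (g (V g)) = f (V g)" by (auto simp: cfp split: if_splits)
    then have "g (V g) = V g" using f \<open>V g \<in> W\<close> by (auto simp: inj_on_def)
    then show False using V[OF gW] by simp
  qed
  then show ?thesis by blast
qed

lemma countable_poly_mapping:
  assumes "countable (UNIV :: 'x set)" "countable (UNIV :: 'y set)"
  shows "countable (UNIV :: ('x \<Rightarrow>\<^sub>0 'y::zero) set)"
proof -
  let ?f = "\<lambda>p :: 'x \<Rightarrow>\<^sub>0 'y. (\<lambda>k. (k, cf p k)) ` supp p"
  have "inj ?f"
  proof (rule injI)
    fix p q :: "'x \<Rightarrow>\<^sub>0 'y" assume eq: "?f p = ?f q"
    have s: "supp r = fst ` ?f r" for r :: "'x \<Rightarrow>\<^sub>0 'y" by (auto simp: image_image)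
    have "supp p = supp q" using s[of p] s[of q] by (simp only: eq)
    moreover have "cf p k = cf q k" if "k \<in> supp p" for k
    proof -
      have "(k, cf p k) \<in> ?f q" using that eq by blast
      then show ?thesis by auto
    qed
    ultimately show "p = q" by (intro poly_mapping_eqI) (metis in_keys_iff)
  qed
  moreover have "countable (range ?f)"
  proof (rule countable_subset)
    show "range ?f \<subseteq> {A. finite A \<and> A \<subseteq> UNIV \<times> UNIV}" by auto
    show "countable {A :: ('x \<times> 'y) set. finite A \<and> A \<subseteq> UNIV \<times> UNIV}"
      by (rule countable_Collect_finite_subset[OF countable_SIGMA]) (use assms in auto)
  qed
  ultimately show ?thesis by (rule countable_image_inj_on[rotated])
qed

lemma countable_fract:
  assumes "countable (UNIV :: 'x::idom set)" shows "countable (UNIV :: 'x fract set)"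
proof -
  have "UNIV = (\<lambda>(a, c). Fract a c :: 'x fract) ` (UNIV \<times> UNIV)"
    by (auto simp: image_def) (metis Fract_cases)
  moreover have "countable ((\<lambda>(a, c). Fract a c :: 'x fract) ` (UNIV \<times> UNIV))"
    by (intro countable_image countable_SIGMA assms)
  ultimately show ?thesis by simp
qed

lemma countable_alg_closure:
  assumes "countable (UNIV :: 'x::field set)" shows "countable (UNIV :: 'x alg_closure set)"
proof -
  have "inj (coeffs :: 'x poly \<Rightarrow> 'x list)" by (auto simp: inj_def coeffs_eq_iff)
  moreover have "countable (range (coeffs :: 'x poly \<Rightarrow> 'x list))"
    by (rule countable_subset[OF _ countable_lists[OF assms]]) simp
  ultimately have cp: "countable (UNIV :: 'x poly set)" by (rule countable_image_inj_on[rotated])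
  have "UNIV = (\<Union>p\<in>{p :: 'x poly. p \<noteq> 0}. {x. poly (map_poly to_ac p) x = 0})"
    using alg_closure_algebraic by blast
  moreover have "countable (\<Union>p\<in>{p :: 'x poly. p \<noteq> 0}. {x. poly (map_poly to_ac p) x = 0})"
  proof (rule countable_UN)
    show "countable {p :: 'x poly. p \<noteq> 0}" using cp by (rule countable_subset[rotated]) simp
    fix p :: "'x poly" assume "p \<in> {p. p \<noteq> 0}"
    then have "map_poly to_ac p \<noteq> 0" by (auto simp: map_poly_eq_0_iff)
    then show "countable {x. poly (map_poly to_ac p) x = 0}" by (intro countable_finite poly_roots_finite)
  qed
  ultimately show ?thesis by simp
qed

lemma inj_into_infinite:
  assumes "countable (UNIV :: 'x set)" "infinite (UNIV :: 'a set)"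
  shows "\<exists>f :: 'x \<Rightarrow> 'a. inj f"
proof -
  obtain f :: "nat \<Rightarrow> 'a" where "inj f" using assms(2) infinite_countable_subset by blast
  then have "inj (f \<circ> to_nat_on (UNIV :: 'x set))"
    using inj_on_to_nat_on[OF assms(1)] by (intro inj_compose)
  then show ?thesis by blast
qed

theorem max_rdim_ge:
  fixes G :: "('w::linordered_ab_group_add \<Rightarrow> 'w) set" and \<Lambda> :: "'w set" and e :: "nat \<Rightarrow> 'w" and n :: nat and crd :: "nat \<Rightarrow> 'w \<Rightarrow> int"
  assumes inf: "infinite (UNIV :: 'a set)" and cw: "countable (UNIV :: 'w set)" and n: "n > 0"
    and G: "finite G" "id \<in> G" "\<And>g h. g \<in> G \<Longrightarrow> h \<in> G \<Longrightarrow> g \<circ> h \<in> G"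
    "\<And>g. g \<in> G \<Longrightarrow> inv_into UNIV g \<in> G" "\<And>g. g \<in> G \<Longrightarrow> bij g" "\<And>g u v. g \<in> G \<Longrightarrow> g (u + v) = g u + g v"
    and X: "0 \<in> \<Lambda>" "\<And>u v. u \<in> \<Lambda> \<Longrightarrow> v \<in> \<Lambda> \<Longrightarrow> u + v \<in> \<Lambda>" "\<And>u. u \<in> \<Lambda> \<Longrightarrow> - u \<in> \<Lambda>"
      "\<And>g u. g \<in> G \<Longrightarrow> u \<in> \<Lambda> \<Longrightarrow> g u \<in> \<Lambda>"
    and e: "\<And>j. j < n \<Longrightarrow> e j \<in> \<Lambda>"
      "\<And>H. 0 \<in> H \<Longrightarrow> (\<And>u v. u \<in> H \<Longrightarrow> v \<in> H \<Longrightarrow> u + v \<in> H) \<Longrightarrow> (\<And>u. u \<in> H \<Longrightarrow> - u \<in> H)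
        \<Longrightarrow> (\<And>j. j < n \<Longrightarrow> e j \<in> H) \<Longrightarrow> \<Lambda> \<subseteq> H"
    and crd: "\<And>j u v. j < n \<Longrightarrow> u \<in> \<Lambda> \<Longrightarrow> v \<in> \<Lambda> \<Longrightarrow> crd j (u + v) = crd j u + crd j v"
      "\<And>i j. i < n \<Longrightarrow> j < n \<Longrightarrow> crd j (e i) = (if i = j then 1 else 0)"
      "\<And>u v. u \<in> \<Lambda> \<Longrightarrow> v \<in> \<Lambda> \<Longrightarrow> (\<And>j. j < n \<Longrightarrow> crd j u = crd j v) \<Longrightarrow> u = v"
    and N: "\<And>S. finite S \<Longrightarrow> S \<subseteq> \<Lambda> \<Longrightarrow> (\<And>g v. g \<in> G \<Longrightarrow> v \<in> S \<Longrightarrow> g v \<in> S) \<Longrightarrow>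
      (\<And>H. 0 \<in> H \<Longrightarrow> (\<And>u v. u \<in> H \<Longrightarrow> v \<in> H \<Longrightarrow> u + v \<in> H) \<Longrightarrow> (\<And>u. u \<in> H \<Longrightarrow> - u \<in> H) \<Longrightarrow> S \<subseteq> H \<Longrightarrow> \<Lambda> \<subseteq> H)
      \<Longrightarrow> N \<le> card S"
  shows "max_rdim TYPE('a) n \<ge> enat N"
proof -
  let ?act = "actf :: _ \<Rightarrow> ('w \<Rightarrow>\<^sub>0 rat) fract \<Rightarrow> _"
  interpret ga: galois_action G ?act by (rule galois_action_actf[OF G])
  obtain y where "\<forall>g\<in>G. ?act g y = y \<longrightarrow> g = id" using primitive_element_actf[OF G(1,5,6)] by blast
  then obtain \<alpha> \<beta> m where gc: "galois_coords G ?act \<alpha> \<beta> m" using ga.dual_bases_exist by blast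
  have cL: "countable (UNIV :: ('w \<Rightarrow>\<^sub>0 rat) fract set)"
    by (intro countable_fract countable_poly_mapping cw) auto
  obtain encK :: "('w \<Rightarrow>\<^sub>0 rat) fract alg_closure \<Rightarrow> 'a" where iK: "inj encK"
    using inj_into_infinite[OF countable_alg_closure[OF cL] inf] by blast
  obtain encA :: "('w \<Rightarrow>\<^sub>0 ('w \<Rightarrow>\<^sub>0 rat) fract) \<Rightarrow> 'a" where iA: "inj encA"
    using inj_into_infinite[OF countable_poly_mapping[OF cw cL] inf] by blast
  interpret t: torus_sep G ?act \<alpha> \<beta> m \<Lambda> e n crd to_ac encK encA
  proof (intro torus_sep.intro torus_data.intro gc)
    show "torus_data_axioms G \<Lambda> e n crd to_ac encK encA"
      using X e crd iK iA by (unfold_locales; (simp; fail)?) 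
    show "torus_sep_axioms (to_ac :: ('w \<Rightarrow>\<^sub>0 rat) fract \<Rightarrow> _)"
    proof
      show "\<exists>x. poly p x = 0" if "Polynomial.degree p > 0" for p :: "('w \<Rightarrow>\<^sub>0 rat) fract alg_closure poly"
        using that by (rule alg_closed_imp_poly_has_root)
      show "\<exists>p. p \<noteq> 0 \<and> poly (map_poly to_ac p) x = 0" for x :: "('w \<Rightarrow>\<^sub>0 rat) fract alg_closure"
        using alg_closure_algebraic[of x] by blast
    qed
  qed
  have "N \<le> rdim t.kk t.AA t.TT"
  proof (rule t.rdim_ge[OF n])
    fix S
    assume S: "finite S" "S \<subseteq> \<Lambda>" "\<And>g v. g \<in> G \<Longrightarrow> v \<in> S \<Longrightarrow> g v \<in> S"
      "\<And>H. 0 \<in> H \<Longrightarrow> (\<And>u v. u \<in> H \<Longrightarrow> v \<in> H \<Longrightarrow> u + v \<in> H) \<Longrightarrow> (\<And>u. u \<in> H \<Longrightarrow> - u \<in> H) \<Longrightarrow> S \<subseteq> H \<Longrightarrow> \<Lambda> \<subseteq> H"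
    show "N \<le> card S" by (rule N) (fact S)+
  qed
  then have "enat N \<le> enat (rdim t.kk t.AA t.TT)" by simp
  also have "\<dots> \<le> max_rdim TYPE('a) n"
    unfolding max_rdim_def using t.TT_torus by (intro Sup_upper) blast
  finally show ?thesis .
qed

type_synonym qvec = "nat \<Rightarrow>\<^sub>0 rat"

definition scl :: "rat \<Rightarrow> qvec \<Rightarrow> qvec" where "scl r v = Poly_Mapping.map ((*) r) v"

lemma cf_scl [simp]: "cf (scl r v) i = r * cf v i"
  unfolding scl_def by (transfer fixing: r) (simp add: when_def)

lemma cf_add [simp]: "cf (u + v) i = cf u i + cf (v :: qvec) i" by (rule lookup_add)
lemma cf_diff [simp]: "cf (u - v) i = cf u i - cf (v :: qvec) i" by (rule lookup_minus)
lemma cf_sum: "cf (sum f I) i = (\<Sum>j\<in>I. cf (f j :: qvec) i)" by (rule lookup_sum)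
lemma cf_mon: "cf (mon j r :: qvec) i = (if i = j then r else 0)" by (simp add: lookup_single when_def)

lemma qvec_eqI: "(\<And>i. cf u i = cf v i) \<Longrightarrow> u = (v :: qvec)" by (rule poly_mapping_eqI)

definition ivec :: "nat \<Rightarrow> qvec set" where
  "ivec n = {v. (\<forall>i\<ge>n. cf v i = 0) \<and> (\<forall>i. cf v i \<in> \<int>)}"

definition zc :: "qvec \<Rightarrow> nat \<Rightarrow> int" where "zc v i = \<lfloor>cf v i\<rfloor>"

lemma cf_zc: "v \<in> ivec n \<Longrightarrow> cf v i = of_int (zc v i)"
  by (auto simp: ivec_def zc_def elim!: Ints_cases)

lemma zc_eqI: "cf v i = of_int k \<Longrightarrow> zc v i = k" by (simp add: zc_def)

lemma ivec_closed: "0 \<in> ivec n" "u \<in> ivec n \<Longrightarrow> v \<in> ivec n \<Longrightarrow> u + v \<in> ivec n"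
    "u \<in> ivec n \<Longrightarrow> - u \<in> ivec n"
  by (auto simp: ivec_def)

lemma zc_add: "u \<in> ivec n \<Longrightarrow> v \<in> ivec n \<Longrightarrow> zc (u + v) i = zc u i + zc v i"
  by (rule zc_eqI) (simp add: cf_zc[of _ n])

lemma zc_uminus: "u \<in> ivec n \<Longrightarrow> zc (- u) i = - zc u i"
  by (rule zc_eqI) (simp add: cf_zc[of _ n])

lemma zc_0: "zc 0 i = 0" by (simp add: zc_def)

definition qf :: "(nat \<Rightarrow> rat) \<Rightarrow> nat \<Rightarrow> qvec \<Rightarrow> rat" where
  "qf c n v = (\<Sum>i<n. c i * (cf v i)\<^sup>2)"

definition isoms :: "(nat \<Rightarrow> rat) \<Rightarrow> nat \<Rightarrow> qvec set \<Rightarrow> (qvec \<Rightarrow> qvec) set" where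
  "isoms c n \<Lambda> = {g. bij g \<and> (\<forall>u v. g (u + v) = g u + g v) \<and> (\<forall>r v. g (scl r v) = scl r (g v)) \<and>
     g ` \<Lambda> = \<Lambda> \<and> (\<forall>v. (\<forall>i<n. cf v i = 0) \<longrightarrow> g v = v) \<and> (\<forall>v\<in>\<Lambda>. qf c n (g v) = qf c n v)}"

lemma isomsD:
  assumes "g \<in> isoms c n \<Lambda>"
  shows "bij g" "g (u + v) = g u + g v" "g (scl r v) = scl r (g v)" "g ` \<Lambda> = \<Lambda>"
    "(\<And>i. i < n \<Longrightarrow> cf v i = 0) \<Longrightarrow> g v = v" "v \<in> \<Lambda> \<Longrightarrow> qf c n (g v) = qf c n v"
  using assms by (auto simp: isoms_def)

lemma isoms_id: "id \<in> isoms c n \<Lambda>" by (simp add: isoms_def)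

lemma isoms_comp:
  assumes g: "g \<in> isoms c n \<Lambda>" and h: "h \<in> isoms c n \<Lambda>" shows "g \<circ> h \<in> isoms c n \<Lambda>"
proof -
  have "h v \<in> \<Lambda>" if "v \<in> \<Lambda>" for v using isomsD(4)[OF h] that by blast
  moreover have "bij (g \<circ> h)" using isomsD(1)[OF h] isomsD(1)[OF g] by (rule bij_comp)
  moreover have "(g \<circ> h) ` \<Lambda> = \<Lambda>" by (simp only: image_comp[symmetric] isomsD(4)[OF g] isomsD(4)[OF h])
  ultimately show ?thesis
    unfolding isoms_def mem_Collect_eq
    by (intro conjI) (auto simp: isomsD(2,3,5,6)[OF g] isomsD(2,3,5,6)[OF h])
qed

lemma isoms_inv:
  assumes g: "g \<in> isoms c n \<Lambda>" shows "inv_into UNIV g \<in> isoms c n \<Lambda>"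
proof -
  let ?h = "inv_into UNIV g"
  have hg: "?h (g v) = v" "g (?h v) = v" for v
    using isomsD(1)[OF g] by (simp_all add: bij_is_inj bij_is_surj surj_f_inv_f)
  have "?h (u + v) = ?h u + ?h v" for u v
    using hg isomsD(2)[OF g, of "?h u" "?h v"] by metis
  moreover have "?h (scl r v) = scl r (?h v)" for r v
    using hg isomsD(3)[OF g, of r "?h v"] by metis
  moreover have im: "?h ` \<Lambda> = \<Lambda>"
  proof -
    have "?h ` (g ` \<Lambda>) = \<Lambda>" by (simp add: image_image hg)
    then show ?thesis using isomsD(4)[OF g] by simp
  qed
  moreover have "?h v = v" if "\<forall>i<n. cf v i = 0" for v
    using hg(1)[of v] isomsD(5)[OF g, of v] that by simp
  moreover have "qf c n (?h v) = qf c n v" if "v \<in> \<Lambda>" for v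
  proof -
    have "?h v \<in> \<Lambda>" using im that by blast
    then show ?thesis using isomsD(6)[OF g, of "?h v"] hg(2)[of v] by simp
  qed
  moreover have "bij ?h" using isomsD(1)[OF g] by (rule bij_imp_bij_inv)
  ultimately show ?thesis unfolding isoms_def by blast
qed

lemma finite_short_vectors:
  assumes c: "\<And>i. i < n \<Longrightarrow> c i \<ge> 1" shows "finite {v \<in> ivec n. qf c n v \<le> of_nat B}"
proof -
  let ?f = "\<lambda>v. \<lambda>i\<in>{..<n}. zc v i"
  have "?f ` {v \<in> ivec n. qf c n v \<le> of_nat B} \<subseteq> {..<n} \<rightarrow>\<^sub>E {- int B..int B}"
  proof (rule image_subsetI)
    fix v assume v: "v \<in> {v \<in> ivec n. qf c n v \<le> of_nat B}"
    have "zc v i \<in> {- int B..int B}" if i: "i < n" for i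
    proof -
      have c0: "c j \<ge> 0" if "j < n" for j using c[OF that] by simp
      have "(cf v i)\<^sup>2 \<le> c i * (cf v i)\<^sup>2" using c[OF i] by (simp add: mult_le_cancel_right1)
      also have "\<dots> \<le> qf c n v"
        unfolding qf_def using i c0 by (intro member_le_sum[of i "{..<n}" "\<lambda>i. c i * (cf v i)\<^sup>2"]) auto
      also have "\<dots> \<le> of_nat B" using v by simp
      finally have "of_int ((zc v i)\<^sup>2) \<le> (of_int (int B) :: rat)" using v by (simp add: cf_zc[of v n])
      then have "(zc v i)\<^sup>2 \<le> int B" by (simp only: of_int_le_iff)
      moreover have "\<bar>zc v i\<bar> \<le> (zc v i)\<^sup>2"
        using self_le_power[of "\<bar>zc v i\<bar>" 2] by (cases "zc v i = 0") auto
      ultimately show ?thesis by auto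
    qed
    then show "?f v \<in> {..<n} \<rightarrow>\<^sub>E {- int B..int B}" by auto
  qed
  then have "finite (?f ` {v \<in> ivec n. qf c n v \<le> of_nat B})"
    by (rule finite_subset) (auto intro: finite_PiE)
  moreover have "inj_on ?f {v \<in> ivec n. qf c n v \<le> of_nat B}"
  proof (rule inj_onI)
    fix u v assume u: "u \<in> {v \<in> ivec n. qf c n v \<le> of_nat B}" and v: "v \<in> {v \<in> ivec n. qf c n v \<le> of_nat B}"
      and eq: "?f u = ?f v"
    show "u = v"
    proof (rule qvec_eqI)
      fix i show "cf u i = cf v i"
      proof (cases "i < n")
        case True then show ?thesis using fun_cong[OF eq, of i] u v by (simp add: cf_zc[of _ n])
      next
        case False then show ?thesis using u v by (simp add: ivec_def)
      qed
    qed
  qed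
  ultimately show ?thesis by (rule finite_imageD)
qed

lemma isoms_finite:
  assumes c: "\<And>i. i < n \<Longrightarrow> c i \<ge> 1" and iv: "\<Lambda> \<subseteq> ivec n" and four: "\<And>i. i < n \<Longrightarrow> mon i 4 \<in> \<Lambda>"
  shows "finite (isoms c n \<Lambda>)"
proof -
  let ?F = "\<lambda>g. \<lambda>i\<in>{..<n}. g (mon i 4)"
  obtain B :: nat where B: "\<And>i. i < n \<Longrightarrow> qf c n (mon i 4) \<le> of_nat B"
  proof -
    have "\<exists>B :: nat. \<forall>i<n. qf c n (mon i 4) \<le> of_nat B"
    proof -
      have "\<forall>i. \<exists>B :: nat. qf c n (mon i 4) \<le> of_nat B" using real_arch_simple by blast
      then obtain B where B: "\<And>i. qf c n (mon i 4) \<le> of_nat (B i)" by metis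
      have "qf c n (mon i 4) \<le> of_nat (\<Sum>i<n. B i)" if "i < n" for i
      proof -
        have "B i \<le> (\<Sum>i<n. B i)" using that by (intro member_le_sum) auto
        then have "(of_nat (B i) :: rat) \<le> of_nat (\<Sum>i<n. B i)" by (simp only: of_nat_le_iff)
        then show ?thesis using B[of i] by simp
      qed
      then show ?thesis by blast
    qed
    then show ?thesis using that by blast
  qed
  have "?F ` isoms c n \<Lambda> \<subseteq> {..<n} \<rightarrow>\<^sub>E {v \<in> ivec n. qf c n v \<le> of_nat B}"
  proof (rule image_subsetI)
    fix g assume g: "g \<in> isoms c n \<Lambda>"
    have "g (mon i 4) \<in> {v \<in> ivec n. qf c n v \<le> of_nat B}" if "i < n" for i
    proof -
      have "g (mon i 4) \<in> \<Lambda>" using isomsD(4)[OF g] four[OF that] by blast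
      then show ?thesis using iv B[OF that] isomsD(6)[OF g four[OF that]] by auto
    qed
    then show "?F g \<in> {..<n} \<rightarrow>\<^sub>E {v \<in> ivec n. qf c n v \<le> of_nat B}" by auto
  qed
  then have "finite (?F ` isoms c n \<Lambda>)"
    by (rule finite_subset) (auto intro!: finite_PiE finite_short_vectors c)
  moreover have "inj_on ?F (isoms c n \<Lambda>)"
  proof (rule inj_onI)
    fix g h assume g: "g \<in> isoms c n \<Lambda>" and h: "h \<in> isoms c n \<Lambda>" and eq: "?F g = ?F h"
    have m: "g (mon i r) = h (mon i r)" for i r
    proof (cases "i < n")
      case True
      then have "g (mon i 4) = h (mon i 4)" using fun_cong[OF eq, of i] by simp
      moreover have "mon i r = scl (r / 4) (mon i 4)" by (rule qvec_eqI) (simp add: cf_mon)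
      ultimately show ?thesis using isomsD(3)[OF g] isomsD(3)[OF h] by simp
    next
      case False
      then show ?thesis using isomsD(5)[OF g, of "mon i r"] isomsD(5)[OF h, of "mon i r"] by (simp add: cf_mon)
    qed
    have z: "g 0 = 0" "h 0 = 0" using isomsD(2)[OF g, of 0 0] isomsD(2)[OF h, of 0 0] by auto
    have s: "g (sum f I) = (\<Sum>i\<in>I. g (f i))" "h (sum f I) = (\<Sum>i\<in>I. h (f i))" for f :: "nat \<Rightarrow> qvec" and I
      by (induction I rule: infinite_finite_induct) (auto simp: z isomsD(2)[OF g] isomsD(2)[OF h])
    show "g = h"
    proof
      fix v show "g v = h v" using s[of "\<lambda>i. mon i (cf v i)" "supp v"] m by (simp add: sum_mon)
    qed
  qed
  ultimately show ?thesis by (rule finite_imageD)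
qed

lemma isoms_involution:
  assumes lin: "\<And>u v. g (u + v) = g u + g v" "\<And>r v. g (scl r v) = scl r (g v)" and inv: "\<And>v. g (g v) = v"
    and L: "\<And>v. v \<in> \<Lambda> \<Longrightarrow> g v \<in> \<Lambda>" and fix': "\<And>v. (\<And>i. i < n \<Longrightarrow> cf v i = 0) \<Longrightarrow> g v = v"
    and q: "\<And>v. v \<in> \<Lambda> \<Longrightarrow> qf c n (g v) = qf c n v"
  shows "g \<in> isoms c n \<Lambda>"
proof -
  have "bij g" by (rule involuntory_imp_bij) (rule inv)
  moreover have "g ` \<Lambda> = \<Lambda>" using L inv by (metis image_subsetI image_eqI subsetI subset_antisym)
  ultimately show ?thesis using assms by (simp add: isoms_def)
qed

theorem lattice_max_rdim_ge:
  fixes e :: "nat \<Rightarrow> qvec" and L :: "nat \<Rightarrow> qvec \<Rightarrow> rat"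
  assumes inf: "infinite (UNIV :: 'a set)" and n: "n > 0" and c: "\<And>i. i < n \<Longrightarrow> c i \<ge> 1"
    and iv: "\<Lambda> \<subseteq> ivec n" and four: "\<And>i. i < n \<Longrightarrow> mon i 4 \<in> \<Lambda>"
    and X: "\<And>u v. u \<in> \<Lambda> \<Longrightarrow> v \<in> \<Lambda> \<Longrightarrow> u + v \<in> \<Lambda>" "\<And>u. u \<in> \<Lambda> \<Longrightarrow> - u \<in> \<Lambda>"
    and e: "\<And>j. j < n \<Longrightarrow> e j \<in> \<Lambda>"
    and L: "\<And>j u v. j < n \<Longrightarrow> L j (u + v) = L j u + L j v" "\<And>j u. j < n \<Longrightarrow> u \<in> \<Lambda> \<Longrightarrow> L j u \<in> \<int>"
      "\<And>i j. i < n \<Longrightarrow> j < n \<Longrightarrow> L j (e i) = (if i = j then 1 else 0)"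
      "\<And>v. v \<in> \<Lambda> \<Longrightarrow> v = (\<Sum>j<n. scl (L j v) (e j))"
    and N: "\<And>S. finite S \<Longrightarrow> S \<subseteq> \<Lambda> \<Longrightarrow> (\<And>g v. g \<in> isoms c n \<Lambda> \<Longrightarrow> v \<in> S \<Longrightarrow> g v \<in> S) \<Longrightarrow>
      (\<And>H. 0 \<in> H \<Longrightarrow> (\<And>u v. u \<in> H \<Longrightarrow> v \<in> H \<Longrightarrow> u + v \<in> H) \<Longrightarrow> (\<And>u. u \<in> H \<Longrightarrow> - u \<in> H) \<Longrightarrow> S \<subseteq> H \<Longrightarrow> \<Lambda> \<subseteq> H)
      \<Longrightarrow> N \<le> card S"
  shows "max_rdim TYPE('a) n \<ge> enat N"
proof (rule max_rdim_ge[OF inf _ n, where G = "isoms c n \<Lambda>" and \<Lambda> = \<Lambda> and e = e and crd = "\<lambda>j v. \<lfloor>L j v\<rfloor>"])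
  show "countable (UNIV :: qvec set)" by (rule countable_poly_mapping) auto
  show "finite (isoms c n \<Lambda>)" by (rule isoms_finite[OF c iv four])
  show "0 \<in> \<Lambda>" using X(1)[OF e[OF n] X(2)[OF e[OF n]]] by simp
  show "g u \<in> \<Lambda>" if "g \<in> isoms c n \<Lambda>" "u \<in> \<Lambda>" for g u using isomsD(4)[OF that(1)] that(2) by blast
  show "\<lfloor>L j (u + v)\<rfloor> = \<lfloor>L j u\<rfloor> + \<lfloor>L j v\<rfloor>" if "j < n" "u \<in> \<Lambda>" "v \<in> \<Lambda>" for j u v
    using L(1)[OF that(1), of u v] L(2)[OF that(1,2)] by (auto elim!: Ints_cases)
  show "\<lfloor>L j (e i)\<rfloor> = (if i = j then 1 else 0)" if "i < n" "j < n" for i j using L(3)[OF that] by simp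
  show "u = v" if uv: "u \<in> \<Lambda>" "v \<in> \<Lambda>" and eq: "\<And>j. j < n \<Longrightarrow> \<lfloor>L j u\<rfloor> = \<lfloor>L j v\<rfloor>" for u v
  proof -
    have "L j u = L j v" if j: "j < n" for j
      using eq[OF j] L(2)[OF j uv(1)] L(2)[OF j uv(2)] by (auto elim!: Ints_cases)
    then have "(\<Sum>j<n. scl (L j u) (e j)) = (\<Sum>j<n. scl (L j v) (e j))" by simp
    then show ?thesis using L(4)[OF uv(1)] L(4)[OF uv(2)] by simp
  qed
  show "\<Lambda> \<subseteq> H" if H: "0 \<in> H" "\<And>u v. u \<in> H \<Longrightarrow> v \<in> H \<Longrightarrow> u + v \<in> H" "\<And>u. u \<in> H \<Longrightarrow> - u \<in> H"
    "\<And>j. j < n \<Longrightarrow> e j \<in> H" for H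
  proof
    fix v assume v: "v \<in> \<Lambda>"
    have nat: "scl (of_nat k) x \<in> H" if "x \<in> H" for k x
    proof (induction k)
      case 0 have "scl (of_nat 0) x = 0" by (rule qvec_eqI) simp
      then show ?case using H(1) by simp
    next
      case (Suc k)
      have "scl (of_nat (Suc k)) x = scl (of_nat k) x + x" by (rule qvec_eqI) (simp add: algebra_simps)
      then show ?case using H(2) Suc that by simp
    qed
    have int: "scl (of_int k) x \<in> H" if "x \<in> H" for k x
    proof (cases k)
      case (nonneg i) then show ?thesis using nat[OF that, of i] by simp
    next
      case (neg i)
      have k: "(of_int k :: rat) = - (1 + of_nat i)" using neg by simp
      have "scl (of_int k) x = - scl (of_nat (Suc i)) x" unfolding k by (intro qvec_eqI) (simp add: algebra_simps)
      then show ?thesis by (simp only: H(3)[OF nat[OF that]])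
    qed
    have t: "scl (L j v) (e j) \<in> H" if j: "j < n" for j
    proof -
      obtain k where "L j v = of_int k" using L(2)[OF j v] by (elim Ints_cases)
      then show ?thesis using int[OF H(4)[OF j], of k] by simp
    qed
    have "(\<Sum>j\<in>I. scl (L j v) (e j)) \<in> H" if "finite I" "I \<subseteq> {..<n}" for I
      using that by (induction I rule: finite_induct) (auto simp: H t)
    then have "(\<Sum>j<n. scl (L j v) (e j)) \<in> H" by simp
    then show "v \<in> H" using L(4)[OF v] by simp
  qed
  show "N \<le> card S" if S: "finite S" "S \<subseteq> \<Lambda>" "\<And>g v. g \<in> isoms c n \<Lambda> \<Longrightarrow> v \<in> S \<Longrightarrow> g v \<in> S"
      "\<And>H. 0 \<in> H \<Longrightarrow> (\<And>u v. u \<in> H \<Longrightarrow> v \<in> H \<Longrightarrow> u + v \<in> H) \<Longrightarrow> (\<And>u. u \<in> H \<Longrightarrow> - u \<in> H) \<Longrightarrow> S \<subseteq> H \<Longrightarrow> \<Lambda> \<subseteq> H" for S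
    by (rule N) (fact S)+
qed (fact X e isoms_id isoms_comp isoms_inv isomsD(1) isomsD(2))+

definition flip :: "nat set \<Rightarrow> qvec \<Rightarrow> qvec" where
  "flip J v = v - scl 2 (\<Sum>i\<in>J. mon i (cf v i))"

definition tau :: "nat \<Rightarrow> nat \<Rightarrow> nat \<Rightarrow> nat" where
  "tau a d i = (if i = a then d else if i = d then a else i)"

definition swp :: "nat \<Rightarrow> nat \<Rightarrow> qvec \<Rightarrow> qvec" where
  "swp a d v = v + (mon a (cf v d - cf v a) + mon d (cf v a - cf v d))"

definition ones :: "nat \<Rightarrow> qvec" where "ones n = (\<Sum>i<n. mon i 1)"

definition refl1 :: "(nat \<Rightarrow> rat) \<Rightarrow> nat \<Rightarrow> qvec \<Rightarrow> qvec" where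
  "refl1 c n v = v - scl (2 * (\<Sum>i<n. c i * cf v i) / (\<Sum>i<n. c i)) (ones n)"

lemma cf_flip: "finite J \<Longrightarrow> cf (flip J v) i = (if i \<in> J then - cf v i else cf v i)"
  by (simp add: flip_def cf_sum cf_mon)

lemma cf_swp: "cf (swp a d v) i = cf v (tau a d i)"
  by (simp add: swp_def cf_mon tau_def)

lemma cf_ones: "cf (ones n) i = (if i < n then 1 else 0)"
  by (simp add: ones_def cf_sum cf_mon)

lemma flip_isom:
  assumes J: "J \<subseteq> {..<n}" and L: "\<And>v. v \<in> \<Lambda> \<Longrightarrow> flip J v \<in> \<Lambda>"
  shows "flip J \<in> isoms c n \<Lambda>"
proof -
  have fin: "finite J" using J finite_subset by blast
  show ?thesis
  proof (rule isoms_involution[OF _ _ _ L])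
    show "qf c n (flip J v) = qf c n v" for v
      unfolding qf_def by (intro sum.cong) (auto simp: cf_flip fin)
  qed (use J in \<open>auto simp: cf_flip fin intro!: qvec_eqI\<close>)
qed

lemma swp_isom:
  assumes ab: "a < n" "d < n" "c a = c d" and L: "\<And>v. v \<in> \<Lambda> \<Longrightarrow> swp a d v \<in> \<Lambda>"
  shows "swp a d \<in> isoms c n \<Lambda>"
proof (rule isoms_involution[OF _ _ _ L])
  have bij: "bij_betw (tau a d) {..<n} {..<n}"
    using ab by (intro bij_betwI[where g = "tau a d"]) (auto simp: tau_def)
  show "qf c n (swp a d v) = qf c n v" for v
  proof -
    have "qf c n (swp a d v) = (\<Sum>i<n. c (tau a d i) * (cf v (tau a d i))\<^sup>2)"
      unfolding qf_def using ab by (intro sum.cong) (auto simp: cf_swp tau_def)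
    also have "\<dots> = qf c n v" unfolding qf_def by (rule sum.reindex_bij_betw[OF bij])
    finally show ?thesis .
  qed
qed (use ab in \<open>auto simp: cf_swp tau_def intro!: qvec_eqI\<close>)

lemma refl1_isom:
  assumes C: "(\<Sum>i<n. c i) \<noteq> 0" and L: "\<And>v. v \<in> \<Lambda> \<Longrightarrow> refl1 c n v \<in> \<Lambda>"
  shows "refl1 c n \<in> isoms c n \<Lambda>"
proof (rule isoms_involution[OF _ _ _ L])
  let ?C = "\<Sum>i<n. c i" and ?T = "\<lambda>v. \<Sum>i<n. c i * cf v i"
  have cfr: "cf (refl1 c n v) i = (if i < n then cf v i - 2 * ?T v / ?C else cf v i)" for v i
    by (simp add: refl1_def cf_ones)
  have T: "?T (u + v) = ?T u + ?T v" "?T (scl r v) = r * ?T v" for u v r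
    by (simp_all add: distrib_left sum.distrib sum_distrib_left mult_ac)
  show "refl1 c n (u + v) = refl1 c n u + refl1 c n v" for u v
    by (rule qvec_eqI, subst cf_add, simp only: cfr, simp only: T, simp add: add_divide_distrib distrib_left)
  show "refl1 c n (scl r v) = scl r (refl1 c n v)" for r v
    by (rule qvec_eqI, subst cf_scl, simp only: cfr, simp only: T, simp add: algebra_simps)
  have Tr: "?T (refl1 c n v) = - ?T v" for v
  proof -
    have "?T (refl1 c n v) = (\<Sum>i<n. c i * cf v i - c i * (2 * ?T v / ?C))"
      by (intro sum.cong) (auto simp: cfr algebra_simps)
    also have "\<dots> = ?T v - ?C * (2 * ?T v / ?C)" by (simp only: sum_subtractf sum_distrib_right)
    also have "\<dots> = - ?T v" using C by simp
    finally show ?thesis .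
  qed
  show "refl1 c n (refl1 c n v) = v" for v
    by (rule qvec_eqI) (simp add: cfr[of "refl1 c n v"] Tr, simp add: cfr)
  show "refl1 c n v = v" if "\<And>i. i < n \<Longrightarrow> cf v i = 0" for v
    by (rule qvec_eqI) (simp add: cfr that)
  show "qf c n (refl1 c n v) = qf c n v" for v
  proof -
    define t where "t = 2 * ?T v / ?C"
    have "qf c n (refl1 c n v) = (\<Sum>i<n. c i * (cf v i)\<^sup>2 - 2 * t * (c i * cf v i) + t\<^sup>2 * c i)"
      unfolding qf_def by (intro sum.cong) (auto simp: cfr t_def[symmetric] power2_eq_square algebra_simps)
    also have "\<dots> = qf c n v - 2 * t * ?T v + t\<^sup>2 * ?C"
      by (simp only: sum.distrib sum_subtractf sum_distrib_left qf_def)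
    also have "\<dots> = qf c n v" using C by (simp add: t_def power2_eq_square)
    finally show ?thesis .
  qed
qed

lemma zc_flip: "finite J \<Longrightarrow> v \<in> ivec n \<Longrightarrow> zc (flip J v) i = (if i \<in> J then - zc v i else zc v i)"
  by (rule zc_eqI) (simp add: cf_flip cf_zc[of v n])

lemma zc_swp: "v \<in> ivec n \<Longrightarrow> zc (swp a d v) i = zc v (tau a d i)"
  by (rule zc_eqI) (simp add: cf_swp cf_zc[of v n])

lemma ivec_flip: "J \<subseteq> {..<n} \<Longrightarrow> v \<in> ivec n \<Longrightarrow> flip J v \<in> ivec n"
  using finite_subset[of J "{..<n}"] by (auto simp: ivec_def cf_flip)

lemma ivec_swp: "a < n \<Longrightarrow> d < n \<Longrightarrow> v \<in> ivec n \<Longrightarrow> swp a d v \<in> ivec n"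
  by (auto simp: ivec_def cf_swp tau_def)

definition pats :: "nat \<Rightarrow> nat \<Rightarrow> (nat set \<times> nat set) set" where
  "pats n w = (SIGMA P:{P. P \<subseteq> {..<n} \<and> card P = w}. Pow P)"

lemma card_pats: "card (pats n w) = (n choose w) * 2 ^ w"
proof -
  have fin: "finite {P. P \<subseteq> {..<n} \<and> card P = w}" by (rule finite_subset[of _ "Pow {..<n}"]) auto
  have "card (pats n w) = (\<Sum>P\<in>{P. P \<subseteq> {..<n} \<and> card P = w}. card (Pow P))"
    unfolding pats_def using fin by (intro card_SigmaI) (auto intro: finite_subset)
  also have "\<dots> = (\<Sum>P\<in>{P. P \<subseteq> {..<n} \<and> card P = w}. 2 ^ w)"
    by (intro sum.cong) (auto simp: card_Pow dest: finite_subset)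
  also have "\<dots> = (n choose w) * 2 ^ w" using n_subsets[of "{..<n}" w] by simp
  finally show ?thesis .
qed

lemma pats_disjoint: "w \<noteq> w' \<Longrightarrow> pats n w \<inter> pats n w' = {}"
  by (auto simp: pats_def)

lemma finite_pats: "finite (pats n w)"
  unfolding pats_def by (rule finite_SigmaI) (auto intro: finite_subset)

lemma pats_subset:
  assumes T: "(P, I) \<in> T" and P: "P \<subseteq> {..<n}" and I: "I \<subseteq> P"
    and tog: "\<And>P I i. (P, I) \<in> T \<Longrightarrow> i \<in> P \<Longrightarrow> P \<subseteq> {..<n} \<Longrightarrow> I \<subseteq> P \<Longrightarrow> (P, if i \<in> I then I - {i} else insert i I) \<in> T"
    and swap: "\<And>P a d. (P, {}) \<in> T \<Longrightarrow> P \<subseteq> {..<n} \<Longrightarrow> a \<in> P \<Longrightarrow> d \<notin> P \<Longrightarrow> d < n \<Longrightarrow> (insert d (P - {a}), {}) \<in> T"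
  shows "pats n (card P) \<subseteq> T"
proof -
  have clear: "(P, {}) \<in> T" if "(P, I) \<in> T" "P \<subseteq> {..<n}" "I \<subseteq> P" for P I
  proof -
    have "finite I" using that finite_subset by (metis finite_lessThan)
    then show ?thesis using that
    proof (induction I rule: finite_induct)
      case (insert i I)
      then show ?case using tog[of P "insert i I" i] by auto
    qed auto
  qed
  have fill: "(P, I) \<in> T" if "(P, {}) \<in> T" "P \<subseteq> {..<n}" "I \<subseteq> P" for P I
  proof -
    have "finite I" using that finite_subset by (metis finite_lessThan)
    then show ?thesis using that
    proof (induction I rule: finite_induct)
      case (insert i I)
      then show ?case using tog[of P I i] by auto
    qed auto
  qed
  have move: "(P', {}) \<in> T" if "(P, {}) \<in> T" "P \<subseteq> {..<n}" "P' \<subseteq> {..<n}" "card P = card P'" for P P'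
    using that
  proof (induction "card (P - P')" arbitrary: P)
    case 0
    then have "P - P' = {}" by (metis card_0_eq finite_Diff finite_lessThan finite_subset)
    then have "P = P'" using 0 by (metis Diff_eq_empty_iff card_subset_eq finite_lessThan finite_subset)
    then show ?case using 0 by simp
  next
    case (Suc k)
    have fin: "finite P" "finite P'" using Suc.prems finite_subset[OF _ finite_lessThan] by auto
    have "P - P' \<noteq> {}" using Suc.hyps(2) by (metis card.empty nat.distinct(1))
    then obtain a where a: "a \<in> P" "a \<notin> P'" by auto
    have "\<not> P' \<subseteq> P" using a Suc.prems(4) fin by (metis card_subset_eq)
    then obtain d where d: "d \<in> P'" "d \<notin> P" by auto
    let ?Q = "insert d (P - {a})"
    have "?Q - P' = (P - P') - {a}" using d a by auto
    then have "card (?Q - P') = k" using Suc.hyps(2) a fin by simp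
    moreover have "(?Q, {}) \<in> T" using swap[OF Suc.prems(1,2) a(1) d(2)] d Suc.prems(3) by auto
    moreover have "card ?Q = card P'" using Suc.prems(4) a d fin by (simp add: card.insert_remove) (metis Suc_pred card_gt_0_iff empty_iff)
    moreover have "?Q \<subseteq> {..<n}" using Suc.prems d by auto
    ultimately show ?case using Suc.hyps(1)[of ?Q] Suc.prems by auto
  qed
  show ?thesis
    unfolding pats_def using move[OF clear[OF T P I] P] fill by auto
qed

lemma not_in_subgroup:
  assumes "\<And>H. 0 \<in> H \<Longrightarrow> (\<And>u v. u \<in> H \<Longrightarrow> v \<in> H \<Longrightarrow> u + v \<in> H) \<Longrightarrow> (\<And>u. u \<in> H \<Longrightarrow> - u \<in> H) \<Longrightarrow> S \<subseteq> H \<Longrightarrow> \<Lambda> \<subseteq> H"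
    and "0 \<in> Y" "\<And>u v. u \<in> Y \<Longrightarrow> v \<in> Y \<Longrightarrow> u + v \<in> Y" "\<And>u. u \<in> Y \<Longrightarrow> - u \<in> Y" "x \<in> \<Lambda>" "x \<notin> Y"
  shows "\<exists>y\<in>S. y \<notin> (Y :: qvec set)"
proof -
  have "\<not> S \<subseteq> Y"
  proof
    assume "S \<subseteq> Y"
    then have "\<Lambda> \<subseteq> Y" by (intro assms(1)) (auto intro: assms)
    then show False using assms by auto
  qed
  then show ?thesis by auto
qed

definition pattern :: "(int \<Rightarrow> bool) \<Rightarrow> (int \<Rightarrow> bool) \<Rightarrow> nat \<Rightarrow> qvec \<Rightarrow> nat set \<times> nat set" where
  "pattern p s m v = ({i. i < m \<and> p (zc v i)}, {i. i < m \<and> p (zc v i) \<and> s (zc v i)})"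

lemma pats_subset_patterns:
  assumes neg: "\<And>z. p (- z) = p z" "\<And>z. p z \<Longrightarrow> s (- z) = (\<not> s z)"
    and fl: "\<And>i v. i < m \<Longrightarrow> v \<in> S \<Longrightarrow> \<exists>u\<in>S. \<forall>j<m. zc u j = (if j = i then - zc v j else zc v j)"
    and sw: "\<And>a d v. a < m \<Longrightarrow> d < m \<Longrightarrow> v \<in> S \<Longrightarrow> \<exists>u\<in>S. \<forall>j<m. zc u j = zc v (tau a d j)"
    and x: "x \<in> S"
  shows "pats m (card {i. i < m \<and> p (zc x i)}) \<subseteq> pattern p s m ` S"
proof (rule pats_subset)
  show "({i. i < m \<and> p (zc x i)}, {i. i < m \<and> p (zc x i) \<and> s (zc x i)}) \<in> pattern p s m ` S"
    using x unfolding pattern_def by blast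
next
  fix P I i assume T: "(P, I) \<in> pattern p s m ` S" and i: "i \<in> P" and P: "P \<subseteq> {..<m}"
  then obtain v where v: "v \<in> S" and vP: "P = {i. i < m \<and> p (zc v i)}" and vI: "I = {i. i < m \<and> p (zc v i) \<and> s (zc v i)}"
    unfolding pattern_def by auto
  have im: "i < m" using i P by auto
  obtain u where u: "u \<in> S" "\<And>j. j < m \<Longrightarrow> zc u j = (if j = i then - zc v j else zc v j)" using fl[OF im v] by blast
  have "{i. i < m \<and> p (zc u i)} = P" unfolding vP by (auto simp: u(2) neg(1) split: if_splits)
  moreover have "{i. i < m \<and> p (zc u i) \<and> s (zc u i)} = (if i \<in> I then I - {i} else insert i I)"
    using i neg unfolding vP vI by (auto simp: u(2) neg(1) split: if_splits)
  ultimately have "pattern p s m u = (P, if i \<in> I then I - {i} else insert i I)" by (simp only: pattern_def)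
  then show "(P, if i \<in> I then I - {i} else insert i I) \<in> pattern p s m ` S" using u(1) by (metis imageI)
next
  fix P a d assume T: "(P, {}) \<in> pattern p s m ` S" and P: "P \<subseteq> {..<m}" and a: "a \<in> P" and d: "d \<notin> P" "d < m"
  then obtain v where v: "v \<in> S" and vP: "P = {i. i < m \<and> p (zc v i)}" and vI: "{} = {i. i < m \<and> p (zc v i) \<and> s (zc v i)}"
    unfolding pattern_def by auto
  have am: "a < m" using a P by auto
  obtain u where u: "u \<in> S" "\<And>j. j < m \<Longrightarrow> zc u j = zc v (tau a d j)" using sw[OF am d(2) v] by blast
  have tm: "tau a d j < m" if "j < m" for j using that am d(2) by (simp add: tau_def)
  have mem: "p (zc v j) \<longleftrightarrow> j \<in> P" if "j < m" for j using that unfolding vP by simp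
  have "\<not> (p (zc v j) \<and> s (zc v j))" if "j < m" for j using that vI by blast
  then have "{i. i < m \<and> p (zc u i) \<and> s (zc u i)} = {}" using u(2) tm by auto
  moreover have "{i. i < m \<and> p (zc u i)} = {i. i < m \<and> tau a d i \<in> P}" using u(2) tm mem by auto
  moreover have "\<dots> = insert d (P - {a})" using a d am P by (auto simp: tau_def split: if_splits)
  ultimately have "pattern p s m u = (insert d (P - {a}), {})" by (simp only: pattern_def)
  then show "(insert d (P - {a}), {}) \<in> pattern p s m ` S" using u(1) by (metis imageI)
qed auto

lemma parity_patterns_card:
  assumes S: "finite S" "S \<subseteq> ivec n" and fl: "\<And>i v. i < n \<Longrightarrow> v \<in> S \<Longrightarrow> flip {i} v \<in> S"
    and sw: "\<And>a d v. a < n \<Longrightarrow> d < n \<Longrightarrow> v \<in> S \<Longrightarrow> swp a d v \<in> S" and x: "x \<in> S"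
  defines "w \<equiv> card {i. i < n \<and> odd (zc x i)}"
  shows "(n choose w) * 2 ^ w \<le> card S"
proof -
  have "pats n w \<subseteq> pattern odd (\<lambda>z. z < 0) n ` S" unfolding w_def
  proof (rule pats_subset_patterns[OF _ _ _ _ x])
    show "- z < 0 \<longleftrightarrow> \<not> z < 0" if "odd z" for z :: int using that by (cases "z = 0") auto
    show "\<exists>u\<in>S. \<forall>j<n. zc u j = (if j = i then - zc v j else zc v j)" if "i < n" "v \<in> S" for i v
      using fl[OF that] zc_flip[of "{i}" v n] S(2) that by (intro bexI[of _ "flip {i} v"]) auto
    show "\<exists>u\<in>S. \<forall>j<n. zc u j = zc v (tau a d j)" if "a < n" "d < n" "v \<in> S" for a d v
      using sw[OF that] zc_swp[of v n] S(2) that by (intro bexI[of _ "swp a d v"]) auto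
  qed simp
  then have "card (pats n w) \<le> card (pattern odd (\<lambda>z. z < 0) n ` S)" using S(1) by (intro card_mono) auto
  also have "\<dots> \<le> card S" using S(1) by (rule card_image_le)
  finally show ?thesis by (simp add: card_pats)
qed

lemma lessThan_split0: "(n :: nat) > 0 \<Longrightarrow> {..<n} = insert 0 {1..<n}"
  by auto

declare single_one [simp del] single_numeral [simp del]

section \<open>body centred cubic\<close>

definition bcc :: "nat \<Rightarrow> qvec set" where
  "bcc n = {v \<in> ivec n. (\<forall>i<n. even (zc v i)) \<or> (\<forall>i<n. odd (zc v i))}"

lemma bcc_closed: "0 \<in> bcc n" "u \<in> bcc n \<Longrightarrow> v \<in> bcc n \<Longrightarrow> u + v \<in> bcc n" "u \<in> bcc n \<Longrightarrow> - u \<in> bcc n"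
proof -
  show "0 \<in> bcc n" by (simp add: bcc_def ivec_closed zc_0)
  show "u + v \<in> bcc n" if "u \<in> bcc n" "v \<in> bcc n"
    using that unfolding bcc_def by (auto simp: ivec_closed zc_add[of u n v])
  show "- u \<in> bcc n" if "u \<in> bcc n"
    using that unfolding bcc_def by (auto simp: ivec_closed zc_uminus[of u n])
qed

lemma bcc_zc: "u \<in> bcc n \<Longrightarrow> v \<in> bcc n \<Longrightarrow> zc (u + v) i = zc u i + zc v i" "u \<in> bcc n \<Longrightarrow> zc (- u) i = - zc u i"
  by (simp_all add: bcc_def zc_add[of u n v] zc_uminus[of u n])

lemma ones_bcc: "ones n \<in> bcc n"
proof -
  have "zc (ones n) i = (if i < n then 1 else 0)" for i by (simp add: zc_def cf_ones)
  then show ?thesis by (auto simp: bcc_def ivec_def cf_ones)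
qed

lemma mon_bcc: "i < n \<Longrightarrow> mon i (of_int (2 * k)) \<in> bcc n"
proof -
  assume i: "i < n"
  have "zc (mon i (of_int (2 * k))) j = (if j = i then 2 * k else 0)" for j by (rule zc_eqI) (simp add: cf_mon)
  then show ?thesis using i by (auto simp: bcc_def ivec_def cf_mon)
qed

lemma bcc_max_rdim_ge:
  assumes inf: "infinite (UNIV :: 'a set)" and n: "n > 0" and c: "\<And>i. i < n \<Longrightarrow> c i \<ge> 1"
    and N: "\<And>S. finite S \<Longrightarrow> S \<subseteq> bcc n \<Longrightarrow> (\<And>g v. g \<in> isoms c n (bcc n) \<Longrightarrow> v \<in> S \<Longrightarrow> g v \<in> S) \<Longrightarrow>
      (\<And>H. 0 \<in> H \<Longrightarrow> (\<And>u v. u \<in> H \<Longrightarrow> v \<in> H \<Longrightarrow> u + v \<in> H) \<Longrightarrow> (\<And>u. u \<in> H \<Longrightarrow> - u \<in> H) \<Longrightarrow> S \<subseteq> H \<Longrightarrow> bcc n \<subseteq> H)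
      \<Longrightarrow> N \<le> card S"
  shows "max_rdim TYPE('a) n \<ge> enat N"
proof (rule lattice_max_rdim_ge[OF inf n c, where \<Lambda> = "bcc n" and e = "\<lambda>j. if j = 0 then ones n else mon j 2"
      and L = "\<lambda>j v. if j = 0 then cf v 0 else (cf v j - cf v 0) / 2"])
  show "bcc n \<subseteq> ivec n" by (auto simp: bcc_def)
  show "mon i 4 \<in> bcc n" if "i < n" for i using mon_bcc[OF that, of 2] by simp
  show "(if j = 0 then ones n else mon j 2) \<in> bcc n" if "j < n" for j
    using mon_bcc[OF that, of 1] ones_bcc by simp
  show "(if j = 0 then cf u 0 else (cf u j - cf u 0) / 2) \<in> \<int>" if "j < n" "u \<in> bcc n" for j u
  proof -
    have u: "u \<in> ivec n" "even (zc u j - zc u 0)" using that n by (auto simp: bcc_def)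
    then obtain k where k: "zc u j - zc u 0 = 2 * k" by (elim evenE)
    have "(cf u j - cf u 0) / 2 = of_int (zc u j - zc u 0) / 2" using u(1) by (simp add: cf_zc[of u n])
    also have "\<dots> = of_int k" unfolding k by simp
    finally show ?thesis using u(1) by (simp add: cf_zc[of u n])
  qed
  show "v = (\<Sum>j<n. scl (if j = 0 then cf v 0 else (cf v j - cf v 0) / 2) (if j = 0 then ones n else mon j 2))"
    if v: "v \<in> bcc n" for v
  proof (rule qvec_eqI)
    fix i
    have tail: "(\<Sum>j\<in>{1..<n}. cf (scl (if j = 0 then cf v 0 else (cf v j - cf v 0) / 2) (if j = 0 then ones n else mon j 2)) i)
       = (\<Sum>j\<in>{1..<n}. if i = j then cf v j - cf v 0 else 0)"
      by (intro sum.cong refl) (auto simp: cf_mon)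
    have "cf (\<Sum>j<n. scl (if j = 0 then cf v 0 else (cf v j - cf v 0) / 2) (if j = 0 then ones n else mon j 2)) i
       = cf v 0 * cf (ones n) i + (\<Sum>j\<in>{1..<n}. if i = j then cf v j - cf v 0 else 0)"
      unfolding cf_sum lessThan_split0[OF n] by (subst sum.insert) (simp_all only: tail finite_atLeastLessThan, simp_all)
    also have "\<dots> = cf v i" using v by (cases "i = 0") (auto simp: cf_ones bcc_def ivec_def not_less)
    finally show "cf v i = cf (\<Sum>j<n. scl (if j = 0 then cf v 0 else (cf v j - cf v 0) / 2) (if j = 0 then ones n else mon j 2)) i" ..
  qed
  show "N \<le> card S" if S: "finite S" "S \<subseteq> bcc n" "\<And>g v. g \<in> isoms c n (bcc n) \<Longrightarrow> v \<in> S \<Longrightarrow> g v \<in> S"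
      "\<And>H. 0 \<in> H \<Longrightarrow> (\<And>u v. u \<in> H \<Longrightarrow> v \<in> H \<Longrightarrow> u + v \<in> H) \<Longrightarrow> (\<And>u. u \<in> H \<Longrightarrow> - u \<in> H) \<Longrightarrow> S \<subseteq> H \<Longrightarrow> bcc n \<subseteq> H" for S
    by (rule N) (fact S)+
qed (auto simp: bcc_closed cf_ones cf_mon add_divide_distrib diff_divide_distrib)

lemma flip_bcc: "J \<subseteq> {..<n} \<Longrightarrow> v \<in> bcc n \<Longrightarrow> flip J v \<in> bcc n"
  using finite_subset[of J "{..<n}"] by (auto simp: bcc_def ivec_flip zc_flip[of J v n])

lemma swp_bcc: "a < n \<Longrightarrow> d < n \<Longrightarrow> v \<in> bcc n \<Longrightarrow> swp a d v \<in> bcc n"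
  unfolding bcc_def by (auto simp: ivec_swp zc_swp[of v n] tau_def)

lemma max_rdim_ge_power2:
  assumes inf: "infinite (UNIV :: 'a set)" and n: "n > 0"
  shows "max_rdim TYPE('a) n \<ge> enat (2 ^ n)"
proof (rule bcc_max_rdim_ge[OF inf n, where c = "\<lambda>_. 1"])
  fix S assume S: "finite S" "S \<subseteq> bcc n" and G: "\<And>g v. g \<in> isoms (\<lambda>_. 1) n (bcc n) \<Longrightarrow> v \<in> S \<Longrightarrow> g v \<in> S"
    and gen: "\<And>H. 0 \<in> H \<Longrightarrow> (\<And>u v. u \<in> H \<Longrightarrow> v \<in> H \<Longrightarrow> u + v \<in> H) \<Longrightarrow> (\<And>u. u \<in> H \<Longrightarrow> - u \<in> H) \<Longrightarrow> S \<subseteq> H \<Longrightarrow> bcc n \<subseteq> H"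
  have z1: "zc (ones n) 0 = 1" using n by (simp add: zc_def cf_ones)
  have "\<exists>x\<in>S. x \<notin> {v \<in> bcc n. even (zc v 0)}"
    by (rule not_in_subgroup[where S = S and \<Lambda> = "bcc n" and x = "ones n" and Y = "{v \<in> bcc n. even (zc v 0)}"], fact gen)
       (use n in \<open>auto simp: bcc_closed ones_bcc z1 zc_0 bcc_zc\<close>)
  then obtain x where x: "x \<in> S" "x \<notin> {v \<in> bcc n. even (zc v 0)}" by blast
  have "odd (zc x i)" if "i < n" for i using x S(2) that n by (auto simp: bcc_def)
  then have "{i. i < n \<and> odd (zc x i)} = {..<n}" by auto
  moreover have "(n choose card {i. i < n \<and> odd (zc x i)}) * 2 ^ card {i. i < n \<and> odd (zc x i)} \<le> card S"
  proof (rule parity_patterns_card[OF S(1) _ _ _ x(1)])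
    show "S \<subseteq> ivec n" using S(2) by (auto simp: bcc_def)
    show "flip {i} v \<in> S" if "i < n" "v \<in> S" for i v
      by (rule G[OF flip_isom that(2)]) (use that in \<open>auto intro: flip_bcc\<close>)
    show "swp a d v \<in> S" if "a < n" "d < n" "v \<in> S" for a d v
      by (rule G[OF swp_isom that(3)]) (use that in \<open>auto intro: swp_bcc\<close>)
  qed
  ultimately show "2 ^ n \<le> card S" by simp
qed simp

section \<open>hexagonal\<close>

lemma max_rdim_2:
  assumes inf: "infinite (UNIV :: 'a set)" shows "max_rdim TYPE('a) 2 \<ge> enat 6"
proof (rule bcc_max_rdim_ge[OF inf, where c = "\<lambda>i. if i = 0 then 1 else 3"])
  let ?c = "\<lambda>i :: nat. if i = 0 then 1 else 3 :: rat"
  fix S assume S: "finite S" "S \<subseteq> bcc 2" and G: "\<And>g v. g \<in> isoms ?c 2 (bcc 2) \<Longrightarrow> v \<in> S \<Longrightarrow> g v \<in> S"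
    and gen: "\<And>H. 0 \<in> H \<Longrightarrow> (\<And>u v. u \<in> H \<Longrightarrow> v \<in> H \<Longrightarrow> u + v \<in> H) \<Longrightarrow> (\<And>u. u \<in> H \<Longrightarrow> - u \<in> H) \<Longrightarrow> S \<subseteq> H \<Longrightarrow> bcc 2 \<subseteq> H"
  have two: "{..<2} = {0, Suc 0}" by auto
  have cr: "cf (refl1 ?c 2 v) i = (if i < 2 then cf v i - (cf v 0 + 3 * cf v 1) / 2 else cf v i)" for v i
    by (simp add: refl1_def cf_ones two)
  have rb: "refl1 ?c 2 v \<in> bcc 2" if v: "v \<in> bcc 2" for v
  proof -
    have vi: "v \<in> ivec 2" and "even (zc v 1 - zc v 0)" using v by (auto simp: bcc_def)
    then have "even (zc v 0 + 3 * zc v 1)" by presburger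
    then obtain k where k: "zc v 0 + 3 * zc v 1 = 2 * k" by (elim evenE)
    have "(cf v 0 + 3 * cf v 1) / 2 = of_int (zc v 0 + 3 * zc v 1) / 2" using vi by (simp add: cf_zc[of v 2])
    also have "\<dots> = of_int k" unfolding k by simp
    finally have cr': "cf (refl1 ?c 2 v) i = of_int (if i < 2 then zc v i - k else zc v i)" for i
      using vi by (simp add: cr cf_zc[of v 2])
    then have z: "zc (refl1 ?c 2 v) i = (if i < 2 then zc v i - k else zc v i)" for i by (rule zc_eqI)
    have "refl1 ?c 2 v \<in> ivec 2" using vi by (auto simp: ivec_def cr' cf_zc[of v 2, symmetric])
    then show ?thesis using v by (auto simp: bcc_def z)
  qed
  have rS: "refl1 ?c 2 v \<in> S" if "v \<in> S" for v
    by (rule G[OF refl1_isom that]) (use rb in \<open>auto simp: two\<close>)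
  have fS: "flip J v \<in> S" if "v \<in> S" "J \<subseteq> {..<2}" for v J
    by (rule G[OF flip_isom that(1)]) (use that in \<open>auto intro: flip_bcc\<close>)
  have o: "ones 2 \<noteq> 0" using cf_ones[of 2 0] by auto
  have "\<exists>x\<in>S. x \<notin> {0}"
    by (rule not_in_subgroup[where S = S and \<Lambda> = "bcc 2" and x = "ones 2" and Y = "{0}"], fact gen) (auto simp: ones_bcc o)
  then obtain x where x: "x \<in> S" "x \<notin> {0}" by blast
  define s where "s v = flip {1} (refl1 ?c 2 v)" for v
  define ng where "ng v = flip {0, 1} v" for v
  have sS: "s v \<in> S" "ng v \<in> S" if "v \<in> S" for v using that rS fS by (auto simp: s_def ng_def)
  define f where "f v = (cf v 0, cf v 1)" for v :: qvec
  define a d where "a = cf x 0" and "d = cf x 1"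
  have xad: "f x = (a, d)" by (simp add: f_def a_def d_def)
  have fs: "f (s v) = ((fst (f v) - 3 * snd (f v)) / 2, (fst (f v) + snd (f v)) / 2)" for v
    by (simp add: f_def s_def cf_flip cr field_simps)
  have fn: "f (ng v) = (- fst (f v), - snd (f v))" for v by (simp add: f_def ng_def cf_flip)
  have "a \<noteq> 0 \<or> d \<noteq> 0"
  proof (rule ccontr)
    assume "\<not> ?thesis"
    then have ad: "cf x 0 = 0" "cf x 1 = 0" by (auto simp: a_def d_def)
    have "x \<in> ivec 2" using S(2) x(1) by (auto simp: bcc_def)
    then have "cf x i = 0" for i
    proof (cases "i < 2")
      case True
      then have "i = 0 \<or> i = 1" by auto
      then show ?thesis using ad by auto
    qed (simp add: ivec_def)
    then have "x = 0" by (intro qvec_eqI) simp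
    then show False using x(2) by simp
  qed
  then have "distinct [(a, d), ((a - 3 * d) / 2, (a + d) / 2), ((- a - 3 * d) / 2, (a - d) / 2),
     (- a, - d), (- ((a - 3 * d) / 2), - ((a + d) / 2)), (- ((- a - 3 * d) / 2), - ((a - d) / 2))]" (is "distinct ?l")
    by (auto simp: field_simps)
  then have "card (set ?l) = length ?l" by (rule distinct_card)
  then have six: "card (set ?l) = 6" by simp
  have ss: "f (s (s x)) = ((- a - 3 * d) / 2, (a - d) / 2)" by (simp add: fs xad) (simp add: field_simps)
  have "set ?l = f ` {x, s x, s (s x), ng x, ng (s x), ng (s (s x))}"
    by (simp only: image_insert image_empty fn ss xad fst_conv snd_conv list.set) (simp add: fs xad)
  also have "\<dots> \<subseteq> f ` S" using x(1) sS by (intro image_mono) auto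
  finally have "card (set ?l) \<le> card (f ` S)" using S(1) by (intro card_mono) auto
  also have "\<dots> \<le> card S" using S(1) by (rule card_image_le)
  finally show "6 \<le> card S" using six by simp
qed auto

section \<open>checkerboard\<close>

definition dn :: "nat \<Rightarrow> qvec set" where
  "dn n = {v \<in> ivec n. even (\<Sum>i<n. zc v i)}"

lemma dn_closed: "0 \<in> dn n" "u \<in> dn n \<Longrightarrow> v \<in> dn n \<Longrightarrow> u + v \<in> dn n" "u \<in> dn n \<Longrightarrow> - u \<in> dn n"
  by (auto simp: dn_def ivec_closed zc_0 zc_add[of _ n] zc_uminus[of _ n] sum.distrib sum_negf)

lemma tau_bij: "a < n \<Longrightarrow> d < n \<Longrightarrow> bij_betw (tau a d) {..<n} {..<n}"
  by (intro bij_betwI[where g = "tau a d"]) (auto simp: tau_def)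

lemma dn_max_rdim_ge:
  assumes inf: "infinite (UNIV :: 'a set)" and n: "n \<ge> 3"
    and N: "\<And>w. 0 < w \<Longrightarrow> w < n \<Longrightarrow> even w \<Longrightarrow> N \<le> (n choose w) * 2 ^ w"
  shows "max_rdim TYPE('a) n \<ge> enat N"
proof (rule lattice_max_rdim_ge[OF inf, where \<Lambda> = "dn n" and e = "\<lambda>j. if j = 0 then mon 0 2 else mon j 1 - mon 0 1"
      and c = "\<lambda>_. 1" and L = "\<lambda>j v. if j = 0 then (\<Sum>i<n. cf v i) / 2 else cf v j"])
  have zmon: "zc (mon i (of_int k)) j = (if j = i then k else 0)" for i j k by (rule zc_eqI) (simp add: cf_mon)
  have moni: "mon i (of_int k) \<in> ivec n" if "i < n" for i k using that by (auto simp: ivec_def cf_mon)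
  show "dn n \<subseteq> ivec n" by (auto simp: dn_def)
  have m2: "mon i (of_int (2 * k)) \<in> dn n" if "i < n" for i k
    unfolding dn_def using moni[OF that, of "2 * k"] that zmon[of i "2 * k"] by simp
  show "mon i 4 \<in> dn n" if "i < n" for i using m2[OF that, of 2] by simp
  show "(if j = 0 then mon 0 2 else mon j 1 - mon 0 1) \<in> dn n" if j: "j < n" for j
  proof (cases "j = 0")
    case True then show ?thesis using m2[of 0 1] n by simp
  next
    case False
    have z: "zc (mon j 1 - mon 0 1) i = (if i = j then 1 else 0) - (if i = 0 then 1 else 0)" for i
      using False by (intro zc_eqI) (simp add: cf_mon)
    have "mon j 1 - mon 0 1 \<in> ivec n" using j by (auto simp: ivec_def cf_mon)
    moreover have "(\<Sum>i<n. zc (mon j 1 - mon 0 1) i) = 0" using j by (simp add: z sum_subtractf)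
    ultimately show ?thesis using False by (simp add: dn_def)
  qed
  show "(if j = 0 then (\<Sum>i<n. cf u i) / 2 else cf u j) \<in> \<int>" if "j < n" "u \<in> dn n" for j u
  proof -
    have u: "u \<in> ivec n" "even (\<Sum>i<n. zc u i)" using that by (auto simp: dn_def)
    then obtain k where k: "(\<Sum>i<n. zc u i) = 2 * k" by (elim evenE)
    have "(\<Sum>i<n. cf u i) / 2 = of_int (\<Sum>i<n. zc u i) / 2" using u(1) by (simp add: cf_zc[of u n])
    also have "\<dots> = of_int k" unfolding k by simp
    finally show ?thesis using u(1) by (simp add: cf_zc[of u n])
  qed
  show "(if j = 0 then (\<Sum>l<n. cf (if i = 0 then mon 0 2 else mon i 1 - mon 0 1 :: qvec) l) / 2 else cf (if i = 0 then mon 0 2 else mon i 1 - mon 0 1 :: qvec) j)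
     = (if i = j then 1 else 0)" if "i < n" "j < n" for i j
    using that n by (auto simp: cf_mon sum_subtractf)
  show "v = (\<Sum>j<n. scl (if j = 0 then (\<Sum>i<n. cf v i) / 2 else cf v j) (if j = 0 then mon 0 2 else mon j 1 - mon 0 1))"
    if v: "v \<in> dn n" for v
  proof (rule qvec_eqI)
    fix i
    have n0: "n > 0" using n by simp
    have tail: "(\<Sum>j\<in>{1..<n}. cf (scl (if j = 0 then (\<Sum>i<n. cf v i) / 2 else cf v j) (if j = 0 then mon 0 2 else mon j 1 - mon 0 1)) i)
       = (\<Sum>j\<in>{1..<n}. (if i = j then cf v j else 0) - (if i = 0 then cf v j else 0))"
      by (intro sum.cong refl) (auto simp: cf_mon)
    have "cf (\<Sum>j<n. scl (if j = 0 then (\<Sum>i<n. cf v i) / 2 else cf v j) (if j = 0 then mon 0 2 else mon j 1 - mon 0 1)) i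
       = (if i = 0 then (\<Sum>i<n. cf v i) else 0) + (\<Sum>j\<in>{1..<n}. (if i = j then cf v j else 0) - (if i = 0 then cf v j else 0))"
      unfolding cf_sum lessThan_split0[OF n0] by (subst sum.insert) (simp_all only: tail finite_atLeastLessThan, simp_all add: cf_mon if_distrib[of "\<lambda>x. _ * x"] cong: if_cong)
    also have "\<dots> = cf v i"
    proof (cases "i = 0")
      case True
      have "(\<Sum>i<n. cf v i) = cf v 0 + (\<Sum>j\<in>{1..<n}. cf v j)" unfolding lessThan_split0[OF n0] by simp
      then show ?thesis using True by (simp add: sum_subtractf sum_negf)
    next
      case False
      then show ?thesis using v by (auto simp: dn_def ivec_def)
    qed
    finally show "cf v i = cf (\<Sum>j<n. scl (if j = 0 then (\<Sum>i<n. cf v i) / 2 else cf v j) (if j = 0 then mon 0 2 else mon j 1 - mon 0 1)) i" ..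
  qed
  fix S assume S: "finite S" "S \<subseteq> dn n" and G: "\<And>g v. g \<in> isoms (\<lambda>_. 1) n (dn n) \<Longrightarrow> v \<in> S \<Longrightarrow> g v \<in> S"
    and gen: "\<And>H. 0 \<in> H \<Longrightarrow> (\<And>u v. u \<in> H \<Longrightarrow> v \<in> H \<Longrightarrow> u + v \<in> H) \<Longrightarrow> (\<And>u. u \<in> H \<Longrightarrow> - u \<in> H) \<Longrightarrow> S \<subseteq> H \<Longrightarrow> dn n \<subseteq> H"
  define p :: qvec where "p = mon 0 1 + mon 1 1"
  have zp: "zc p i = (if i < 2 then 1 else 0)" for i by (rule zc_eqI) (auto simp: cf_mon p_def)
  have "{i. i < n \<and> i < 2} = {0, 1}" using n by auto
  then have "(\<Sum>i<n. zc p i) = 2" using sum.inter_filter[of "{..<n}" "\<lambda>_. 1 :: int" "\<lambda>i. i < 2"] by (simp add: zp)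
  then have pd: "p \<in> dn n" using n by (auto simp: dn_def ivec_def cf_mon p_def)
  have "\<exists>x\<in>S. x \<notin> bcc n"
  proof (rule not_in_subgroup[where S = S and \<Lambda> = "dn n" and x = "p" and Y = "bcc n"], fact gen)
    show "p \<notin> bcc n" using n zp[of 2] zp[of 0] by (auto simp: bcc_def intro: exI[of _ "0 :: nat"] exI[of _ "2 :: nat"])
  qed (use pd in \<open>auto simp: bcc_closed\<close>)
  then obtain x where x: "x \<in> S" "x \<notin> bcc n" by blast
  define w where "w = card {i. i < n \<and> odd (zc x i)}"
  have xi: "x \<in> ivec n" "even (\<Sum>i<n. zc x i)" using x(1) S(2) by (auto simp: dn_def)
  then have ew: "even w" unfolding w_def even_sum_iff[OF finite_lessThan] by simp
  have ex: "\<exists>k<n. odd (zc x k)" "\<exists>k<n. even (zc x k)" using x(2) xi(1) by (auto simp: bcc_def)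
  have w0: "0 < w" using ex(1) unfolding w_def by (auto simp: card_gt_0_iff)
  have "{i. i < n \<and> odd (zc x i)} \<subset> {..<n}" using ex(2) by auto
  then have "w < card {..<n}" unfolding w_def by (intro psubset_card_mono) auto
  then have wn: "w < n" by simp
  have "(n choose w) * 2 ^ w \<le> card S"
    unfolding w_def
  proof (rule parity_patterns_card[OF S(1) _ _ _ x(1)])
    show "S \<subseteq> ivec n" using S(2) by (auto simp: dn_def)
    show "flip {i} v \<in> S" if "i < n" "v \<in> S" for i v
    proof (rule G[OF flip_isom that(2)])
      show "flip {i} u \<in> dn n" if u: "u \<in> dn n" for u
      proof -
        have ui: "u \<in> ivec n" using u by (simp add: dn_def)
        have "even ((\<Sum>j<n. zc (flip {i} u) j) - (\<Sum>j<n. zc u j))"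
          unfolding sum_subtractf[symmetric] using ui by (intro dvd_sum) (auto simp: zc_flip[of _ u n])
        then show ?thesis using u ivec_flip[of "{i}" n u] \<open>i < n\<close> by (auto simp: dn_def)
      qed
    qed (use that in auto)
    show "swp a d v \<in> S" if "a < n" "d < n" "v \<in> S" for a d v
    proof (rule G[OF swp_isom that(3)])
      show "swp a d u \<in> dn n" if u: "u \<in> dn n" for u
      proof -
        have "(\<Sum>j<n. zc (swp a d u) j) = (\<Sum>j<n. zc u (tau a d j))" using u by (simp add: zc_swp[of u n] dn_def)
        also have "\<dots> = (\<Sum>j<n. zc u j)" by (rule sum.reindex_bij_betw[OF tau_bij[OF \<open>a < n\<close> \<open>d < n\<close>]])
        finally show ?thesis using u ivec_swp[OF \<open>a < n\<close> \<open>d < n\<close>] by (simp add: dn_def)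
      qed
    qed (use that in auto)
  qed
  then show "N \<le> card S" using N[OF w0 wn ew] by simp
qed (use n in \<open>auto simp: dn_closed sum.distrib add_divide_distrib\<close>)

section \<open>E6\<close>

definition e6 :: "qvec set" where
  "e6 = {v \<in> ivec 6. (\<forall>i<5. even (zc v i - zc v 5)) \<and> 4 dvd (\<Sum>i<5. zc v i) - zc v 5}"

definition e6_weight :: "nat \<Rightarrow> rat" where "e6_weight i = (if i = 5 then 3 else 1)"

lemma lessThan_5: "{..<5 :: nat} = {0, 1, 2, 3, 4}" by auto
lemma lessThan_6: "{..<6 :: nat} = {0, 1, 2, 3, 4, 5}" by auto

lemma all_less_5: "(\<forall>i<5 :: nat. P i) \<longleftrightarrow> P 0 \<and> P 1 \<and> P 2 \<and> P 3 \<and> P 4"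
proof -
  have "(\<forall>i<5 :: nat. P i) \<longleftrightarrow> (\<forall>i\<in>{..<5}. P i)" by (simp only: Ball_def lessThan_iff)
  then show ?thesis unfolding lessThan_5 by simp
qed

lemma less_6_cases: "(i :: nat) < 6 \<longleftrightarrow> i = 0 \<or> i = 1 \<or> i = 2 \<or> i = 3 \<or> i = 4 \<or> i = 5"
  by auto

lemma e6_iff: "v \<in> e6 \<longleftrightarrow> v \<in> ivec 6 \<and> even (zc v 0 - zc v 5) \<and> even (zc v 1 - zc v 5) \<and> even (zc v 2 - zc v 5)
    \<and> even (zc v 3 - zc v 5) \<and> even (zc v 4 - zc v 5) \<and> 4 dvd zc v 0 + zc v 1 + zc v 2 + zc v 3 + zc v 4 - zc v 5"
  unfolding e6_def all_less_5 lessThan_5 by (simp add: add.assoc)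

lemma e6_closed: "u \<in> e6 \<Longrightarrow> v \<in> e6 \<Longrightarrow> u + v \<in> e6" "u \<in> e6 \<Longrightarrow> - u \<in> e6" "0 \<in> e6"
proof -
  assume u: "u \<in> e6"
  then have iu: "u \<in> ivec 6" and eu: "\<And>i. i < 5 \<Longrightarrow> even (zc u i - zc u 5)" and du: "4 dvd (\<Sum>i<5. zc u i) - zc u 5"
    unfolding e6_def by blast+
  have "(\<Sum>i<5. - zc u i) - - zc u 5 = - ((\<Sum>i<5. zc u i) - zc u 5)" by (simp add: sum_negf)
  then have "4 dvd (\<Sum>i<5. - zc u i) - - zc u 5" using du by (simp only: dvd_minus_iff)
  moreover have "even (- zc u i - - zc u 5)" if "i < 5" for i using eu[OF that] by presburger
  ultimately show "- u \<in> e6" unfolding e6_def mem_Collect_eq zc_uminus[OF iu] using ivec_closed(3)[OF iu] by blast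
  assume v: "v \<in> e6"
  then have iv: "v \<in> ivec 6" and ev: "\<And>i. i < 5 \<Longrightarrow> even (zc v i - zc v 5)" and dv: "4 dvd (\<Sum>i<5. zc v i) - zc v 5"
    unfolding e6_def by blast+
  have "(\<Sum>i<5. zc u i + zc v i) - (zc u 5 + zc v 5) = ((\<Sum>i<5. zc u i) - zc u 5) + ((\<Sum>i<5. zc v i) - zc v 5)"
    by (simp add: sum.distrib)
  then have "4 dvd (\<Sum>i<5. zc u i + zc v i) - (zc u 5 + zc v 5)" using dvd_add[OF du dv] by (simp only:)
  moreover have "even (zc u i + zc v i - (zc u 5 + zc v 5))" if "i < 5" for i using eu[OF that] ev[OF that] by presburger
  ultimately show "u + v \<in> e6" unfolding e6_def mem_Collect_eq zc_add[OF iu iv] using ivec_closed(2)[OF iu iv] by blast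
qed (simp add: e6_iff ivec_closed zc_0)

lemma zc_mon: "zc (mon i (of_int k)) j = (if j = i then k else 0)"
  by (rule zc_eqI) (simp add: cf_mon)

lemma mon4_e6: "i < 6 \<Longrightarrow> mon i 4 \<in> e6"
  using zc_mon[of i 4] by (auto simp: less_6_cases e6_iff ivec_def cf_mon)

lemma diff_e6: "0 < j \<Longrightarrow> j < 5 \<Longrightarrow> mon j 2 - mon 0 2 \<in> e6"
proof -
  assume j: "0 < j" "j < 5"
  then have "j \<in> {1, 2, 3, 4}" by auto
  moreover have "zc (mon j 2 - mon 0 2) i = (if i = j then 2 else 0) - (if i = 0 then 2 else 0)" for i
    using j by (intro zc_eqI) (simp add: cf_mon)
  moreover have "mon j 2 - mon 0 2 \<in> ivec 6" using j by (auto simp: ivec_def cf_mon)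
  ultimately show ?thesis unfolding e6_iff by auto
qed

lemma ones_e6: "ones 6 \<in> e6"
proof -
  have "zc (ones 6) i = (if i < 6 then 1 else 0)" for i by (simp add: zc_def cf_ones)
  then show ?thesis by (auto simp: e6_iff ivec_def cf_ones)
qed

lemma swp_e6:
  assumes a: "a < 5" "d < 5" and v: "v \<in> e6" shows "swp a d v \<in> e6"
proof -
  have iv: "v \<in> ivec 6" and ev: "even (zc v i - zc v 5)" if "i < 5" for i using v that by (auto simp: e6_def)
  have iv: "v \<in> ivec 6" and dv: "4 dvd (\<Sum>i<5. zc v i) - zc v 5" using v by (auto simp: e6_def)
  have "(\<Sum>i<5. zc v (tau a d i)) = (\<Sum>i<5. zc v i)" by (rule sum.reindex_bij_betw[OF tau_bij[OF a]])
  moreover have "tau a d i < 5" if "i < 5" for i using a that by (simp add: tau_def)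
  moreover have "tau a d 5 = 5" using a by (simp add: tau_def)
  ultimately show ?thesis using ev dv ivec_swp[of a 6 d v] a iv unfolding e6_def mem_Collect_eq zc_swp[OF iv] by simp
qed

lemma flip_e6:
  assumes i: "i < 5" and v: "v \<in> e6" shows "flip {i, 5} v \<in> e6"
proof -
  have iv: "v \<in> ivec 6" and ev: "\<And>j. j < 5 \<Longrightarrow> even (zc v j - zc v 5)" and dv: "4 dvd (\<Sum>j<5. zc v j) - zc v 5"
    using v unfolding e6_def by blast+
  have z: "zc (flip {i, 5} v) j = (if j = i \<or> j = 5 then - zc v j else zc v j)" for j
    using zc_flip[of "{i, 5}" v 6] iv by auto
  have f: "flip {i, 5} v \<in> ivec 6" using i iv by (intro ivec_flip) auto
  obtain l where l: "zc v i - zc v 5 = 2 * l" using ev[OF i] by (elim evenE)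
  have "(\<Sum>j<5. zc (flip {i, 5} v) j) = (\<Sum>j<5. zc v j + (if j = i then - 2 * zc v j else 0))"
    by (intro sum.cong) (auto simp: z)
  also have "\<dots> = (\<Sum>j<5. zc v j) - 2 * zc v i" using i by (simp add: sum.distrib)
  finally have "(\<Sum>j<5. zc (flip {i, 5} v) j) - zc (flip {i, 5} v) 5 = ((\<Sum>j<5. zc v j) - zc v 5) - 4 * l"
    using l z[of 5] by simp
  then have "4 dvd (\<Sum>j<5. zc (flip {i, 5} v) j) - zc (flip {i, 5} v) 5" using dv by (simp only: dvd_diff dvd_triv_left)
  moreover have "even (zc (flip {i, 5} v) j - zc (flip {i, 5} v) 5)" if "j < 5" for j using ev[OF that] z[of j] z[of 5] by auto
  ultimately show ?thesis using f unfolding e6_def by blast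
qed

lemma refl_e6:
  assumes v: "v \<in> e6"
  shows "\<exists>k. 4 * k = zc v 0 + zc v 1 + zc v 2 + zc v 3 + zc v 4 + 3 * zc v 5 \<and> refl1 e6_weight 6 v \<in> e6 \<and>
    (\<forall>i<6. zc (refl1 e6_weight 6 v) i = zc v i - k)"
proof -
  have iv: "v \<in> ivec 6" and "4 dvd zc v 0 + zc v 1 + zc v 2 + zc v 3 + zc v 4 - zc v 5" using v by (auto simp: e6_iff)
  then have "4 dvd (zc v 0 + zc v 1 + zc v 2 + zc v 3 + zc v 4 - zc v 5) + 4 * zc v 5" by (intro dvd_add dvd_triv_left)
  then have "4 dvd zc v 0 + zc v 1 + zc v 2 + zc v 3 + zc v 4 + 3 * zc v 5" by (simp add: algebra_simps)
  then obtain k where k: "zc v 0 + zc v 1 + zc v 2 + zc v 3 + zc v 4 + 3 * zc v 5 = 4 * k" by (elim dvdE)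
  have "2 * (\<Sum>i<6. e6_weight i * cf v i) / (\<Sum>i<6. e6_weight i)
      = of_int (zc v 0 + zc v 1 + zc v 2 + zc v 3 + zc v 4 + 3 * zc v 5) / 4"
    unfolding lessThan_6 using iv by (simp add: e6_weight_def cf_zc[of v 6])
  also have "\<dots> = of_int k" unfolding k by simp
  finally have cr: "cf (refl1 e6_weight 6 v) i = of_int (if i < 6 then zc v i - k else zc v i)" for i
    using iv by (simp add: refl1_def cf_ones cf_zc[of v 6])
  then have z: "zc (refl1 e6_weight 6 v) i = (if i < 6 then zc v i - k else zc v i)" for i by (rule zc_eqI)
  have "refl1 e6_weight 6 v \<in> ivec 6" using iv by (auto simp: ivec_def cr cf_zc[of v 6, symmetric])
  moreover have "even (zc (refl1 e6_weight 6 v) i - zc (refl1 e6_weight 6 v) 5)" if "i < 5" for i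
    using v that by (simp add: z e6_def)
  moreover have "4 dvd (\<Sum>i<5. zc (refl1 e6_weight 6 v) i) - zc (refl1 e6_weight 6 v) 5"
  proof -
    have "(\<Sum>i<5. zc (refl1 e6_weight 6 v) i) - zc (refl1 e6_weight 6 v) 5 = ((\<Sum>i<5. zc v i) - zc v 5) - 4 * k"
      by (simp add: z sum_subtractf)
    then show ?thesis using v unfolding e6_def by (simp only: mem_Collect_eq dvd_diff dvd_triv_left)
  qed
  ultimately have "refl1 e6_weight 6 v \<in> e6" unfolding e6_def by blast
  then show ?thesis using k z by (intro exI[of _ k]) simp
qed

lemma pats_5_card: "card (pats 5 3) = 80" "card (pats 5 4) = 80" "card (pats 5 2 \<union> pats 5 5) = 72"
proof -
  have c: "(5 :: nat) choose 2 = 10" "(5 :: nat) choose 3 = 10" "(5 :: nat) choose 4 = 5" by (simp_all add: numeral_eq_Suc)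
  show "card (pats 5 3) = 80" "card (pats 5 4) = 80" by (simp_all add: card_pats c)
  show "card (pats 5 2 \<union> pats 5 5) = 72"
    by (subst card_Un_disjoint) (simp_all add: finite_pats pats_disjoint card_pats c)
qed

lemma e6_patterns_card:
  assumes fin: "finite S" and S: "S \<subseteq> e6" and G: "\<And>g v. g \<in> isoms e6_weight 6 e6 \<Longrightarrow> v \<in> S \<Longrightarrow> g v \<in> S"
    and gen: "\<And>H. 0 \<in> H \<Longrightarrow> (\<And>u v. u \<in> H \<Longrightarrow> v \<in> H \<Longrightarrow> u + v \<in> H) \<Longrightarrow> (\<And>u. u \<in> H \<Longrightarrow> - u \<in> H) \<Longrightarrow> S \<subseteq> H \<Longrightarrow> e6 \<subseteq> H"
  shows "72 \<le> card S"
proof -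
  let ?p = "\<lambda>z :: int. \<not> 3 dvd z" and ?s = "\<lambda>z :: int. z mod 3 = 2"
  let ?T = "pattern ?p ?s 5 ` S"
  have Siv: "v \<in> ivec 6" if "v \<in> S" for v using S that by (auto simp: e6_def)
  have fS: "flip {i, 5} v \<in> S" if "i < 5" "v \<in> S" for i v
    by (rule G[OF flip_isom that(2)]) (use that in \<open>auto intro: flip_e6\<close>)
  have wS: "swp a d v \<in> S" if "a < 5" "d < 5" "v \<in> S" for a d v
    by (rule G[OF swp_isom that(3)]) (use that in \<open>auto intro: swp_e6 simp: e6_weight_def\<close>)
  have c8: "(\<Sum>i<6. e6_weight i) \<noteq> 0" unfolding lessThan_6 by (simp add: e6_weight_def)
  have rS: "refl1 e6_weight 6 v \<in> S" if "v \<in> S" for v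
    by (rule G[OF refl1_isom[OF c8] that]) (use refl_e6 in blast)
  have key: "pats 5 (card {i. i < 5 \<and> ?p (zc x i)}) \<subseteq> ?T" if x: "x \<in> S" for x
  proof (rule pats_subset_patterns[OF _ _ _ _ x])
    show "?s (- z) \<longleftrightarrow> \<not> ?s z" if "?p z" for z :: int using that by presburger
    show "\<exists>u\<in>S. \<forall>j<5. zc u j = (if j = i then - zc v j else zc v j)" if "i < 5" "v \<in> S" for i v
      using fS[OF that] zc_flip[of "{i, 5}" v 6] Siv that by (intro bexI[of _ "flip {i, 5} v"]) auto
    show "\<exists>u\<in>S. \<forall>j<5. zc u j = zc v (tau a d j)" if "a < 5" "d < 5" "v \<in> S" for a d v
      using wS[OF that] zc_swp[of v 6] Siv that by (intro bexI[of _ "swp a d v"]) auto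
  qed simp
  have reflected: "pats 5 (card Q) \<subseteq> ?T"
    if sub: "pats 5 w \<subseteq> ?T" and PI: "(P, I) \<in> pats 5 w" and r: "r = (\<lambda>j. if j \<in> I then 2 else if j \<in> P then 1 else 0)"
      and Q: "Q \<subseteq> {..<5}" "\<And>i. i < 5 \<Longrightarrow> i \<in> Q \<longleftrightarrow> r i \<noteq> (\<Sum>j<5. r j) mod 3"
    for P I Q w and r :: "nat \<Rightarrow> int"
  proof -
    obtain v where v: "v \<in> S" "(P, I) = pattern ?p ?s 5 v" using sub PI by (meson imageE subsetD)
    have rv: "zc v i mod 3 = r i" if i: "i < 5" for i
    proof -
      have "i \<in> P \<longleftrightarrow> ?p (zc v i)" "i \<in> I \<longleftrightarrow> ?p (zc v i) \<and> ?s (zc v i)" using v(2) i by (simp_all add: pattern_def)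
      moreover have "?p z \<or> z mod 3 = 0" "?p z \<longrightarrow> z mod 3 = 1 \<or> z mod 3 = 2" "?s z \<longrightarrow> ?p z" for z by presburger+
      ultimately show ?thesis unfolding r by metis
    qed
    obtain k where k: "4 * k = zc v 0 + zc v 1 + zc v 2 + zc v 3 + zc v 4 + 3 * zc v 5"
      "\<forall>i<6. zc (refl1 e6_weight 6 v) i = zc v i - k"
      using refl_e6[OF subsetD[OF S v(1)]] by blast
    have "(\<Sum>j<5. zc v j) = k + 3 * (k - zc v 5)" using k(1) by (simp add: lessThan_5)
    then have "k mod 3 = (\<Sum>j<5. zc v j) mod 3" by (simp only: mod_mult_self2)
    also have "\<dots> = (\<Sum>j<5. zc v j mod 3) mod 3" by (rule mod_sum_eq[symmetric])
    also have "(\<Sum>j<5. zc v j mod 3) = (\<Sum>j<5. r j)" by (intro sum.cong) (auto simp: rv)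
    finally have km: "k mod 3 = (\<Sum>j<5. r j) mod 3" .
    have "?p (zc (refl1 e6_weight 6 v) i) \<longleftrightarrow> i \<in> Q" if "i < 5" for i
      using k(2) that by (simp add: mod_eq_dvd_iff[symmetric] rv km Q(2))
    then have "{i. i < 5 \<and> ?p (zc (refl1 e6_weight 6 v) i)} = Q" using Q(1) by auto
    then show ?thesis using key[OF rS[OF v(1)]] by simp
  qed
  have count: "72 \<le> card S" if "Z \<subseteq> ?T" "72 \<le> card Z" for Z
  proof -
    have "card Z \<le> card ?T" using that(1) fin by (intro card_mono) auto
    also have "\<dots> \<le> card S" using fin by (rule card_image_le)
    finally show ?thesis using that(2) by simp
  qed
  have "\<exists>x\<in>S. x \<notin> {v \<in> e6. \<forall>i<5. 3 dvd zc v i}"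
  proof (rule not_in_subgroup[where S = S and \<Lambda> = e6 and x = "ones 6"], fact gen)
    show "ones 6 \<notin> {v \<in> e6. \<forall>i<5. 3 dvd zc v i}" by (auto simp: zc_def cf_ones intro: exI[of _ "0 :: nat"])
    show "u + v \<in> {v \<in> e6. \<forall>i<5. 3 dvd zc v i}" if "u \<in> {v \<in> e6. \<forall>i<5. 3 dvd zc v i}" "v \<in> {v \<in> e6. \<forall>i<5. 3 dvd zc v i}" for u v
      using that e6_closed(1)[of u v] zc_add[of u 6 v] by (simp add: e6_iff)
    show "- u \<in> {v \<in> e6. \<forall>i<5. 3 dvd zc v i}" if "u \<in> {v \<in> e6. \<forall>i<5. 3 dvd zc v i}" for u
      using that e6_closed(2)[of u] zc_uminus[of u 6] by (simp add: e6_iff)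
  qed (simp_all add: e6_closed ones_e6 zc_0)
  then obtain x where x: "x \<in> S" "\<not> (\<forall>i<5. 3 dvd zc x i)" using S by blast
  define w where "w = card {i. i < 5 \<and> ?p (zc x i)}"
  have T: "pats 5 w \<subseteq> ?T" unfolding w_def by (rule key[OF x(1)])
  have "w \<noteq> 0" using x(2) by (auto simp: w_def)
  moreover have "w \<le> card {..<5 :: nat}" unfolding w_def by (intro card_mono) auto
  ultimately consider "w = 3" | "w = 4" | "w = 1" | "w = 2" | "w = 5" by fastforce
  then show ?thesis
  proof cases
    case 1 show ?thesis by (rule count[OF T]) (simp add: 1 pats_5_card)
  next
    case 2 show ?thesis by (rule count[OF T]) (simp add: 2 pats_5_card)
  next
    case 3
    have single: "({0}, {}) \<in> pats 5 w" by (auto simp: pats_def 3)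
    have "pats 5 (card {1, 2, 3, 4 :: nat}) \<subseteq> ?T" by (rule reflected[OF T single refl]) (auto simp: lessThan_5)
    moreover have "card {1, 2, 3, 4 :: nat} = 4" by simp
    ultimately have "pats 5 4 \<subseteq> ?T" by (simp only:)
    then show ?thesis by (rule count) (simp add: pats_5_card)
  next
    case 4
    have pair: "({0, 1}, {}) \<in> pats 5 w" by (auto simp: pats_def 4)
    have "pats 5 (card {0, 1, 2, 3, 4 :: nat}) \<subseteq> ?T" by (rule reflected[OF T pair refl]) (auto simp: lessThan_5)
    moreover have "card {0, 1, 2, 3, 4 :: nat} = 5" by simp
    ultimately have "pats 5 2 \<union> pats 5 5 \<subseteq> ?T" using T by (simp only: 4 Un_least)
    then show ?thesis by (rule count) (simp add: pats_5_card)
  next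
    case 5
    have full: "({0, 1, 2, 3, 4}, {0, 1}) \<in> pats 5 w" by (auto simp: pats_def 5)
    have "pats 5 (card {0, 1 :: nat}) \<subseteq> ?T" by (rule reflected[OF T full refl]) (auto simp: lessThan_5)
    moreover have "card {0, 1 :: nat} = 2" by simp
    ultimately have "pats 5 2 \<union> pats 5 5 \<subseteq> ?T" using T by (simp only: 5 Un_least)
    then show ?thesis by (rule count) (simp add: pats_5_card)
  qed
qed

definition e6_coord :: "nat \<Rightarrow> qvec \<Rightarrow> rat" where
  "e6_coord j v = (if j = 0 then (cf v 0 + cf v 1 + cf v 2 + cf v 3 + cf v 4 - 5 * cf v 5) / 4
     else if j = 5 then cf v 5 else (cf v j - cf v 5) / 2)"

definition e6_basis :: "nat \<Rightarrow> qvec" where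
  "e6_basis j = (if j = 0 then mon 0 4 else if j = 5 then ones 6 else mon j 2 - mon 0 2)"

lemma max_rdim_6:
  assumes inf: "infinite (UNIV :: 'a set)" shows "max_rdim TYPE('a) 6 \<ge> enat 72"
proof (rule lattice_max_rdim_ge[OF inf, where \<Lambda> = e6 and e = e6_basis and c = e6_weight and L = e6_coord])
  show "e6 \<subseteq> ivec 6" by (auto simp: e6_def)
  show "e6_basis j \<in> e6" if "j < 6" for j
    using that by (auto simp: e6_basis_def intro!: mon4_e6 ones_e6 diff_e6)
  show "e6_coord j (u + v) = e6_coord j u + e6_coord j v" for j u v
    by (simp add: e6_coord_def field_simps)
  show "e6_coord j u \<in> \<int>" if "j < 6" "u \<in> e6" for j u
  proof -
    have iv: "u \<in> ivec 6" using that by (simp add: e6_iff)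
    have "4 dvd zc u 0 + zc u 1 + zc u 2 + zc u 3 + zc u 4 - zc u 5" using that(2) unfolding e6_iff by blast
    then have "4 dvd (zc u 0 + zc u 1 + zc u 2 + zc u 3 + zc u 4 - zc u 5) - 4 * zc u 5" by (rule dvd_diff[OF _ dvd_triv_left])
    then have "4 dvd zc u 0 + zc u 1 + zc u 2 + zc u 3 + zc u 4 - 5 * zc u 5" by (simp add: algebra_simps)
    then obtain k where k: "zc u 0 + zc u 1 + zc u 2 + zc u 3 + zc u 4 - 5 * zc u 5 = 4 * k" by (elim dvdE)
    have 0: "(cf u 0 + cf u 1 + cf u 2 + cf u 3 + cf u 4 - 5 * cf u 5) / 4 = of_int k"
      using arg_cong[OF k, of "of_int :: int \<Rightarrow> rat"] iv by (simp add: cf_zc[of u 6])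
    have 1: "(cf u j - cf u 5) / 2 \<in> \<int>" if "j < 5"
    proof -
      have "even (zc u j - zc u 5)" using \<open>u \<in> e6\<close> that by (auto simp: e6_def)
      then obtain l where l: "zc u j - zc u 5 = 2 * l" by (elim evenE)
      have "(cf u j - cf u 5) / 2 = of_int l"
        using arg_cong[OF l, of "of_int :: int \<Rightarrow> rat"] iv by (simp add: cf_zc[of u 6])
      then show ?thesis by simp
    qed
    show ?thesis using that(1) 0 1 iv by (auto simp: e6_coord_def cf_zc[of u 6])
  qed
  show "e6_coord j (e6_basis i) = (if i = j then 1 else 0)" if "i < 6" "j < 6" for i j
    using that unfolding less_6_cases by (elim disjE) (simp_all add: e6_coord_def e6_basis_def cf_mon cf_ones)
  show "v = (\<Sum>j<6. scl (e6_coord j v) (e6_basis j))" if v: "v \<in> e6" for v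
  proof (rule qvec_eqI)
    fix i
    show "cf v i = cf (\<Sum>j<6. scl (e6_coord j v) (e6_basis j)) i"
    proof (cases "i < 6")
      case True
      have "cf (\<Sum>j<6. scl (e6_coord j v) (e6_basis j)) i = (\<Sum>j\<in>{0, 1, 2, 3, 4, 5}. e6_coord j v * cf (e6_basis j) i)"
        unfolding lessThan_6 cf_sum cf_scl ..
      also have "\<dots> = e6_coord 0 v * cf (e6_basis 0) i + e6_coord 1 v * cf (e6_basis 1) i + e6_coord 2 v * cf (e6_basis 2) i
        + e6_coord 3 v * cf (e6_basis 3) i + e6_coord 4 v * cf (e6_basis 4) i + e6_coord 5 v * cf (e6_basis 5) i"
        by simp
      also have "\<dots> = cf v i"
        using True unfolding less_6_cases e6_coord_def e6_basis_def
        by (elim disjE) (simp_all add: cf_mon cf_ones add_divide_distrib diff_divide_distrib)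
      finally show ?thesis ..
    next
      case False
      then have "cf v i = 0" using v by (simp add: e6_def ivec_def)
      then show ?thesis using False unfolding cf_sum lessThan_6 by (simp add: e6_basis_def cf_mon cf_ones)
    qed
  qed
  show "72 \<le> card S" if S: "finite S" "S \<subseteq> e6" "\<And>g v. g \<in> isoms e6_weight 6 e6 \<Longrightarrow> v \<in> S \<Longrightarrow> g v \<in> S"
      "\<And>H. 0 \<in> H \<Longrightarrow> (\<And>u v. u \<in> H \<Longrightarrow> v \<in> H \<Longrightarrow> u + v \<in> H) \<Longrightarrow> (\<And>u. u \<in> H \<Longrightarrow> - u \<in> H) \<Longrightarrow> S \<subseteq> H \<Longrightarrow> e6 \<subseteq> H" for S
    by (rule e6_patterns_card) (fact S)+
qed (auto simp: e6_closed mon4_e6 e6_weight_def)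

theorem theorem1p1:
  fixes n :: nat
  assumes "infinite (UNIV :: 'a set)" and "n \<ge> 1"
  shows "max_rdim TYPE('a) n \<ge> enat (b n)"
proof -
  have binom: "(3 :: nat) choose 2 = 3" "(4 :: nat) choose 2 = 6" "(5 :: nat) choose 2 = 10" "(5 :: nat) choose 4 = 5"
    by (simp_all add: numeral_eq_Suc)
  have checkerboard: "max_rdim TYPE('a) n \<ge> enat N"
    if "n \<in> {3, 4, 5}" "N \<le> (n choose 2) * 2 ^ 2" "n = 5 \<Longrightarrow> N \<le> (n choose 4) * 2 ^ 4" for N
  proof (rule dn_max_rdim_ge[OF assms(1)])
    fix w :: nat assume w: "0 < w" "w < n" "even w"
    then have "w = 2 \<or> w = 4 \<and> n = 5" using that(1) by (elim insertE) (auto elim!: evenE)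
    then show "N \<le> (n choose w) * 2 ^ w" using that(2,3) by auto
  qed (use that in auto)
  consider "n = 2" | "n = 3" | "n = 4" | "n = 5" | "n = 6" | "n = 1 \<or> n \<ge> 7" using assms(2) by linarith
  then show ?thesis
  proof cases
    case 1 then show ?thesis using max_rdim_2[OF assms(1)] by (simp add: b_def)
  next
    case 2 then show ?thesis using checkerboard[of 12] by (simp add: b_def binom)
  next
    case 3 then show ?thesis using checkerboard[of 24] by (simp add: b_def binom)
  next
    case 4 then show ?thesis using checkerboard[of 40] by (simp add: b_def binom)
  next
    case 5 then show ?thesis using max_rdim_6[OF assms(1)] by (simp add: b_def)
  next
    case 6
    then have "b n = 2 ^ n" by (auto simp: b_def)
    then show ?thesis using max_rdim_ge_power2[OF assms(1), of n] assms(2) by simp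
  qed
qed

end
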